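(* Let $(\mathcal V,\sigma)$ be a braided tensor category, $\mathcal C$ a $\mathcal V$-central tensor category via a right exact functor $G:\mathcal V\to\mathcal Z(\mathcal C)$, and $\mathcal M$ a left $\mathcal C$-module category. Let $A_{\mathcal V,\mathcal M}=\mathcal Z_{\mathcal C}(\bar\rho)(\mathrm{Id}_{\mathcal M})\in\mathcal Z^{\mathcal V}(\mathcal C)$ with dinatural transformations $\pi_M:A_{\mathcal V,\mathcal M}\to\underline{\mathrm{Hom}}(M,M)$, and let $e_M:A_{\mathcal V,\mathcal M}\triangleright M\to M$ be $e_M=\phi^{\underline{\mathrm{Hom}}(M,M)}_{M,M}(\mathrm{id})\,(\pi_M\triangleright\mathrm{id}_M)$. Then $(A_{\mathcal V,\mathcal M},e)$ is a terminal object in the category of pairs $((Z,\sigma^Z),z)$, where $(Z,\sigma^Z)\in\mathcal Z^{\mathcal V}(\mathcal C)$ and $z_M:Z\triangleright M\to M$ is a natural transformation satisfying, for all $X\in\mathcal C$, $M\in\mathcal M$, $$z_{X\triangleright M}\,m_{Z,X,M}=(\mathrm{id}_X\triangleright z_M)\,m_{X,Z,M}\,(\sigma^Z_X\triangleright\mathrm{id}_M):(Z\otimes X)\triangleright M\to X\triangleright M,$$ a morphism $((Z,\sigma^Z),z)\to((Z',\sigma^{Z'}),z')$ being a morphism $f:Z\to Z'$ in $\mathcal Z^{\mathcal V}(\mathcal C)$ with $z'_M(f\triangleright\mathrm{id}_M)=z_M$ for all $M$.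
   Context: Conventions: $\Bbbk$ is an algebraically closed field; all categories are finite abelian $\Bbbk$-linear; monoidal categories are strict; tensor categories are finite, rigid, with simple unit $\mathbf 1$. Duals: $\mathrm{ev}_X:X^*\otimes X\to\mathbf 1$. A left $\mathcal C$-module category has an action $\triangleright$, bilinear and exact in each variable, with associativity isomorphisms $m_{X,Y,M}:(X\otimes Y)\triangleright M\to X\triangleright(Y\triangleright M)$ (suppressed below). Center: objects of $\mathcal Z(\mathcal C)$ are pairs $(A,\sigma_{A,-})$ with natural isomorphisms $\sigma_{A,X}:A\otimes X\to X\otimes A$, $\sigma_{A,X\otimes Y}=(\mathrm{id}_X\otimes\sigma_{A,Y})(\sigma_{A,X}\otimes\mathrm{id}_Y)$; the braiding is $\sigma_{A,B}$. $\mathcal C$ is $\mathcal V$-central if there is a faithful braided monoidal functor $G:\mathcal V\to\mathcal Z(\mathcal C)$; $\sigma_{G(V),X}$ is the half-braiding of $G(V)$; identify $G(V^* )=G(V)^*$. $\mathcal Z^{\mathcal V}(\mathcal C)$ is the full subcategory of $\mathcal Z(\mathcal C)$ of objects with $\sigma_{G(V),A}\sigma_{A,G(V)}=\mathrm{id}$ for all $V\in\mathcal V$. $\mathcal M$ is a $\mathcal V$-module category via $V\blacktriangleright M:=G(V)\triangleright M$. $\mathrm{End}_{\mathcal V}(\mathcal M)$ is the category of right exact $\mathcal V$-module endofunctors $(F,d)$, $d_{V,M}:F(V\blacktriangleright M)\to V\blacktriangleright F(M)$, with natural module transformations. It is a $\mathcal C$-bimodule category by $(X\triangleright F)(M)=X\triangleright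 F(M)$, $(F\triangleleft X)(M)=F(X\triangleright M)$, with $(X\triangleright d)_{V,M}=(\sigma_{G(V),X}^{-1}\triangleright\mathrm{id})(\mathrm{id}_X\triangleright d_{V,M})$, $(d\triangleleft X)_{V,M}=d_{V,X\triangleright M}F(\sigma_{G(V),X}^{-1}\triangleright\mathrm{id}_M)$. $\rho:\mathcal C\to\mathrm{End}_{\mathcal V}(\mathcal M)$, $\rho(X)=X\triangleright-$ with structure $\sigma_{G(V),X}^{-1}\triangleright\mathrm{id}_M$, is a $\mathcal C$-bimodule functor. Internal Hom: $\underline{\mathrm{Hom}}(M,N)\in\mathcal C$ represents $\mathrm{Hom}_{\mathcal M}(-\triangleright M,N)$, with natural isomorphisms $\phi^X_{M,N}:\mathrm{Hom}_{\mathcal C}(X,\underline{\mathrm{Hom}}(M,N))\to\mathrm{Hom}_{\mathcal M}(X\triangleright M,N)$. Relative end: for a functor $S:\mathcal M^{\mathrm{op}}\times\mathcal M\to\mathcal A$ with a $\mathcal V$-prebalancing (natural isomorphism) $\beta^V_{M,N}:S(M,V\blacktriangleright N)\to S(V^*\blacktriangleright M,N)$, $\oint_{M\in\mathcal M}(S,\beta)$ is the universal object $E$ with dinatural $\pi_M:E\to S(M,M)$ satisfying $S(\mathrm{ev}_V\blacktriangleright\mathrm{id}_M,\mathrm{id}_M)\pi_M=\beta^V_{V\blacktriangleright M,M}\pi_{V\blacktriangleright M}$. The functor $\bar\rho$: for $(F,d)$ and $f:X\triangleright M\to F(V\blacktriangleright N)$ put $\gamma^X_{V,M,N}(f)=(\mathrm{ev}_{G(V)}\triangleright\mathrm{id}_{F(N)})(\mathrm{id}_{G(V^*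 )}\triangleright d_{V,N}f)(\sigma_{G(V^* ),X}^{-1}\triangleright\mathrm{id}_M)$. With $E=\underline{\mathrm{Hom}}(M,F(V\blacktriangleright N))$, let $\beta^V_{M,N}:E\to\underline{\mathrm{Hom}}(V^*\blacktriangleright M,F(N))$ be the unique morphism with $\phi^E_{V^*\blacktriangleright M,F(N)}(\beta^V_{M,N})=\gamma^E_{V,M,N}(\phi^E_{M,F(V\blacktriangleright N)}(\mathrm{id}_E))$. Then $\bar\rho(F,d)=\oint_{M}(\underline{\mathrm{Hom}}(M,F(M)),\beta)$; it is right adjoint to $\rho$, with unit $h$ and counit $e$. It is a $\mathcal C$-bimodule functor with $r_{F,X}:\bar\rho(F\triangleleft X)\to\bar\rho(F)\otimes X$, $l_{X,F}:\bar\rho(X\triangleright F)\to X\otimes\bar\rho(F)$, $r_{F,X}^{-1}=\bar\rho(e_F\triangleleft\mathrm{id}_X)h_{\bar\rho(F)\otimes X}$, $l_{X,F}^{-1}=\bar\rho(\mathrm{id}_X\triangleright e_F)h_{X\otimes\bar\rho(F)}$. For $(F,d)\in\mathrm{End}_{\mathcal V}(\mathcal M)$ with a $\mathcal C$-module structure $c$ such that $c_{G(V),M}=d_{V,M}$, $\mathcal Z_{\mathcal C}(\bar\rho)(F,c,d)$ is the object $\bar\rho(F,d)$ with half-braiding $l_{X,F}\bar\rho(c_X)r_{F,X}^{-1}$; it lies in $\mathcal Z^{\mathcal V}(\mathcal C)$. Here it is applied to $F=\mathrm{Id}_{\mathcal M}$ with identity structures. *)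

theory Defs
  imports "HOL-Algebra.Algebraic_Closure"
begin

text \<open>The library reserves the token \<open>X\<close> for the polynomial indeterminate.\<close>

no_notation var (\<open>X\<index>\<close>)

section \<open>Categories\<close>

record ('o, 'a) cat =
  Ob :: "'o set"
  Arr :: "'a set"
  Dom :: "'a \<Rightarrow> 'o"
  Cod :: "'a \<Rightarrow> 'o"
  Comp :: "'a \<Rightarrow> 'a \<Rightarrow> 'a"  (infixr \<open>\<cdot>\<index>\<close> 75)
  Ide :: "'o \<Rightarrow> 'a"

definition Hom :: "('o, 'a, 'm) cat_scheme \<Rightarrow> 'o \<Rightarrow> 'o \<Rightarrow> 'a set" where
  "Hom C X Y = {f \<in> Arr C. Dom C f = X \<and> Cod C f = Y}"

locale category =
  fixes C :: "('o, 'a, 'm) cat_scheme" (structure)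
  assumes dom_ob: "f \<in> Arr C \<Longrightarrow> Dom C f \<in> Ob C"
    and cod_ob: "f \<in> Arr C \<Longrightarrow> Cod C f \<in> Ob C"
    and ide_hom: "X \<in> Ob C \<Longrightarrow> Ide C X \<in> Hom C X X"
    and comp_hom: "\<lbrakk>f \<in> Hom C X Y; g \<in> Hom C Y Z\<rbrakk> \<Longrightarrow> g \<cdot> f \<in> Hom C X Z"
    and comp_ide_right: "f \<in> Hom C X Y \<Longrightarrow> f \<cdot> Ide C X = f"
    and comp_ide_left: "f \<in> Hom C X Y \<Longrightarrow> Ide C Y \<cdot> f = f"
    and comp_assoc: "\<lbrakk>f \<in> Hom C W X; g \<in> Hom C X Y; h \<in> Hom C Y Z\<rbrakk>
      \<Longrightarrow> (h \<cdot> g) \<cdot> f = h \<cdot> (g \<cdot> f)"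

definition is_inverse :: "('o, 'a, 'm) cat_scheme \<Rightarrow> 'a \<Rightarrow> 'a \<Rightarrow> bool" where
  "is_inverse C f g \<longleftrightarrow> f \<in> Arr C \<and> g \<in> Hom C (Cod C f) (Dom C f)
     \<and> g \<cdot>\<^bsub>C\<^esub> f = Ide C (Dom C f) \<and> f \<cdot>\<^bsub>C\<^esub> g = Ide C (Cod C f)"

definition is_iso :: "('o, 'a, 'm) cat_scheme \<Rightarrow> 'a \<Rightarrow> bool" where
  "is_iso C f \<longleftrightarrow> (\<exists>g. is_inverse C f g)"

definition inv_arr :: "('o, 'a, 'm) cat_scheme \<Rightarrow> 'a \<Rightarrow> 'a" where
  "inv_arr C f = (THE g. is_inverse C f g)"

definition is_mono :: "('o, 'a, 'm) cat_scheme \<Rightarrow> 'a \<Rightarrow> bool" where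
  "is_mono C f \<longleftrightarrow> f \<in> Arr C \<and>
     (\<forall>W. \<forall>g\<in>Hom C W (Dom C f). \<forall>h\<in>Hom C W (Dom C f). f \<cdot>\<^bsub>C\<^esub> g = f \<cdot>\<^bsub>C\<^esub> h \<longrightarrow> g = h)"

definition is_epi :: "('o, 'a, 'm) cat_scheme \<Rightarrow> 'a \<Rightarrow> bool" where
  "is_epi C f \<longleftrightarrow> f \<in> Arr C \<and>
     (\<forall>W. \<forall>g\<in>Hom C (Cod C f) W. \<forall>h\<in>Hom C (Cod C f) W. g \<cdot>\<^bsub>C\<^esub> f = h \<cdot>\<^bsub>C\<^esub> f \<longrightarrow> g = h)"

definition terminal :: "('o, 'a, 'm) cat_scheme \<Rightarrow> 'o \<Rightarrow> bool" where
  "terminal C T \<longleftrightarrow> T \<in> Ob C \<and> (\<forall>X\<in>Ob C. \<exists>!f. f \<in> Hom C X T)"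

definition zero_object :: "('o, 'a, 'm) cat_scheme \<Rightarrow> 'o \<Rightarrow> bool" where
  "zero_object C Z \<longleftrightarrow> terminal C Z \<and> (\<forall>X\<in>Ob C. \<exists>!f. f \<in> Hom C Z X)"

definition full_subcat :: "('o, 'a, 'm) cat_scheme \<Rightarrow> 'o set \<Rightarrow> ('o, 'a, 'm) cat_scheme" where
  "full_subcat C S = C\<lparr>Ob := S, Arr := {f \<in> Arr C. Dom C f \<in> S \<and> Cod C f \<in> S}\<rparr>"

record ('o, 'a, 'p, 'b) func =
  FO :: "'o \<Rightarrow> 'p"
  FA :: "'a \<Rightarrow> 'b"

definition is_functor ::
    "('o, 'a, 'm) cat_scheme \<Rightarrow> ('p, 'b, 'n) cat_scheme \<Rightarrow> ('o, 'a, 'p, 'b, 'x) func_scheme \<Rightarrow> bool" where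
  "is_functor C D F \<longleftrightarrow>
     (\<forall>X\<in>Ob C. FO F X \<in> Ob D) \<and>
     (\<forall>X Y. \<forall>f\<in>Hom C X Y. FA F f \<in> Hom D (FO F X) (FO F Y)) \<and>
     (\<forall>X\<in>Ob C. FA F (Ide C X) = Ide D (FO F X)) \<and>
     (\<forall>X Y Z. \<forall>f\<in>Hom C X Y. \<forall>g\<in>Hom C Y Z. FA F (g \<cdot>\<^bsub>C\<^esub> f) = FA F g \<cdot>\<^bsub>D\<^esub> FA F f)"

definition faithful ::
    "('o, 'a, 'm) cat_scheme \<Rightarrow> ('o, 'a, 'p, 'b, 'x) func_scheme \<Rightarrow> bool" where
  "faithful C F \<longleftrightarrow> (\<forall>X Y. inj_on (FA F) (Hom C X Y))"

section \<open>Finite abelian linear categories\<close>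

record ('k, 'o, 'a) lincat = "('o, 'a) cat" +
  Add :: "'a \<Rightarrow> 'a \<Rightarrow> 'a"
  Zero :: "'o \<Rightarrow> 'o \<Rightarrow> 'a"
  Scale :: "'k \<Rightarrow> 'a \<Rightarrow> 'a"

text \<open>The ring multiplication and its unit are irrelevant fields of the record type of modules.\<close>

definition hom_space :: "('k, 'o, 'a, 'm) lincat_scheme \<Rightarrow> 'o \<Rightarrow> 'o \<Rightarrow> ('k, 'a) module" where
  "hom_space C X Y = \<lparr>carrier = Hom C X Y, monoid.mult = undefined, one = undefined,
     zero = Zero C X Y, add = Add C, smult = Scale C\<rparr>"

locale linear_category = category C + field K
  for K :: "('k, 'r) ring_scheme" and C :: "('k, 'o, 'a, 'm) lincat_scheme" (structure) +
  assumes hom_module: "\<lbrakk>X \<in> Ob C; Y \<in> Ob C\<rbrakk> \<Longrightarrow> module K (hom_space C X Y)"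
    and comp_add_left: "\<lbrakk>f \<in> Hom C X Y; g \<in> Hom C Y Z; g' \<in> Hom C Y Z\<rbrakk>
      \<Longrightarrow> Add C g g' \<cdot> f = Add C (g \<cdot> f) (g' \<cdot> f)"
    and comp_add_right: "\<lbrakk>f \<in> Hom C X Y; f' \<in> Hom C X Y; g \<in> Hom C Y Z\<rbrakk>
      \<Longrightarrow> g \<cdot> Add C f f' = Add C (g \<cdot> f) (g \<cdot> f')"
    and comp_scale_left: "\<lbrakk>a \<in> carrier K; f \<in> Hom C X Y; g \<in> Hom C Y Z\<rbrakk>
      \<Longrightarrow> Scale C a g \<cdot> f = Scale C a (g \<cdot> f)"
    and comp_scale_right: "\<lbrakk>a \<in> carrier K; f \<in> Hom C X Y; g \<in> Hom C Y Z\<rbrakk>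
      \<Longrightarrow> g \<cdot> Scale C a f = Scale C a (g \<cdot> f)"

definition is_kernel :: "('k, 'o, 'a, 'm) lincat_scheme \<Rightarrow> 'a \<Rightarrow> 'a \<Rightarrow> bool" where
  "is_kernel C f k \<longleftrightarrow> f \<in> Arr C \<and> k \<in> Arr C \<and> Cod C k = Dom C f \<and>
     f \<cdot>\<^bsub>C\<^esub> k = Zero C (Dom C k) (Cod C f) \<and>
     (\<forall>W. \<forall>g\<in>Hom C W (Dom C f). f \<cdot>\<^bsub>C\<^esub> g = Zero C W (Cod C f)
        \<longrightarrow> (\<exists>!u. u \<in> Hom C W (Dom C k) \<and> k \<cdot>\<^bsub>C\<^esub> u = g))"

definition is_cokernel :: "('k, 'o, 'a, 'm) lincat_scheme \<Rightarrow> 'a \<Rightarrow> 'a \<Rightarrow> bool" where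
  "is_cokernel C f q \<longleftrightarrow> f \<in> Arr C \<and> q \<in> Arr C \<and> Dom C q = Cod C f \<and>
     q \<cdot>\<^bsub>C\<^esub> f = Zero C (Dom C f) (Cod C q) \<and>
     (\<forall>W. \<forall>g\<in>Hom C (Cod C f) W. g \<cdot>\<^bsub>C\<^esub> f = Zero C (Dom C f) W
        \<longrightarrow> (\<exists>!u. u \<in> Hom C (Cod C q) W \<and> u \<cdot>\<^bsub>C\<^esub> q = g))"

locale abelian_category = linear_category K C
  for K :: "('k, 'r) ring_scheme" and C :: "('k, 'o, 'a, 'm) lincat_scheme" (structure) +
  assumes zero_object_exists: "\<exists>Z. zero_object C Z"
    and biproducts: "\<lbrakk>X \<in> Ob C; Y \<in> Ob C\<rbrakk> \<Longrightarrow>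
      \<exists>P\<in>Ob C. \<exists>i\<in>Hom C X P. \<exists>j\<in>Hom C Y P. \<exists>p\<in>Hom C P X. \<exists>q\<in>Hom C P Y.
        p \<cdot> i = Ide C X \<and> q \<cdot> j = Ide C Y \<and> p \<cdot> j = Zero C Y X \<and> q \<cdot> i = Zero C X Y
        \<and> Add C (i \<cdot> p) (j \<cdot> q) = Ide C P"
    and kernels: "f \<in> Arr C \<Longrightarrow> \<exists>k. is_kernel C f k"
    and cokernels: "f \<in> Arr C \<Longrightarrow> \<exists>q. is_cokernel C f q"
    and mono_normal: "is_mono C k \<Longrightarrow> \<exists>f. is_kernel C f k"
    and epi_normal: "is_epi C q \<Longrightarrow> \<exists>f. is_cokernel C f q"

definition is_simple :: "('o, 'a, 'm) cat_scheme \<Rightarrow> 'o \<Rightarrow> bool" where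
  "is_simple C X \<longleftrightarrow> X \<in> Ob C \<and> \<not> zero_object C X \<and>
     (\<forall>f. is_mono C f \<and> Cod C f = X \<longrightarrow> zero_object C (Dom C f) \<or> is_iso C f)"

definition is_projective :: "('o, 'a, 'm) cat_scheme \<Rightarrow> 'o \<Rightarrow> bool" where
  "is_projective C P \<longleftrightarrow> P \<in> Ob C \<and>
     (\<forall>q. is_epi C q \<longrightarrow> (\<forall>f\<in>Hom C P (Cod C q). \<exists>g\<in>Hom C P (Dom C q). q \<cdot>\<^bsub>C\<^esub> g = f))"

inductive finite_length :: "('k, 'o, 'a, 'm) lincat_scheme \<Rightarrow> 'o \<Rightarrow> bool"
  for C :: "('k, 'o, 'a, 'm) lincat_scheme" where
  zero: "zero_object C X \<Longrightarrow> finite_length C X"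
| extend: "\<lbrakk>finite_length C (Dom C k); is_kernel C q k; is_cokernel C k q; is_simple C (Cod C q)\<rbrakk>
    \<Longrightarrow> finite_length C (Cod C k)"

locale finite_abelian_category = abelian_category K C
  for K :: "('k, 'r) ring_scheme" and C :: "('k, 'o, 'a, 'm) lincat_scheme" (structure) +
  assumes alg_closed: "algebraically_closed K"
    and hom_finite_dim: "\<lbrakk>X \<in> Ob C; Y \<in> Ob C\<rbrakk> \<Longrightarrow>
      \<exists>B. finite B \<and> B \<subseteq> Hom C X Y \<and>
        (\<forall>f\<in>Hom C X Y. \<exists>c\<in>B \<rightarrow> carrier K. f = finsum (hom_space C X Y) (\<lambda>b. Scale C (c b) b) B)"
    and all_finite_length: "X \<in> Ob C \<Longrightarrow> finite_length C X"
    and enough_projectives: "X \<in> Ob C \<Longrightarrow>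
      \<exists>q. is_epi C q \<and> Cod C q = X \<and> is_projective C (Dom C q)"
    and finitely_many_simples: "\<exists>S\<subseteq>Ob C. finite S \<and>
      (\<forall>X. is_simple C X \<longrightarrow> (\<exists>Y\<in>S. \<exists>f\<in>Hom C X Y. is_iso C f))"

definition linear_functor ::
    "('k, 'r) ring_scheme \<Rightarrow> ('k, 'o, 'a, 'm) lincat_scheme \<Rightarrow> ('k, 'p, 'b, 'n) lincat_scheme
      \<Rightarrow> ('o, 'a, 'p, 'b, 'x) func_scheme \<Rightarrow> bool" where
  "linear_functor K C D F \<longleftrightarrow> is_functor C D F \<and>
     (\<forall>X Y. \<forall>f\<in>Hom C X Y. \<forall>g\<in>Hom C X Y. FA F (Add C f g) = Add D (FA F f) (FA F g)) \<and>
     (\<forall>X Y. \<forall>f\<in>Hom C X Y. \<forall>a\<in>carrier K. FA F (Scale C a f) = Scale D a (FA F f))"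

definition right_exact ::
    "('k, 'r) ring_scheme \<Rightarrow> ('k, 'o, 'a, 'm) lincat_scheme \<Rightarrow> ('k, 'p, 'b, 'n) lincat_scheme
      \<Rightarrow> ('o, 'a, 'p, 'b, 'x) func_scheme \<Rightarrow> bool" where
  "right_exact K C D F \<longleftrightarrow> linear_functor K C D F \<and>
     (\<forall>f q. is_cokernel C f q \<longrightarrow> is_cokernel D (FA F f) (FA F q))"

definition left_exact ::
    "('k, 'r) ring_scheme \<Rightarrow> ('k, 'o, 'a, 'm) lincat_scheme \<Rightarrow> ('k, 'p, 'b, 'n) lincat_scheme
      \<Rightarrow> ('o, 'a, 'p, 'b, 'x) func_scheme \<Rightarrow> bool" where
  "left_exact K C D F \<longleftrightarrow> linear_functor K C D F \<and>
     (\<forall>f k. is_kernel C f k \<longrightarrow> is_kernel D (FA F f) (FA F k))"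

section \<open>Tensor categories\<close>

record ('k, 'o, 'a) moncat = "('k, 'o, 'a) lincat" +
  TensO :: "'o \<Rightarrow> 'o \<Rightarrow> 'o"  (infixr \<open>\<otimes>\<^sub>o\<index>\<close> 80)
  TensA :: "'a \<Rightarrow> 'a \<Rightarrow> 'a"  (infixr \<open>\<otimes>\<^sub>a\<index>\<close> 80)
  Unit :: "'o"

text \<open>\<^term>\<open>left_dual C X Y e c\<close>: the object \<open>Y\<close> is a left dual of \<open>X\<close>,
  with evaluation \<open>e : Y \<otimes> X \<rightarrow> 1\<close> and coevaluation \<open>c : 1 \<rightarrow> X \<otimes> Y\<close>.\<close>

definition left_dual :: "('k, 'o, 'a, 'm) moncat_scheme \<Rightarrow> 'o \<Rightarrow> 'o \<Rightarrow> 'a \<Rightarrow> 'a \<Rightarrow> bool" where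
  "left_dual C X Y e c \<longleftrightarrow> X \<in> Ob C \<and> Y \<in> Ob C \<and>
     e \<in> Hom C (Y \<otimes>\<^sub>o\<^bsub>C\<^esub> X) (Unit C) \<and> c \<in> Hom C (Unit C) (X \<otimes>\<^sub>o\<^bsub>C\<^esub> Y) \<and>
     (Ide C X \<otimes>\<^sub>a\<^bsub>C\<^esub> e) \<cdot>\<^bsub>C\<^esub> (c \<otimes>\<^sub>a\<^bsub>C\<^esub> Ide C X) = Ide C X \<and>
     (e \<otimes>\<^sub>a\<^bsub>C\<^esub> Ide C Y) \<cdot>\<^bsub>C\<^esub> (Ide C Y \<otimes>\<^sub>a\<^bsub>C\<^esub> c) = Ide C Y"

locale tensor_category = finite_abelian_category K C
  for K :: "('k, 'r) ring_scheme" and C :: "('k, 'o, 'a, 'm) moncat_scheme" (structure) +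
  assumes tensO_ob: "\<lbrakk>X \<in> Ob C; Y \<in> Ob C\<rbrakk> \<Longrightarrow> X \<otimes>\<^sub>o Y \<in> Ob C"
    and unit_ob: "Unit C \<in> Ob C"
    and tensA_hom: "\<lbrakk>f \<in> Hom C X X'; g \<in> Hom C Y Y'\<rbrakk>
      \<Longrightarrow> f \<otimes>\<^sub>a g \<in> Hom C (X \<otimes>\<^sub>o Y) (X' \<otimes>\<^sub>o Y')"
    and tensA_ide: "\<lbrakk>X \<in> Ob C; Y \<in> Ob C\<rbrakk> \<Longrightarrow> Ide C X \<otimes>\<^sub>a Ide C Y = Ide C (X \<otimes>\<^sub>o Y)"
    and tensA_comp: "\<lbrakk>f \<in> Hom C X Y; g \<in> Hom C Y Z; f' \<in> Hom C X' Y'; g' \<in> Hom C Y' Z'\<rbrakk>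
      \<Longrightarrow> (g \<cdot> f) \<otimes>\<^sub>a (g' \<cdot> f') = (g \<otimes>\<^sub>a g') \<cdot> (f \<otimes>\<^sub>a f')"
    and tensO_assoc: "\<lbrakk>X \<in> Ob C; Y \<in> Ob C; Z \<in> Ob C\<rbrakk>
      \<Longrightarrow> (X \<otimes>\<^sub>o Y) \<otimes>\<^sub>o Z = X \<otimes>\<^sub>o (Y \<otimes>\<^sub>o Z)"
    and tensA_assoc: "\<lbrakk>f \<in> Arr C; g \<in> Arr C; h \<in> Arr C\<rbrakk>
      \<Longrightarrow> (f \<otimes>\<^sub>a g) \<otimes>\<^sub>a h = f \<otimes>\<^sub>a (g \<otimes>\<^sub>a h)"
    and tensO_unit: "X \<in> Ob C \<Longrightarrow> Unit C \<otimes>\<^sub>o X = X \<and> X \<otimes>\<^sub>o Unit C = X"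
    and tensA_unit: "f \<in> Arr C \<Longrightarrow> Ide C (Unit C) \<otimes>\<^sub>a f = f \<and> f \<otimes>\<^sub>a Ide C (Unit C) = f"
    and tens_linear_right: "X \<in> Ob C \<Longrightarrow>
      linear_functor K C C \<lparr>FO = \<lambda>Y. X \<otimes>\<^sub>o Y, FA = \<lambda>f. Ide C X \<otimes>\<^sub>a f\<rparr>"
    and tens_linear_left: "Y \<in> Ob C \<Longrightarrow>
      linear_functor K C C \<lparr>FO = \<lambda>X. X \<otimes>\<^sub>o Y, FA = \<lambda>f. f \<otimes>\<^sub>a Ide C Y\<rparr>"
    and left_duals: "X \<in> Ob C \<Longrightarrow> \<exists>Y e c. left_dual C X Y e c"
    and right_duals: "X \<in> Ob C \<Longrightarrow> \<exists>Y e c. left_dual C Y X e c"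
    and unit_simple: "is_simple C (Unit C)"

text \<open>A choice \<open>X \<mapsto> (X\<^sup>*, ev)\<close> of left duals.\<close>

record ('o, 'a) duality =
  Dual :: "'o \<Rightarrow> 'o"
  Ev :: "'o \<Rightarrow> 'a"

definition left_duality :: "('k, 'o, 'a, 'm) moncat_scheme \<Rightarrow> ('o, 'a) duality \<Rightarrow> bool" where
  "left_duality C D \<longleftrightarrow> (\<forall>X\<in>Ob C. \<exists>c. left_dual C X (Dual D X) (Ev D X) c)"

record ('k, 'o, 'a) brcat = "('k, 'o, 'a) moncat" +
  Braid :: "'o \<Rightarrow> 'o \<Rightarrow> 'a"

locale braided_tensor_category = tensor_category K C
  for K :: "('k, 'r) ring_scheme" and C :: "('k, 'o, 'a, 'm) brcat_scheme" (structure) +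
  assumes braid_hom: "\<lbrakk>X \<in> Ob C; Y \<in> Ob C\<rbrakk> \<Longrightarrow>
      Braid C X Y \<in> Hom C (X \<otimes>\<^sub>o Y) (Y \<otimes>\<^sub>o X) \<and> is_iso C (Braid C X Y)"
    and braid_natural: "\<lbrakk>f \<in> Hom C X X'; g \<in> Hom C Y Y'\<rbrakk>
      \<Longrightarrow> (g \<otimes>\<^sub>a f) \<cdot> Braid C X Y = Braid C X' Y' \<cdot> (f \<otimes>\<^sub>a g)"
    and braid_tens_right: "\<lbrakk>X \<in> Ob C; Y \<in> Ob C; Z \<in> Ob C\<rbrakk> \<Longrightarrow>
      Braid C X (Y \<otimes>\<^sub>o Z) = (Ide C Y \<otimes>\<^sub>a Braid C X Z) \<cdot> (Braid C X Y \<otimes>\<^sub>a Ide C Z)"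
    and braid_tens_left: "\<lbrakk>X \<in> Ob C; Y \<in> Ob C; Z \<in> Ob C\<rbrakk> \<Longrightarrow>
      Braid C (X \<otimes>\<^sub>o Y) Z = (Braid C X Z \<otimes>\<^sub>a Ide C Y) \<cdot> (Ide C X \<otimes>\<^sub>a Braid C Y Z)"

text \<open>Monoidal functors are strong: \<open>MulIso F X Y : F X \<otimes> F Y \<rightarrow> F (X \<otimes> Y)\<close> and
  \<open>UnitIso F : 1 \<rightarrow> F 1\<close> are isomorphisms. The coherence conditions are those between strict
  monoidal categories.\<close>

record ('o, 'a, 'p, 'b) monfunc = "('o, 'a, 'p, 'b) func" +
  MulIso :: "'o \<Rightarrow> 'o \<Rightarrow> 'b"
  UnitIso :: "'b"

definition monoidal_functor ::
    "('k, 'o, 'a, 'm) moncat_scheme \<Rightarrow> ('k, 'p, 'b, 'n) moncat_scheme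
      \<Rightarrow> ('o, 'a, 'p, 'b, 'x) monfunc_scheme \<Rightarrow> bool" where
  "monoidal_functor C D F \<longleftrightarrow> is_functor C D F \<and>
     (\<forall>X\<in>Ob C. \<forall>Y\<in>Ob C.
        MulIso F X Y \<in> Hom D (FO F X \<otimes>\<^sub>o\<^bsub>D\<^esub> FO F Y) (FO F (X \<otimes>\<^sub>o\<^bsub>C\<^esub> Y)) \<and> is_iso D (MulIso F X Y)) \<and>
     (\<forall>f\<in>Arr C. \<forall>g\<in>Arr C.
        FA F (f \<otimes>\<^sub>a\<^bsub>C\<^esub> g) \<cdot>\<^bsub>D\<^esub> MulIso F (Dom C f) (Dom C g)
          = MulIso F (Cod C f) (Cod C g) \<cdot>\<^bsub>D\<^esub> (FA F f \<otimes>\<^sub>a\<^bsub>D\<^esub> FA F g)) \<and>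
     (\<forall>X\<in>Ob C. \<forall>Y\<in>Ob C. \<forall>Z\<in>Ob C.
        MulIso F (X \<otimes>\<^sub>o\<^bsub>C\<^esub> Y) Z \<cdot>\<^bsub>D\<^esub> (MulIso F X Y \<otimes>\<^sub>a\<^bsub>D\<^esub> Ide D (FO F Z))
          = MulIso F X (Y \<otimes>\<^sub>o\<^bsub>C\<^esub> Z) \<cdot>\<^bsub>D\<^esub> (Ide D (FO F X) \<otimes>\<^sub>a\<^bsub>D\<^esub> MulIso F Y Z)) \<and>
     UnitIso F \<in> Hom D (Unit D) (FO F (Unit C)) \<and> is_iso D (UnitIso F) \<and>
     (\<forall>X\<in>Ob C.
        MulIso F (Unit C) X \<cdot>\<^bsub>D\<^esub> (UnitIso F \<otimes>\<^sub>a\<^bsub>D\<^esub> Ide D (FO F X)) = Ide D (FO F X) \<and>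
        MulIso F X (Unit C) \<cdot>\<^bsub>D\<^esub> (Ide D (FO F X) \<otimes>\<^sub>a\<^bsub>D\<^esub> UnitIso F) = Ide D (FO F X))"

definition braided_monoidal_functor ::
    "('k, 'o, 'a, 'm) brcat_scheme \<Rightarrow> ('k, 'p, 'b, 'n) brcat_scheme
      \<Rightarrow> ('o, 'a, 'p, 'b, 'x) monfunc_scheme \<Rightarrow> bool" where
  "braided_monoidal_functor C D F \<longleftrightarrow> monoidal_functor C D F \<and>
     (\<forall>X\<in>Ob C. \<forall>Y\<in>Ob C.
        FA F (Braid C X Y) \<cdot>\<^bsub>D\<^esub> MulIso F X Y = MulIso F Y X \<cdot>\<^bsub>D\<^esub> Braid D (FO F X) (FO F Y))"

section \<open>The Drinfeld center\<close>

text \<open>An object of the center is a pair \<open>(A, s)\<close> with \<open>s X : A \<otimes> X \<rightarrow> X \<otimes> A\<close>; the function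
  \<open>s\<close> is normalised to \<open>undefined\<close> outside \<open>Ob C\<close>. A morphism carries its source and target,
  so that hom-sets are disjoint.\<close>

type_synonym ('o, 'a) cob = "'o \<times> ('o \<Rightarrow> 'a)"
type_synonym ('o, 'a) carr = "('o, 'a) cob \<times> 'a \<times> ('o, 'a) cob"

definition half_braiding :: "('k, 'o, 'a, 'm) moncat_scheme \<Rightarrow> 'o \<Rightarrow> ('o \<Rightarrow> 'a) \<Rightarrow> bool" where
  "half_braiding C A s \<longleftrightarrow> A \<in> Ob C \<and> s \<in> extensional (Ob C) \<and>
     (\<forall>X\<in>Ob C. s X \<in> Hom C (A \<otimes>\<^sub>o\<^bsub>C\<^esub> X) (X \<otimes>\<^sub>o\<^bsub>C\<^esub> A) \<and> is_iso C (s X)) \<and>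
     (\<forall>f\<in>Arr C. (f \<otimes>\<^sub>a\<^bsub>C\<^esub> Ide C A) \<cdot>\<^bsub>C\<^esub> s (Dom C f) = s (Cod C f) \<cdot>\<^bsub>C\<^esub> (Ide C A \<otimes>\<^sub>a\<^bsub>C\<^esub> f)) \<and>
     (\<forall>X\<in>Ob C. \<forall>Y\<in>Ob C. s (X \<otimes>\<^sub>o\<^bsub>C\<^esub> Y) =
        (Ide C X \<otimes>\<^sub>a\<^bsub>C\<^esub> s Y) \<cdot>\<^bsub>C\<^esub> (s X \<otimes>\<^sub>a\<^bsub>C\<^esub> Ide C Y))"

definition center_tensO ::
    "('k, 'o, 'a, 'm) moncat_scheme \<Rightarrow> ('o, 'a) cob \<Rightarrow> ('o, 'a) cob \<Rightarrow> ('o, 'a) cob" where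
  "center_tensO C = (\<lambda>(A, s) (B, t). (A \<otimes>\<^sub>o\<^bsub>C\<^esub> B,
     \<lambda>X\<in>Ob C. (s X \<otimes>\<^sub>a\<^bsub>C\<^esub> Ide C B) \<cdot>\<^bsub>C\<^esub> (Ide C A \<otimes>\<^sub>a\<^bsub>C\<^esub> t X)))"

definition center ::
    "('k, 'o, 'a, 'm) moncat_scheme \<Rightarrow> ('k, ('o, 'a) cob, ('o, 'a) carr) brcat" where
  "center C = \<lparr>
     Ob = {(A, s). half_braiding C A s},
     Arr = {((A, s), f, (B, t)). half_braiding C A s \<and> half_braiding C B t \<and> f \<in> Hom C A B \<and>
       (\<forall>X\<in>Ob C. (Ide C X \<otimes>\<^sub>a\<^bsub>C\<^esub> f) \<cdot>\<^bsub>C\<^esub> s X = t X \<cdot>\<^bsub>C\<^esub> (f \<otimes>\<^sub>a\<^bsub>C\<^esub> Ide C X))},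
     Dom = (\<lambda>(P, f, Q). P),
     Cod = (\<lambda>(P, f, Q). Q),
     Comp = (\<lambda>(Q, g, R) (P, f, Q'). (P, g \<cdot>\<^bsub>C\<^esub> f, R)),
     Ide = (\<lambda>P. (P, Ide C (fst P), P)),
     Add = (\<lambda>(P, f, Q) (P', g, Q'). (P, Add C f g, Q)),
     Zero = (\<lambda>P Q. (P, Zero C (fst P) (fst Q), Q)),
     Scale = (\<lambda>a (P, f, Q). (P, Scale C a f, Q)),
     TensO = center_tensO C,
     TensA = (\<lambda>(P, f, Q) (P', f', Q'). (center_tensO C P P', f \<otimes>\<^sub>a\<^bsub>C\<^esub> f', center_tensO C Q Q')),
     Unit = (Unit C, \<lambda>X\<in>Ob C. Ide C X),
     Braid = (\<lambda>P Q. (center_tensO C P Q, snd P (fst Q), center_tensO C Q P))\<rparr>"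

definition center_arr :: "('o, 'a) carr \<Rightarrow> 'a" where
  "center_arr = (\<lambda>(P, f, Q). f)"

definition relative_center ::
    "('k, 'v, 'w, 'n) brcat_scheme \<Rightarrow> ('k, 'o, 'a, 'm) moncat_scheme
      \<Rightarrow> ('v, 'w, ('o, 'a) cob, ('o, 'a) carr) monfunc
      \<Rightarrow> ('k, ('o, 'a) cob, ('o, 'a) carr) brcat" where
  "relative_center V C G = full_subcat (center C)
     {A \<in> Ob (center C). \<forall>W\<in>Ob V.
        Braid (center C) (FO G W) A \<cdot>\<^bsub>center C\<^esub> Braid (center C) A (FO G W)
          = Ide (center C) (A \<otimes>\<^sub>o\<^bsub>center C\<^esub> FO G W)}"

section \<open>Module categories\<close>

text \<open>\<open>Assoc M X Y N : (X \<otimes> Y) \<rhd> N \<rightarrow> X \<rhd> (Y \<rhd> N)\<close> and \<open>LUnit M N : 1 \<rhd> N \<rightarrow> N\<close>.\<close>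

record ('k, 'o, 'a, 'mo, 'ma) modcat = "('k, 'mo, 'ma) lincat" +
  ActO :: "'o \<Rightarrow> 'mo \<Rightarrow> 'mo"  (infixr \<open>\<rhd>\<^sub>o\<index>\<close> 78)
  ActA :: "'a \<Rightarrow> 'ma \<Rightarrow> 'ma"  (infixr \<open>\<rhd>\<^sub>a\<index>\<close> 78)
  Assoc :: "'o \<Rightarrow> 'o \<Rightarrow> 'mo \<Rightarrow> 'ma"
  LUnit :: "'mo \<Rightarrow> 'ma"

locale module_category = C: tensor_category K C + finite_abelian_category K M
  for K :: "('k, 'r) ring_scheme" and C :: "('k, 'o, 'a, 'm) moncat_scheme"
    and M :: "('k, 'o, 'a, 'mo, 'ma, 'n) modcat_scheme" (structure) +
  assumes actO_ob: "\<lbrakk>X \<in> Ob C; N \<in> Ob M\<rbrakk> \<Longrightarrow> X \<rhd>\<^sub>o N \<in> Ob M"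
    and actA_hom: "\<lbrakk>f \<in> Hom C X X'; g \<in> Hom M N N'\<rbrakk> \<Longrightarrow> f \<rhd>\<^sub>a g \<in> Hom M (X \<rhd>\<^sub>o N) (X' \<rhd>\<^sub>o N')"
    and actA_ide: "\<lbrakk>X \<in> Ob C; N \<in> Ob M\<rbrakk> \<Longrightarrow> Ide C X \<rhd>\<^sub>a Ide M N = Ide M (X \<rhd>\<^sub>o N)"
    and actA_comp: "\<lbrakk>f \<in> Hom C X X'; f' \<in> Hom C X' X''; g \<in> Hom M N N'; g' \<in> Hom M N' N''\<rbrakk>
      \<Longrightarrow> (f' \<cdot>\<^bsub>C\<^esub> f) \<rhd>\<^sub>a (g' \<cdot> g) = (f' \<rhd>\<^sub>a g') \<cdot> (f \<rhd>\<^sub>a g)"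
    and act_exact_right: "X \<in> Ob C \<Longrightarrow>
      right_exact K M M \<lparr>FO = \<lambda>N. X \<rhd>\<^sub>o N, FA = \<lambda>g. Ide C X \<rhd>\<^sub>a g\<rparr> \<and>
      left_exact K M M \<lparr>FO = \<lambda>N. X \<rhd>\<^sub>o N, FA = \<lambda>g. Ide C X \<rhd>\<^sub>a g\<rparr>"
    and act_exact_left: "N \<in> Ob M \<Longrightarrow>
      right_exact K C M \<lparr>FO = \<lambda>X. X \<rhd>\<^sub>o N, FA = \<lambda>f. f \<rhd>\<^sub>a Ide M N\<rparr> \<and>
      left_exact K C M \<lparr>FO = \<lambda>X. X \<rhd>\<^sub>o N, FA = \<lambda>f. f \<rhd>\<^sub>a Ide M N\<rparr>"
    and assoc_hom: "\<lbrakk>X \<in> Ob C; Y \<in> Ob C; N \<in> Ob M\<rbrakk> \<Longrightarrow>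
      Assoc M X Y N \<in> Hom M ((X \<otimes>\<^sub>o\<^bsub>C\<^esub> Y) \<rhd>\<^sub>o N) (X \<rhd>\<^sub>o Y \<rhd>\<^sub>o N) \<and> is_iso M (Assoc M X Y N)"
    and assoc_natural: "\<lbrakk>f \<in> Hom C X X'; f' \<in> Hom C Y Y'; g \<in> Hom M N N'\<rbrakk> \<Longrightarrow>
      (f \<rhd>\<^sub>a f' \<rhd>\<^sub>a g) \<cdot> Assoc M X Y N = Assoc M X' Y' N' \<cdot> ((f \<otimes>\<^sub>a\<^bsub>C\<^esub> f') \<rhd>\<^sub>a g)"
    and assoc_pentagon: "\<lbrakk>X \<in> Ob C; Y \<in> Ob C; Z \<in> Ob C; N \<in> Ob M\<rbrakk> \<Longrightarrow>
      Assoc M X Y (Z \<rhd>\<^sub>o N) \<cdot> Assoc M (X \<otimes>\<^sub>o\<^bsub>C\<^esub> Y) Z N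
        = (Ide C X \<rhd>\<^sub>a Assoc M Y Z N) \<cdot> Assoc M X (Y \<otimes>\<^sub>o\<^bsub>C\<^esub> Z) N"
    and lunit_hom: "N \<in> Ob M \<Longrightarrow> LUnit M N \<in> Hom M (Unit C \<rhd>\<^sub>o N) N \<and> is_iso M (LUnit M N)"
    and lunit_natural: "g \<in> Hom M N N' \<Longrightarrow>
      g \<cdot> LUnit M N = LUnit M N' \<cdot> (Ide C (Unit C) \<rhd>\<^sub>a g)"
    and lunit_triangle: "\<lbrakk>X \<in> Ob C; N \<in> Ob M\<rbrakk> \<Longrightarrow>
      (Ide C X \<rhd>\<^sub>a LUnit M N) \<cdot> Assoc M X (Unit C) N = Ide M (X \<rhd>\<^sub>o N)"

text \<open>The \<open>\<V>\<close>-module category structure \<open>W \<^bold>\<rhd> N = G W \<rhd> N\<close> on \<open>M\<close>.\<close>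

definition restrict_module ::
    "('v, 'w, ('o, 'a) cob, ('o, 'a) carr) monfunc \<Rightarrow> ('k, 'o, 'a, 'm) moncat_scheme
      \<Rightarrow> ('k, 'o, 'a, 'mo, 'ma) modcat \<Rightarrow> ('k, 'v, 'w, 'mo, 'ma) modcat" where
  "restrict_module G C M = \<lparr>
     Ob = Ob M, Arr = Arr M, Dom = Dom M, Cod = Cod M, Comp = Comp M, Ide = Ide M,
     Add = Add M, Zero = Zero M, Scale = Scale M,
     ActO = (\<lambda>W N. fst (FO G W) \<rhd>\<^sub>o\<^bsub>M\<^esub> N),
     ActA = (\<lambda>w g. center_arr (FA G w) \<rhd>\<^sub>a\<^bsub>M\<^esub> g),
     Assoc = (\<lambda>U W N. Assoc M (fst (FO G U)) (fst (FO G W)) N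
       \<cdot>\<^bsub>M\<^esub> (inv_arr C (center_arr (MulIso G U W)) \<rhd>\<^sub>a\<^bsub>M\<^esub> Ide M N)),
     LUnit = (\<lambda>N. LUnit M N \<cdot>\<^bsub>M\<^esub> (inv_arr C (center_arr (UnitIso G)) \<rhd>\<^sub>a\<^bsub>M\<^esub> Ide M N))\<rparr>"

text \<open>Right exact module endofunctors \<open>(F, d)\<close> with \<open>d W N : F (W \<rhd> N) \<rightarrow> W \<rhd> F N\<close>.\<close>

definition module_endofunctor ::
    "('k, 'r) ring_scheme \<Rightarrow> ('k, 'v, 'w, 'm) moncat_scheme
      \<Rightarrow> ('k, 'v, 'w, 'mo, 'ma, 'n) modcat_scheme
      \<Rightarrow> ('mo, 'ma, 'mo, 'ma) func \<Rightarrow> ('v \<Rightarrow> 'mo \<Rightarrow> 'ma) \<Rightarrow> bool" where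
  "module_endofunctor K V N F d \<longleftrightarrow> right_exact K N N F \<and>
     (\<forall>W\<in>Ob V. \<forall>X\<in>Ob N.
        d W X \<in> Hom N (FO F (W \<rhd>\<^sub>o\<^bsub>N\<^esub> X)) (W \<rhd>\<^sub>o\<^bsub>N\<^esub> FO F X) \<and> is_iso N (d W X)) \<and>
     (\<forall>w\<in>Arr V. \<forall>f\<in>Arr N.
        d (Cod V w) (Cod N f) \<cdot>\<^bsub>N\<^esub> FA F (w \<rhd>\<^sub>a\<^bsub>N\<^esub> f)
          = (w \<rhd>\<^sub>a\<^bsub>N\<^esub> FA F f) \<cdot>\<^bsub>N\<^esub> d (Dom V w) (Dom N f)) \<and>
     (\<forall>U\<in>Ob V. \<forall>W\<in>Ob V. \<forall>X\<in>Ob N.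
        Assoc N U W (FO F X) \<cdot>\<^bsub>N\<^esub> d (U \<otimes>\<^sub>o\<^bsub>V\<^esub> W) X
          = (Ide V U \<rhd>\<^sub>a\<^bsub>N\<^esub> d W X) \<cdot>\<^bsub>N\<^esub> d U (W \<rhd>\<^sub>o\<^bsub>N\<^esub> X) \<cdot>\<^bsub>N\<^esub> FA F (Assoc N U W X)) \<and>
     (\<forall>X\<in>Ob N. LUnit N (FO F X) \<cdot>\<^bsub>N\<^esub> d (Unit V) X = FA F (LUnit N X))"

section \<open>Relative ends\<close>

text \<open>\<open>eval_act D N W X : W\<^sup>* \<rhd> (W \<rhd> X) \<rightarrow> X\<close> is \<open>ev\<^sub>W \<rhd> id\<close> with the associativity and unit
  isomorphisms of the module category inserted.\<close>

definition eval_act ::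
    "('v, 'w) duality \<Rightarrow> ('k, 'v, 'w, 'mo, 'ma, 'n) modcat_scheme \<Rightarrow> 'v \<Rightarrow> 'mo \<Rightarrow> 'ma" where
  "eval_act D N W X = LUnit N X \<cdot>\<^bsub>N\<^esub> (Ev D W \<rhd>\<^sub>a\<^bsub>N\<^esub> Ide N X) \<cdot>\<^bsub>N\<^esub> inv_arr N (Assoc N (Dual D W) W X)"

text \<open>\<open>SO\<close>, \<open>SA\<close> are the object and arrow part of \<open>S : N\<^sup>o\<^sup>p \<times> N \<rightarrow> A\<close>, the first argument being
  contravariant, and \<open>b W X Y : S X (W \<rhd> Y) \<rightarrow> S (W\<^sup>* \<rhd> X) Y\<close> is the prebalancing.\<close>

definition balanced_dinatural ::
    "('k, 'v, 'w, 'm) moncat_scheme \<Rightarrow> ('v, 'w) duality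
      \<Rightarrow> ('k, 'v, 'w, 'mo, 'ma, 'n) modcat_scheme \<Rightarrow> ('o, 'a, 'l) cat_scheme
      \<Rightarrow> ('mo \<Rightarrow> 'mo \<Rightarrow> 'o) \<Rightarrow> ('ma \<Rightarrow> 'ma \<Rightarrow> 'a) \<Rightarrow> ('v \<Rightarrow> 'mo \<Rightarrow> 'mo \<Rightarrow> 'a)
      \<Rightarrow> 'o \<Rightarrow> ('mo \<Rightarrow> 'a) \<Rightarrow> bool" where
  "balanced_dinatural V D N A SO SA b E p \<longleftrightarrow> E \<in> Ob A \<and>
     (\<forall>X\<in>Ob N. p X \<in> Hom A E (SO X X)) \<and>
     (\<forall>X Y. \<forall>f\<in>Hom N X Y. SA (Ide N X) f \<cdot>\<^bsub>A\<^esub> p X = SA f (Ide N Y) \<cdot>\<^bsub>A\<^esub> p Y) \<and>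
     (\<forall>W\<in>Ob V. \<forall>X\<in>Ob N.
        SA (eval_act D N W X) (Ide N X) \<cdot>\<^bsub>A\<^esub> p X = b W (W \<rhd>\<^sub>o\<^bsub>N\<^esub> X) X \<cdot>\<^bsub>A\<^esub> p (W \<rhd>\<^sub>o\<^bsub>N\<^esub> X))"

definition relative_end ::
    "('k, 'v, 'w, 'm) moncat_scheme \<Rightarrow> ('v, 'w) duality
      \<Rightarrow> ('k, 'v, 'w, 'mo, 'ma, 'n) modcat_scheme \<Rightarrow> ('o, 'a, 'l) cat_scheme
      \<Rightarrow> ('mo \<Rightarrow> 'mo \<Rightarrow> 'o) \<Rightarrow> ('ma \<Rightarrow> 'ma \<Rightarrow> 'a) \<Rightarrow> ('v \<Rightarrow> 'mo \<Rightarrow> 'mo \<Rightarrow> 'a)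
      \<Rightarrow> 'o \<Rightarrow> ('mo \<Rightarrow> 'a) \<Rightarrow> bool" where
  "relative_end V D N A SO SA b E p \<longleftrightarrow> balanced_dinatural V D N A SO SA b E p \<and>
     (\<forall>E' p'. balanced_dinatural V D N A SO SA b E' p' \<longrightarrow>
        (\<exists>!u. u \<in> Hom A E' E \<and> (\<forall>X\<in>Ob N. p X \<cdot>\<^bsub>A\<^esub> u = p' X)))"

section \<open>Internal Homs\<close>

text \<open>A choice of representing objects \<open>IHom M N\<close> together with the bijections
  \<open>Phi X M N : Hom X (IHom M N) \<rightarrow> Hom (X \<rhd> M) N\<close>.\<close>

record ('o, 'a, 'mo, 'ma) ihom =
  IHom :: "'mo \<Rightarrow> 'mo \<Rightarrow> 'o"
  Phi :: "'o \<Rightarrow> 'mo \<Rightarrow> 'mo \<Rightarrow> 'a \<Rightarrow> 'ma"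

definition internal_homs ::
    "('k, 'o, 'a, 'm) moncat_scheme \<Rightarrow> ('k, 'o, 'a, 'mo, 'ma) modcat \<Rightarrow> ('o, 'a, 'mo, 'ma) ihom \<Rightarrow> bool"
  where
  "internal_homs C M H \<longleftrightarrow> (\<forall>N\<in>Ob M. \<forall>N'\<in>Ob M. IHom H N N' \<in> Ob C \<and>
     (\<forall>X\<in>Ob C. bij_betw (Phi H X N N') (Hom C X (IHom H N N')) (Hom M (X \<rhd>\<^sub>o\<^bsub>M\<^esub> N) N')) \<and>
     (\<forall>X Y. \<forall>g\<in>Hom C X Y. \<forall>f\<in>Hom C Y (IHom H N N').
        Phi H X N N' (f \<cdot>\<^bsub>C\<^esub> g) = Phi H Y N N' f \<cdot>\<^bsub>M\<^esub> (g \<rhd>\<^sub>a\<^bsub>M\<^esub> Ide M N)))"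

definition phi_inv ::
    "('k, 'o, 'a, 'm) moncat_scheme \<Rightarrow> ('o, 'a, 'mo, 'ma) ihom
      \<Rightarrow> 'o \<Rightarrow> 'mo \<Rightarrow> 'mo \<Rightarrow> 'ma \<Rightarrow> 'a" where
  "phi_inv C H X N N' = the_inv_into (Hom C X (IHom H N N')) (Phi H X N N')"

definition ihom_ev ::
    "('k, 'o, 'a, 'm) moncat_scheme \<Rightarrow> ('o, 'a, 'mo, 'ma) ihom \<Rightarrow> 'mo \<Rightarrow> 'mo \<Rightarrow> 'ma" where
  "ihom_ev C H N N' = Phi H (IHom H N N') N N' (Ide C (IHom H N N'))"

text \<open>The functor structure of the internal Hom, contravariant in the first argument: the unique one
  for which \<^const>\<open>Phi\<close> is natural in all three variables.\<close>

definition ihom_map ::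
    "('k, 'o, 'a, 'm) moncat_scheme \<Rightarrow> ('k, 'o, 'a, 'mo, 'ma) modcat \<Rightarrow> ('o, 'a, 'mo, 'ma) ihom
      \<Rightarrow> 'ma \<Rightarrow> 'ma \<Rightarrow> 'a" where
  "ihom_map C M H f g =
     (let E = IHom H (Cod M f) (Dom M g) in
        phi_inv C H E (Dom M f) (Cod M g)
          (g \<cdot>\<^bsub>M\<^esub> ihom_ev C H (Cod M f) (Dom M g) \<cdot>\<^bsub>M\<^esub> (Ide C E \<rhd>\<^sub>a\<^bsub>M\<^esub> f)))"

section \<open>The functor \<open>\<rho>\<close> and the bimodule structure on module endofunctors\<close>

text \<open>\<open>swap G C M X W N : X \<rhd> (G W \<rhd> N) \<rightarrow> G W \<rhd> (X \<rhd> N)\<close> is \<open>\<sigma>\<^sup>-\<^sup>1 \<rhd> id\<close> for the half-braiding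
  \<open>\<sigma> : G W \<otimes> X \<rightarrow> X \<otimes> G W\<close>, with the associativity isomorphisms inserted.\<close>

definition swap ::
    "('v, 'w, ('o, 'a) cob, ('o, 'a) carr) monfunc \<Rightarrow> ('k, 'o, 'a, 'm) moncat_scheme
      \<Rightarrow> ('k, 'o, 'a, 'mo, 'ma) modcat \<Rightarrow> 'o \<Rightarrow> 'v \<Rightarrow> 'mo \<Rightarrow> 'ma" where
  "swap G C M X W N = Assoc M (fst (FO G W)) X N
     \<cdot>\<^bsub>M\<^esub> (inv_arr C (snd (FO G W) X) \<rhd>\<^sub>a\<^bsub>M\<^esub> Ide M N)
     \<cdot>\<^bsub>M\<^esub> inv_arr M (Assoc M X (fst (FO G W)) N)"

definition rho ::
    "('k, 'o, 'a, 'm) moncat_scheme \<Rightarrow> ('k, 'o, 'a, 'mo, 'ma) modcat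
      \<Rightarrow> 'o \<Rightarrow> ('mo, 'ma, 'mo, 'ma) func" where
  "rho C M X = \<lparr>FO = \<lambda>N. X \<rhd>\<^sub>o\<^bsub>M\<^esub> N, FA = \<lambda>f. Ide C X \<rhd>\<^sub>a\<^bsub>M\<^esub> f\<rparr>"

definition lact ::
    "('k, 'o, 'a, 'm) moncat_scheme \<Rightarrow> ('k, 'o, 'a, 'mo, 'ma) modcat
      \<Rightarrow> 'o \<Rightarrow> ('mo, 'ma, 'mo, 'ma) func \<Rightarrow> ('mo, 'ma, 'mo, 'ma) func" where
  "lact C M X F = \<lparr>FO = \<lambda>N. X \<rhd>\<^sub>o\<^bsub>M\<^esub> FO F N, FA = \<lambda>f. Ide C X \<rhd>\<^sub>a\<^bsub>M\<^esub> FA F f\<rparr>"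

definition lact_str ::
    "('v, 'w, ('o, 'a) cob, ('o, 'a) carr) monfunc \<Rightarrow> ('k, 'o, 'a, 'm) moncat_scheme
      \<Rightarrow> ('k, 'o, 'a, 'mo, 'ma) modcat \<Rightarrow> 'o \<Rightarrow> ('mo, 'ma, 'mo, 'ma) func
      \<Rightarrow> ('v \<Rightarrow> 'mo \<Rightarrow> 'ma) \<Rightarrow> 'v \<Rightarrow> 'mo \<Rightarrow> 'ma" where
  "lact_str G C M X F d = (\<lambda>W N. swap G C M X W (FO F N) \<cdot>\<^bsub>M\<^esub> (Ide C X \<rhd>\<^sub>a\<^bsub>M\<^esub> d W N))"

definition ract ::
    "('k, 'o, 'a, 'm) moncat_scheme \<Rightarrow> ('k, 'o, 'a, 'mo, 'ma) modcat
      \<Rightarrow> ('mo, 'ma, 'mo, 'ma) func \<Rightarrow> 'o \<Rightarrow> ('mo, 'ma, 'mo, 'ma) func" where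
  "ract C M F X = \<lparr>FO = \<lambda>N. FO F (X \<rhd>\<^sub>o\<^bsub>M\<^esub> N), FA = \<lambda>f. FA F (Ide C X \<rhd>\<^sub>a\<^bsub>M\<^esub> f)\<rparr>"

definition ract_str ::
    "('v, 'w, ('o, 'a) cob, ('o, 'a) carr) monfunc \<Rightarrow> ('k, 'o, 'a, 'm) moncat_scheme
      \<Rightarrow> ('k, 'o, 'a, 'mo, 'ma) modcat \<Rightarrow> ('mo, 'ma, 'mo, 'ma) func
      \<Rightarrow> ('v \<Rightarrow> 'mo \<Rightarrow> 'ma) \<Rightarrow> 'o \<Rightarrow> 'v \<Rightarrow> 'mo \<Rightarrow> 'ma" where
  "ract_str G C M F d X = (\<lambda>W N. d W (X \<rhd>\<^sub>o\<^bsub>M\<^esub> N) \<cdot>\<^bsub>M\<^esub> FA F (swap G C M X W N))"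

section \<open>The right adjoint of \<open>\<rho>\<close>\<close>

text \<open>\<open>gamma\<close> sends \<open>f : X \<rhd> N \<rightarrow> F (W \<^bold>\<rhd> N')\<close> to an arrow \<open>X \<rhd> (W\<^sup>* \<^bold>\<rhd> N) \<rightarrow> F N'\<close>. Identifying
  \<open>G (W\<^sup>*)\<close> with \<open>(G W)\<^sup>*\<close> means that the evaluation of \<open>G W\<close> is
  \<open>G (W\<^sup>*) \<otimes> G W \<rightarrow> G (W\<^sup>* \<otimes> W) \<rightarrow> G 1 \<rightarrow> 1\<close>; this is what \<^const>\<open>eval_act\<close> gives for the restricted
  module category.\<close>

definition gamma ::
    "('v, 'w) duality \<Rightarrow> ('v, 'w, ('o, 'a) cob, ('o, 'a) carr) monfunc
      \<Rightarrow> ('k, 'o, 'a, 'm) moncat_scheme \<Rightarrow> ('k, 'o, 'a, 'mo, 'ma) modcat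
      \<Rightarrow> ('mo, 'ma, 'mo, 'ma) func \<Rightarrow> ('v \<Rightarrow> 'mo \<Rightarrow> 'ma)
      \<Rightarrow> 'o \<Rightarrow> 'v \<Rightarrow> 'mo \<Rightarrow> 'mo \<Rightarrow> 'ma \<Rightarrow> 'ma" where
  "gamma D G C M F d X W N N' f =
     eval_act D (restrict_module G C M) W (FO F N')
       \<cdot>\<^bsub>M\<^esub> (Ide C (fst (FO G (Dual D W))) \<rhd>\<^sub>a\<^bsub>M\<^esub> (d W N' \<cdot>\<^bsub>M\<^esub> f))
       \<cdot>\<^bsub>M\<^esub> swap G C M X (Dual D W) N"

definition beta ::
    "('v, 'w) duality \<Rightarrow> ('v, 'w, ('o, 'a) cob, ('o, 'a) carr) monfunc
      \<Rightarrow> ('k, 'o, 'a, 'm) moncat_scheme \<Rightarrow> ('k, 'o, 'a, 'mo, 'ma) modcat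
      \<Rightarrow> ('o, 'a, 'mo, 'ma) ihom \<Rightarrow> ('mo, 'ma, 'mo, 'ma) func \<Rightarrow> ('v \<Rightarrow> 'mo \<Rightarrow> 'ma)
      \<Rightarrow> 'v \<Rightarrow> 'mo \<Rightarrow> 'mo \<Rightarrow> 'a" where
  "beta D G C M H F d W N N' =
     (let Q = FO F (fst (FO G W) \<rhd>\<^sub>o\<^bsub>M\<^esub> N'); E = IHom H N Q in
        phi_inv C H E (fst (FO G (Dual D W)) \<rhd>\<^sub>o\<^bsub>M\<^esub> N) (FO F N')
          (gamma D G C M F d E W N N' (ihom_ev C H N Q)))"

text \<open>A choice of relative ends is a function \<open>R\<close> sending a module endofunctor \<open>(F, d)\<close> to the
  relative end of \<open>Hom(N, F N')\<close> and its dinatural transformation.\<close>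

type_synonym ('v, 'o, 'a, 'mo, 'ma) ends =
  "('mo, 'ma, 'mo, 'ma) func \<Rightarrow> ('v \<Rightarrow> 'mo \<Rightarrow> 'ma) \<Rightarrow> 'o \<times> ('mo \<Rightarrow> 'a)"

definition rhobar_ends ::
    "('k, 'r) ring_scheme \<Rightarrow> ('k, 'v, 'w) brcat \<Rightarrow> ('v, 'w) duality
      \<Rightarrow> ('v, 'w, ('o, 'a) cob, ('o, 'a) carr) monfunc
      \<Rightarrow> ('k, 'o, 'a, 'm) moncat_scheme \<Rightarrow> ('k, 'o, 'a, 'mo, 'ma) modcat
      \<Rightarrow> ('o, 'a, 'mo, 'ma) ihom \<Rightarrow> ('v, 'o, 'a, 'mo, 'ma) ends \<Rightarrow> bool" where
  "rhobar_ends K V D G C M H R \<longleftrightarrow>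
     (\<forall>F d. module_endofunctor K V (restrict_module G C M) F d \<longrightarrow>
        relative_end V D (restrict_module G C M) C
          (\<lambda>N N'. IHom H N (FO F N')) (\<lambda>f g. ihom_map C M H f (FA F g)) (beta D G C M H F d)
          (fst (R F d)) (snd (R F d)))"

text \<open>The value of the right adjoint \<open>\<rho>'\<close> on a module natural transformation \<open>t : (F, d) \<rightarrow> (F', d')\<close>.\<close>

definition rhobar_map ::
    "('k, 'o, 'a, 'm) moncat_scheme \<Rightarrow> ('k, 'o, 'a, 'mo, 'ma) modcat
      \<Rightarrow> ('o, 'a, 'mo, 'ma) ihom \<Rightarrow> ('v, 'o, 'a, 'mo, 'ma) ends
      \<Rightarrow> ('mo, 'ma, 'mo, 'ma) func \<Rightarrow> ('v \<Rightarrow> 'mo \<Rightarrow> 'ma)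
      \<Rightarrow> ('mo, 'ma, 'mo, 'ma) func \<Rightarrow> ('v \<Rightarrow> 'mo \<Rightarrow> 'ma) \<Rightarrow> ('mo \<Rightarrow> 'ma) \<Rightarrow> 'a" where
  "rhobar_map C M H R F d F' d' t =
     (THE u. u \<in> Hom C (fst (R F d)) (fst (R F' d')) \<and>
        (\<forall>N\<in>Ob M. snd (R F' d') N \<cdot>\<^bsub>C\<^esub> u = ihom_map C M H (Ide M N) (t N) \<cdot>\<^bsub>C\<^esub> snd (R F d) N))"

text \<open>The adjunction \<open>\<rho> \<stileturn> \<rho>'\<close> is the one induced by \<^const>\<open>Phi\<close> and the universal property of the
  end. Its counit at \<open>(F, d)\<close> is therefore \<open>\<phi>(id) (\<pi>\<^sub>N \<rhd> id) : \<rho>'(F, d) \<rhd> N \<rightarrow> F N\<close>; its unit at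
  \<open>X\<close> is the transpose of the identity of \<open>\<rho>(X)\<close>, i.e. it is determined by the triangle identity
  \<open>e\<^sub>\<rho>\<^sub>(\<^sub>X\<^sub>) \<circ> \<rho>(h\<^sub>X) = id\<close>.\<close>

definition counit ::
    "('k, 'o, 'a, 'm) moncat_scheme \<Rightarrow> ('k, 'o, 'a, 'mo, 'ma) modcat
      \<Rightarrow> ('o, 'a, 'mo, 'ma) ihom \<Rightarrow> ('v, 'o, 'a, 'mo, 'ma) ends
      \<Rightarrow> ('mo, 'ma, 'mo, 'ma) func \<Rightarrow> ('v \<Rightarrow> 'mo \<Rightarrow> 'ma) \<Rightarrow> 'mo \<Rightarrow> 'ma" where
  "counit C M H R F d N = ihom_ev C H N (FO F N) \<cdot>\<^bsub>M\<^esub> (snd (R F d) N \<rhd>\<^sub>a\<^bsub>M\<^esub> Ide M N)"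

definition unit ::
    "('v, 'w, ('o, 'a) cob, ('o, 'a) carr) monfunc
      \<Rightarrow> ('k, 'o, 'a, 'm) moncat_scheme \<Rightarrow> ('k, 'o, 'a, 'mo, 'ma) modcat
      \<Rightarrow> ('o, 'a, 'mo, 'ma) ihom \<Rightarrow> ('v, 'o, 'a, 'mo, 'ma) ends \<Rightarrow> 'o \<Rightarrow> 'a" where
  "unit G C M H R X =
     (THE h. h \<in> Hom C X (fst (R (rho C M X) (swap G C M X))) \<and>
        (\<forall>N\<in>Ob M. counit C M H R (rho C M X) (swap G C M X) N \<cdot>\<^bsub>M\<^esub> (h \<rhd>\<^sub>a\<^bsub>M\<^esub> Ide M N)
          = Ide M (X \<rhd>\<^sub>o\<^bsub>M\<^esub> N)))"

text \<open>The inverses of the bimodule structure \<open>l\<close>, \<open>r\<close> of \<open>\<rho>'\<close>. The associativity isomorphisms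
  appear because \<open>\<rho>(A \<otimes> X)\<close> and \<open>\<rho>(A) \<lhd> X\<close>, respectively \<open>\<rho>(X \<otimes> A)\<close> and \<open>X \<rhd> \<rho>(A)\<close>, are
  identified along them.\<close>

definition r_inv ::
    "('v, 'w, ('o, 'a) cob, ('o, 'a) carr) monfunc
      \<Rightarrow> ('k, 'o, 'a, 'm) moncat_scheme \<Rightarrow> ('k, 'o, 'a, 'mo, 'ma) modcat
      \<Rightarrow> ('o, 'a, 'mo, 'ma) ihom \<Rightarrow> ('v, 'o, 'a, 'mo, 'ma) ends
      \<Rightarrow> ('mo, 'ma, 'mo, 'ma) func \<Rightarrow> ('v \<Rightarrow> 'mo \<Rightarrow> 'ma) \<Rightarrow> 'o \<Rightarrow> 'a" where
  "r_inv G C M H R F d X =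
     (let A = fst (R F d); AX = A \<otimes>\<^sub>o\<^bsub>C\<^esub> X in
        rhobar_map C M H R (rho C M AX) (swap G C M AX) (ract C M F X) (ract_str G C M F d X)
          (\<lambda>N. counit C M H R F d (X \<rhd>\<^sub>o\<^bsub>M\<^esub> N) \<cdot>\<^bsub>M\<^esub> Assoc M A X N)
        \<cdot>\<^bsub>C\<^esub> unit G C M H R AX)"

definition l_inv ::
    "('v, 'w, ('o, 'a) cob, ('o, 'a) carr) monfunc
      \<Rightarrow> ('k, 'o, 'a, 'm) moncat_scheme \<Rightarrow> ('k, 'o, 'a, 'mo, 'ma) modcat
      \<Rightarrow> ('o, 'a, 'mo, 'ma) ihom \<Rightarrow> ('v, 'o, 'a, 'mo, 'ma) ends
      \<Rightarrow> 'o \<Rightarrow> ('mo, 'ma, 'mo, 'ma) func \<Rightarrow> ('v \<Rightarrow> 'mo \<Rightarrow> 'ma) \<Rightarrow> 'a" where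
  "l_inv G C M H R X F d =
     (let A = fst (R F d); XA = X \<otimes>\<^sub>o\<^bsub>C\<^esub> A in
        rhobar_map C M H R (rho C M XA) (swap G C M XA) (lact C M X F) (lact_str G C M X F d)
          (\<lambda>N. (Ide C X \<rhd>\<^sub>a\<^bsub>M\<^esub> counit C M H R F d N) \<cdot>\<^bsub>M\<^esub> Assoc M X A N)
        \<cdot>\<^bsub>C\<^esub> unit G C M H R XA)"

text \<open>The functor \<open>\<Z>\<^sub>C(\<rho>')\<close> on objects \<open>(F, c, d)\<close>, where \<open>c X N : F (X \<rhd> N) \<rightarrow> X \<rhd> F N\<close>.\<close>

definition center_rhobar ::
    "('v, 'w, ('o, 'a) cob, ('o, 'a) carr) monfunc
      \<Rightarrow> ('k, 'o, 'a, 'm) moncat_scheme \<Rightarrow> ('k, 'o, 'a, 'mo, 'ma) modcat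
      \<Rightarrow> ('o, 'a, 'mo, 'ma) ihom \<Rightarrow> ('v, 'o, 'a, 'mo, 'ma) ends
      \<Rightarrow> ('mo, 'ma, 'mo, 'ma) func \<Rightarrow> ('o \<Rightarrow> 'mo \<Rightarrow> 'ma) \<Rightarrow> ('v \<Rightarrow> 'mo \<Rightarrow> 'ma)
      \<Rightarrow> ('o, 'a) cob" where
  "center_rhobar G C M H R F c d =
     (fst (R F d),
      \<lambda>X\<in>Ob C. inv_arr C (l_inv G C M H R X F d)
        \<cdot>\<^bsub>C\<^esub> rhobar_map C M H R (ract C M F X) (ract_str G C M F d X)
              (lact C M X F) (lact_str G C M X F d) (c X)
        \<cdot>\<^bsub>C\<^esub> r_inv G C M H R F d X)"

definition id_func :: "('o, 'a, 'o, 'a) func" where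
  "id_func = \<lparr>FO = \<lambda>X. X, FA = \<lambda>f. f\<rparr>"

definition id_str :: "('k, 'o, 'a, 'mo, 'ma) modcat \<Rightarrow> 'o \<Rightarrow> 'mo \<Rightarrow> 'ma" where
  "id_str M X N = Ide M (X \<rhd>\<^sub>o\<^bsub>M\<^esub> N)"

text \<open>The object \<open>A\<^sub>V\<^sub>,\<^sub>M\<close> of the relative center, and its dinatural transformation.\<close>

definition adj_alg ::
    "('v, 'w, ('o, 'a) cob, ('o, 'a) carr) monfunc
      \<Rightarrow> ('k, 'o, 'a, 'm) moncat_scheme \<Rightarrow> ('k, 'o, 'a, 'mo, 'ma) modcat
      \<Rightarrow> ('o, 'a, 'mo, 'ma) ihom \<Rightarrow> ('v, 'o, 'a, 'mo, 'ma) ends \<Rightarrow> ('o, 'a) cob" where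
  "adj_alg G C M H R =
     center_rhobar G C M H R id_func (id_str M) (id_str (restrict_module G C M))"

definition adj_alg_proj ::
    "('v, 'w, ('o, 'a) cob, ('o, 'a) carr) monfunc
      \<Rightarrow> ('k, 'o, 'a, 'm) moncat_scheme \<Rightarrow> ('k, 'o, 'a, 'mo, 'ma) modcat
      \<Rightarrow> ('v, 'o, 'a, 'mo, 'ma) ends \<Rightarrow> 'mo \<Rightarrow> 'a" where
  "adj_alg_proj G C M R = snd (R id_func (id_str (restrict_module G C M)))"

section \<open>The category of pairs\<close>

type_synonym ('o, 'a, 'mo, 'ma) pob = "('o, 'a) cob \<times> ('mo \<Rightarrow> 'ma)"

definition pair_object ::
    "('k, 'v, 'w) brcat \<Rightarrow> ('k, 'o, 'a, 'm) moncat_scheme \<Rightarrow> ('k, 'o, 'a, 'mo, 'ma) modcat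
      \<Rightarrow> ('v, 'w, ('o, 'a) cob, ('o, 'a) carr) monfunc \<Rightarrow> ('o, 'a, 'mo, 'ma) pob \<Rightarrow> bool" where
  "pair_object V C M G = (\<lambda>((Z, s), z).
     (Z, s) \<in> Ob (relative_center V C G) \<and> z \<in> extensional (Ob M) \<and>
     (\<forall>N\<in>Ob M. z N \<in> Hom M (Z \<rhd>\<^sub>o\<^bsub>M\<^esub> N) N) \<and>
     (\<forall>N N'. \<forall>f\<in>Hom M N N'. z N' \<cdot>\<^bsub>M\<^esub> (Ide C Z \<rhd>\<^sub>a\<^bsub>M\<^esub> f) = f \<cdot>\<^bsub>M\<^esub> z N) \<and>
     (\<forall>X\<in>Ob C. \<forall>N\<in>Ob M.
        z (X \<rhd>\<^sub>o\<^bsub>M\<^esub> N) \<cdot>\<^bsub>M\<^esub> Assoc M Z X N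
          = (Ide C X \<rhd>\<^sub>a\<^bsub>M\<^esub> z N) \<cdot>\<^bsub>M\<^esub> Assoc M X Z N \<cdot>\<^bsub>M\<^esub> (s X \<rhd>\<^sub>a\<^bsub>M\<^esub> Ide M N)))"

definition pair_category ::
    "('k, 'v, 'w) brcat \<Rightarrow> ('k, 'o, 'a, 'm) moncat_scheme \<Rightarrow> ('k, 'o, 'a, 'mo, 'ma) modcat
      \<Rightarrow> ('v, 'w, ('o, 'a) cob, ('o, 'a) carr) monfunc
      \<Rightarrow> (('o, 'a, 'mo, 'ma) pob,
          ('o, 'a, 'mo, 'ma) pob \<times> ('o, 'a) carr \<times> ('o, 'a, 'mo, 'ma) pob) cat" where
  "pair_category V C M G = \<lparr>
     Ob = {P. pair_object V C M G P},
     Arr = {(P, f, Q). pair_object V C M G P \<and> pair_object V C M G Q \<and>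
       f \<in> Hom (relative_center V C G) (fst P) (fst Q) \<and>
       (\<forall>N\<in>Ob M. snd Q N \<cdot>\<^bsub>M\<^esub> (center_arr f \<rhd>\<^sub>a\<^bsub>M\<^esub> Ide M N) = snd P N)},
     Dom = (\<lambda>(P, f, Q). P),
     Cod = (\<lambda>(P, f, Q). Q),
     Comp = (\<lambda>(Q, g, R) (P, f, Q'). (P, g \<cdot>\<^bsub>relative_center V C G\<^esub> f, R)),
     Ide = (\<lambda>P. (P, Ide (relative_center V C G) (fst P), P))\<rparr>"

section \<open>The center, the relative center and the category of pairs are categories\<close>

context tensor_category begin

lemma center_sel:
  "Ob (center C) = {(A, s). half_braiding C A s}"
  "Dom (center C) = (\<lambda>(P, f, Q). P)"
  "Cod (center C) = (\<lambda>(P, f, Q). Q)"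
  "Ide (center C) = (\<lambda>P. (P, Ide C (fst P), P))"
  "Comp (center C) = (\<lambda>(Q, g, R) (P, f, Q'). (P, g \<cdot> f, R))"
  by (simp_all add: center_def)

lemma in_center_hom:
  "x \<in> Hom (center C) P Q \<longleftrightarrow> (\<exists>f. x = (P, f, Q) \<and> half_braiding C (fst P) (snd P)
     \<and> half_braiding C (fst Q) (snd Q) \<and> f \<in> Hom C (fst P) (fst Q) \<and>
     (\<forall>X\<in>Ob C. (Ide C X \<otimes>\<^sub>a f) \<cdot> snd P X = snd Q X \<cdot> (f \<otimes>\<^sub>a Ide C X)))"
  unfolding Hom_def[of "center C"] by (auto simp: center_def)

lemma center_comp_step:
  assumes "half_braiding C A r" "half_braiding C B s" "half_braiding C E t"
    "f \<in> Hom C A B" "g \<in> Hom C B E" "X \<in> Ob C"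
    "(Ide C X \<otimes>\<^sub>a f) \<cdot> r X = s X \<cdot> (f \<otimes>\<^sub>a Ide C X)"
    "(Ide C X \<otimes>\<^sub>a g) \<cdot> s X = t X \<cdot> (g \<otimes>\<^sub>a Ide C X)"
  shows "(Ide C X \<otimes>\<^sub>a (g \<cdot> f)) \<cdot> r X = t X \<cdot> ((g \<cdot> f) \<otimes>\<^sub>a Ide C X)"
proof -
  have I: "Ide C X \<in> Hom C X X" "Ide C X \<cdot> Ide C X = Ide C X"
    using ide_hom comp_ide_left assms by blast+
  have h: "r X \<in> Hom C (A \<otimes>\<^sub>o X) (X \<otimes>\<^sub>o A)" "s X \<in> Hom C (B \<otimes>\<^sub>o X) (X \<otimes>\<^sub>o B)"
     "t X \<in> Hom C (E \<otimes>\<^sub>o X) (X \<otimes>\<^sub>o E)" using assms unfolding half_braiding_def by auto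
  have T: "Ide C X \<otimes>\<^sub>a f \<in> Hom C (X \<otimes>\<^sub>o A) (X \<otimes>\<^sub>o B)" "Ide C X \<otimes>\<^sub>a g \<in> Hom C (X \<otimes>\<^sub>o B) (X \<otimes>\<^sub>o E)"
     "f \<otimes>\<^sub>a Ide C X \<in> Hom C (A \<otimes>\<^sub>o X) (B \<otimes>\<^sub>o X)" "g \<otimes>\<^sub>a Ide C X \<in> Hom C (B \<otimes>\<^sub>o X) (E \<otimes>\<^sub>o X)"
    using tensA_hom I assms by blast+
  have "(Ide C X \<otimes>\<^sub>a (g \<cdot> f)) \<cdot> r X = ((Ide C X \<otimes>\<^sub>a g) \<cdot> (Ide C X \<otimes>\<^sub>a f)) \<cdot> r X"
    using tensA_comp[OF I(1) I(1) assms(4,5)] I by simp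
  also have "\<dots> = (Ide C X \<otimes>\<^sub>a g) \<cdot> (s X \<cdot> (f \<otimes>\<^sub>a Ide C X))"
    using comp_assoc[OF h(1) T(1,2)] assms by simp
  also have "\<dots> = (t X \<cdot> (g \<otimes>\<^sub>a Ide C X)) \<cdot> (f \<otimes>\<^sub>a Ide C X)"
    using comp_assoc[OF T(3) h(2) T(2)] assms by simp
  also have "\<dots> = t X \<cdot> ((g \<cdot> f) \<otimes>\<^sub>a Ide C X)"
    using comp_assoc[OF T(3,4) h(3)] tensA_comp[OF assms(4,5) I(1) I(1)] I by simp
  finally show ?thesis .
qed

lemma category_center: "category (center C)"
proof
  fix P assume P: "P \<in> Ob (center C)"
  then have hb: "half_braiding C (fst P) (snd P)" by (auto simp: center_sel)
  have A: "fst P \<in> Ob C" using hb by (auto simp: half_braiding_def)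
  have "(Ide C X \<otimes>\<^sub>a Ide C (fst P)) \<cdot> snd P X = snd P X \<cdot> (Ide C (fst P) \<otimes>\<^sub>a Ide C X)" if X: "X \<in> Ob C" for X
  proof -
    have "snd P X \<in> Hom C (fst P \<otimes>\<^sub>o X) (X \<otimes>\<^sub>o fst P)" using hb X by (auto simp: half_braiding_def)
    then show ?thesis using tensA_ide[OF X A] tensA_ide[OF A X] comp_ide_left comp_ide_right by metis
  qed
  then show "Ide (center C) P \<in> Hom (center C) P P"
    using ide_hom[OF A] hb by (auto simp: in_center_hom center_sel)
next
  fix f g P Q R assume "f \<in> Hom (center C) P Q" "g \<in> Hom (center C) Q R"
  then show "g \<cdot>\<^bsub>center C\<^esub> f \<in> Hom (center C) P R"
    by (fastforce simp: in_center_hom center_sel intro: comp_hom center_comp_step)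
next
  fix f g h P Q R S assume "f \<in> Hom (center C) P Q" "g \<in> Hom (center C) Q R" "h \<in> Hom (center C) R S"
  then show "(h \<cdot>\<^bsub>center C\<^esub> g) \<cdot>\<^bsub>center C\<^esub> f = h \<cdot>\<^bsub>center C\<^esub> g \<cdot>\<^bsub>center C\<^esub> f"
    by (auto simp: in_center_hom center_sel comp_assoc)
next
  fix f assume "f \<in> Arr (center C)"
  then show "Dom (center C) f \<in> Ob (center C)" "Cod (center C) f \<in> Ob (center C)"
    by (auto simp: center_def)
qed (auto simp: center_sel in_center_hom comp_ide_left comp_ide_right)

end

lemma full_subcat_Hom:
  "Hom (full_subcat B S) P Q = {f \<in> Hom B P Q. P \<in> S \<and> Q \<in> S}"
  by (auto simp: full_subcat_def Hom_def)

lemma (in category) category_full_subcat: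
  assumes "S \<subseteq> Ob C" shows "category (full_subcat C S)"
proof
qed (use assms in \<open>auto simp: full_subcat_Hom comp_ide_left comp_ide_right comp_assoc,
   auto simp: full_subcat_def comp_assoc comp_ide_left comp_ide_right intro: ide_hom comp_hom\<close>)

lemma (in tensor_category) category_relative_center: "category (relative_center V C G)"
  unfolding relative_center_def
  by (rule category.category_full_subcat[OF category_center]) auto

lemma category_pair_category:
  fixes M :: "('k, 'o, 'a, 'mo, 'ma) modcat" (structure)
  assumes "module_category K C M"
  shows "category (pair_category V C M G)"
proof -
  interpret module_category K C M by fact
  let ?R = "relative_center V C G"
  interpret R: category ?R by (rule C.category_relative_center)
  have HR: "Hom ?R P Q \<subseteq> Hom (center C) P Q" for P Q
    by (auto simp: relative_center_def full_subcat_Hom)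
  have cR: "Comp ?R = Comp (center C)" "Ide ?R = Ide (center C)"
    by (simp_all add: relative_center_def full_subcat_def)
  have homP: "x \<in> Hom (pair_category V C M G) P Q \<longleftrightarrow> (\<exists>f. x = (P, f, Q) \<and> 
      pair_object V C M G P \<and> pair_object V C M G Q \<and> f \<in> Hom ?R (fst P) (fst Q) \<and>
       (\<forall>N\<in>Ob M. snd Q N \<cdot> (center_arr f \<rhd>\<^sub>a Ide M N) = snd P N))" for x P Q
    unfolding Hom_def[of "pair_category V C M G"] by (auto simp: pair_category_def)
  have sel: "Ob (pair_category V C M G) = {P. pair_object V C M G P}"
     "Comp (pair_category V C M G) = (\<lambda>(Q, g, R) (P, f, Q'). (P, g \<cdot>\<^bsub>?R\<^esub> f, R))"
     "Ide (pair_category V C M G) = (\<lambda>P. (P, Ide ?R (fst P), P))"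
     "Dom (pair_category V C M G) = (\<lambda>(P, f, Q). P)"
     "Cod (pair_category V C M G) = (\<lambda>(P, f, Q). Q)"
     by (simp_all add: pair_category_def)
  have po: "pair_object V C M G P \<Longrightarrow> fst P \<in> Ob ?R \<and> fst (fst P) \<in> Ob C \<and> 
      (\<forall>N\<in>Ob M. snd P N \<in> Hom M (fst (fst P) \<rhd>\<^sub>o N) N)" for P
    by (auto simp: pair_object_def relative_center_def full_subcat_def C.center_sel half_braiding_def
        split: prod.splits)
  show ?thesis
  proof
    fix P assume "P \<in> Ob (pair_category V C M G)"
    then have P: "pair_object V C M G P" by (simp add: sel)
    note p = po[OF P]
    have "snd P N \<cdot> (Ide C (fst (fst P)) \<rhd>\<^sub>a Ide M N) = snd P N" if "N \<in> Ob M" for N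
      using p that actA_ide comp_ide_right by metis
    then show "Ide (pair_category V C M G) P \<in> Hom (pair_category V C M G) P P"
      using P p R.ide_hom by (auto simp: homP sel cR center_arr_def C.center_sel)
  next
    fix f g P Q S
    assume "f \<in> Hom (pair_category V C M G) P Q" "g \<in> Hom (pair_category V C M G) Q S"
    then obtain f' g' where f: "f = (P, f', Q)" "f' \<in> Hom ?R (fst P) (fst Q)"
       "\<And>N. N \<in> Ob M \<Longrightarrow> snd Q N \<cdot> (center_arr f' \<rhd>\<^sub>a Ide M N) = snd P N"
      and g: "g = (Q, g', S)" "g' \<in> Hom ?R (fst Q) (fst S)"
       "\<And>N. N \<in> Ob M \<Longrightarrow> snd S N \<cdot> (center_arr g' \<rhd>\<^sub>a Ide M N) = snd Q N"
      and o: "pair_object V C M G P" "pair_object V C M G Q" "pair_object V C M G S"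
      by (auto simp: homP)
    obtain f1 where f1: "f' = (fst P, f1, fst Q)" "f1 \<in> Hom C (fst (fst P)) (fst (fst Q))"
      using f(2) HR by (fastforce simp: C.in_center_hom)
    obtain g1 where g1: "g' = (fst Q, g1, fst S)" "g1 \<in> Hom C (fst (fst Q)) (fst (fst S))"
      using g(2) HR by (fastforce simp: C.in_center_hom)
    have "snd S N \<cdot> ((g1 \<cdot>\<^bsub>C\<^esub> f1) \<rhd>\<^sub>a Ide M N) = snd P N" if N: "N \<in> Ob M" for N
    proof -
      have I: "Ide M N \<in> Hom M N N" "Ide M N \<cdot> Ide M N = Ide M N" using ide_hom comp_ide_left N by blast+
      have h: "f1 \<rhd>\<^sub>a Ide M N \<in> Hom M (fst (fst P) \<rhd>\<^sub>o N) (fst (fst Q) \<rhd>\<^sub>o N)"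
        "g1 \<rhd>\<^sub>a Ide M N \<in> Hom M (fst (fst Q) \<rhd>\<^sub>o N) (fst (fst S) \<rhd>\<^sub>o N)"
        using actA_hom f1 g1 I by blast+
      have s: "snd S N \<in> Hom M (fst (fst S) \<rhd>\<^sub>o N) N" using po o N by blast
      have "(g1 \<cdot>\<^bsub>C\<^esub> f1) \<rhd>\<^sub>a Ide M N = (g1 \<rhd>\<^sub>a Ide M N) \<cdot> (f1 \<rhd>\<^sub>a Ide M N)"
        using actA_comp[OF f1(2) g1(2) I(1) I(1)] I by simp
      then show ?thesis using comp_assoc[OF h s] f(3)[OF N] g(3)[OF N] f1(1) g1(1)
        by (simp add: center_arr_def)
    qed
    then show "g \<cdot>\<^bsub>pair_category V C M G\<^esub> f \<in> Hom (pair_category V C M G) P S"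
      using R.comp_hom[OF f(2) g(2)] o f1 g1 unfolding f(1) g(1)
      by (auto simp: homP sel cR C.center_sel center_arr_def)
  next
    fix f assume "f \<in> Arr (pair_category V C M G)"
    then show "Dom (pair_category V C M G) f \<in> Ob (pair_category V C M G)"
      "Cod (pair_category V C M G) f \<in> Ob (pair_category V C M G)"
      by (auto simp: pair_category_def)
  qed (auto simp: homP sel R.comp_ide_left R.comp_ide_right R.comp_assoc)
qed

end

theory Submission
  imports Defs
begin

text \<open>Natural transformations \<open>X \<rhd> - \<rightarrow> Y \<rhd> -\<close> that are compatible with the action of \<open>\<V>\<close> are the
  arrows \<open>X \<rightarrow> Y\<close> of a strict monoidal category \<open>E'\<close> with the same objects as \<open>C\<close>, and \<open>C\<close> maps to
  it by \<open>f \<mapsto> f \<rhd> id\<close>. The relative end says that \<open>A\<close> corepresents transformations to the identity: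
  \<open>Hom\<^sub>C(Z, A) = Hom\<^sub>E\<^sub>'(Z, 1)\<close>. Since \<open>C\<close> is rigid, \<open>Hom\<^sub>C(Z, X \<otimes> A) = Hom\<^sub>E\<^sub>'(Z, X)\<close> follows, and
  every statement about the half-braiding \<open>s\<close> of \<open>A\<close> can be tested after composing with
  \<open>X \<otimes> e\<close>, where \<open>s\<close> is characterised by \<open>(X \<otimes> e) s\<^sub>X = e \<otimes> X\<close>. This is the condition on pairs,
  and an arrow \<open>Z \<rightarrow> A\<close> respects half-braidings as soon as it respects the transformations.\<close>

section \<open>Categories and strict monoidal categories\<close>

text \<open>The action of C is associative and unital only up to isomorphism, and the balancing of
  the relative end is stated through internal Homs and duals in V. Both are removed before the
  monoidal argument starts. Transposing along \<open>Phi\<close>, and then along the duality between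
  the images of W and its dual, turns balancing into compatibility with \<open>swap\<close>; the
  second transposition loses nothing because G carries dual pairs to dual pairs. Compatibility with
  \<open>swap\<close> in turn says that a transformation commutes with the half-braidings of the
  objects G W. This is a centrality condition, stable under composition and tensor product, and so
  E' is monoidal. A second obstacle is that the half-braiding of A is defined as a composite through
  further ends. Among them are those of X |> - with the structures \<open>lact_str\<close> and
  \<open>ract_str\<close>, which agree with \<open>swap\<close> on objects but need not be the same
  functions, so that \<open>R\<close> may select different ends for them. The composite is therefore
  evaluated by universal properties alone. Its invertibility comes from right duals, and membership
  in the relative center from the centrality of e.\<close>

definition composable :: "('o, 'a, 'm) cat_scheme \<Rightarrow> 'a \<Rightarrow> 'a \<Rightarrow> bool" where
  "composable C g f \<longleftrightarrow> g \<in> Arr C \<and> f \<in> Arr C \<and> Dom C g = Cod C f"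

context category
begin

lemma hom_arr: "f \<in> Hom C X Y \<Longrightarrow> f \<in> Arr C"
  and hom_dom: "f \<in> Hom C X Y \<Longrightarrow> Dom C f = X"
  and hom_cod: "f \<in> Hom C X Y \<Longrightarrow> Cod C f = Y"
  by (auto simp: Hom_def)

lemma in_hom: "f \<in> Arr C \<Longrightarrow> Dom C f = X \<Longrightarrow> Cod C f = Y \<Longrightarrow> f \<in> Hom C X Y"
  by (auto simp: Hom_def)

lemma composableI [simp]: "g \<in> Arr C \<Longrightarrow> f \<in> Arr C \<Longrightarrow> Dom C g = Cod C f \<Longrightarrow> composable C g f"
  by (simp add: composable_def)

text \<open>The axioms of \<open>category\<close> name intermediate objects only in their premises,
  where a simplifier cannot guess them. Phrased with \<open>Dom\<close> and \<open>Cod\<close>, the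
  side conditions are computed instead.\<close>

lemma comp_arr [simp]: "composable C g f \<Longrightarrow> g \<cdot> f \<in> Arr C"
  and comp_dom [simp]: "composable C g f \<Longrightarrow> Dom C (g \<cdot> f) = Dom C f"
  and comp_cod [simp]: "composable C g f \<Longrightarrow> Cod C (g \<cdot> f) = Cod C g"
  using comp_hom[of f "Dom C f" "Cod C f" g "Cod C g"] by (auto simp: Hom_def composable_def)

lemma comp_assoc_arr [simp]:
  "composable C h g \<Longrightarrow> composable C g f \<Longrightarrow> (h \<cdot> g) \<cdot> f = h \<cdot> (g \<cdot> f)"
  using comp_assoc[of f "Dom C f" "Cod C f" g "Cod C g" h "Cod C h"] by (auto simp: Hom_def composable_def)

lemma ide_arr [simp]: "X \<in> Ob C \<Longrightarrow> Ide C X \<in> Arr C"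
  and ide_dom [simp]: "X \<in> Ob C \<Longrightarrow> Dom C (Ide C X) = X"
  and ide_cod [simp]: "X \<in> Ob C \<Longrightarrow> Cod C (Ide C X) = X"
  using ide_hom[of X] by (auto simp: Hom_def)

lemma comp_ide_right_arr [simp]: "f \<in> Arr C \<Longrightarrow> Dom C f = X \<Longrightarrow> f \<cdot> Ide C X = f"
  and comp_ide_left_arr [simp]: "f \<in> Arr C \<Longrightarrow> Cod C f = X \<Longrightarrow> Ide C X \<cdot> f = f"
  using comp_ide_right comp_ide_left by (auto simp: Hom_def)

declare dom_ob [simp] cod_ob [simp]

text \<open>Composites are kept nested to the right, so an equation for \<open>a\<close> after
  \<open>b\<close> meets a longer chain only when a remaining factor \<open>r\<close> is carried
  along. Most chains below are rewritten through this rule.\<close>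

lemma comp_tail:
  assumes "a \<cdot> b = e" "composable C a b" "composable C b r"
  shows "a \<cdot> (b \<cdot> r) = e \<cdot> r"
  unfolding assms(1)[symmetric] by (rule comp_assoc_arr[OF assms(2,3), symmetric])

lemma is_inverse_unique:
  assumes "is_inverse C f g" "is_inverse C f h" shows "g = h"
proof -
  have "g = g \<cdot> (f \<cdot> h)" using assms by (auto simp: is_inverse_def Hom_def)
  also have "\<dots> = (g \<cdot> f) \<cdot> h" using assms comp_assoc_arr[of h f g] by (auto simp: is_inverse_def Hom_def)
  also have "\<dots> = h" using assms by (auto simp: is_inverse_def Hom_def)
  finally show ?thesis .
qed

lemma inv_arr_eqI: "is_inverse C f g \<Longrightarrow> inv_arr C f = g"
  unfolding inv_arr_def by (blast intro: is_inverse_unique)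

lemma is_isoI:
  "f \<in> Hom C X Y \<Longrightarrow> g \<in> Hom C Y X \<Longrightarrow> g \<cdot> f = Ide C X \<Longrightarrow> f \<cdot> g = Ide C Y \<Longrightarrow> is_iso C f"
  unfolding is_iso_def is_inverse_def by (auto simp: Hom_def)

lemma is_inverse_inv: "is_iso C f \<Longrightarrow> is_inverse C f (inv_arr C f)"
  unfolding is_iso_def using inv_arr_eqI by blast

lemma iso_inv_arr [simp]: "is_iso C f \<Longrightarrow> inv_arr C f \<in> Arr C"
  and iso_inv_dom [simp]: "is_iso C f \<Longrightarrow> Dom C (inv_arr C f) = Cod C f"
  and iso_inv_cod [simp]: "is_iso C f \<Longrightarrow> Cod C (inv_arr C f) = Dom C f"
  and iso_inv_comp [simp]: "is_iso C f \<Longrightarrow> inv_arr C f \<cdot> f = Ide C (Dom C f)"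
  and iso_comp_inv [simp]: "is_iso C f \<Longrightarrow> f \<cdot> inv_arr C f = Ide C (Cod C f)"
  and iso_arr: "is_iso C f \<Longrightarrow> f \<in> Arr C"
  using is_inverse_inv[of f] by (auto simp: is_inverse_def Hom_def)

lemma iso_inv_tail [simp]:
  assumes "is_iso C f" "r \<in> Arr C" "Cod C r = Dom C f" shows "inv_arr C f \<cdot> (f \<cdot> r) = r"
  using comp_tail[OF iso_inv_comp, of f r] assms by (simp add: iso_arr)

lemma iso_tail_inv [simp]:
  assumes "is_iso C f" "r \<in> Arr C" "Cod C r = Cod C f" shows "f \<cdot> (inv_arr C f \<cdot> r) = r"
  using comp_tail[OF iso_comp_inv, of f r] assms by (simp add: iso_arr)

lemma iso_inv_iso [simp]: "is_iso C f \<Longrightarrow> is_iso C (inv_arr C f)"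
  by (rule is_isoI[of _ "Cod C f" "Dom C f" f]) (auto simp: iso_arr Hom_def)

lemma ide_iso [simp]: "X \<in> Ob C \<Longrightarrow> is_iso C (Ide C X)"
  by (rule is_isoI[of _ X X "Ide C X"]) (auto simp: Hom_def)

lemma comp_iso [simp]:
  assumes "is_iso C f" "is_iso C g" "Dom C g = Cod C f" shows "is_iso C (g \<cdot> f)"
  by (rule is_isoI[of _ "Dom C f" "Cod C g" "inv_arr C f \<cdot> inv_arr C g"])
     (use assms in \<open>auto simp: iso_arr Hom_def\<close>)

lemma inv_arr_ide [simp]: "X \<in> Ob C \<Longrightarrow> inv_arr C (Ide C X) = Ide C X"
  by (rule inv_arr_eqI) (simp add: is_inverse_def Hom_def)

lemma inv_arr_inv [simp]: "is_iso C f \<Longrightarrow> inv_arr C (inv_arr C f) = f"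
  by (rule inv_arr_eqI) (simp add: is_inverse_def Hom_def iso_arr)

lemma inv_arr_comp:
  assumes "is_iso C f" "is_iso C g" "Dom C g = Cod C f"
  shows "inv_arr C (g \<cdot> f) = inv_arr C f \<cdot> inv_arr C g"
  by (rule inv_arr_eqI) (use assms in \<open>auto simp: is_inverse_def iso_arr Hom_def\<close>)

lemma iso_cancel_left:
  assumes "is_iso C a" "a \<cdot> f = a \<cdot> g" "f \<in> Arr C" "g \<in> Arr C" "Cod C f = Dom C a" "Cod C g = Dom C a"
  shows "f = g"
  using assms iso_inv_tail by metis

lemma iso_cancel_right:
  assumes "is_iso C a" "f \<cdot> a = g \<cdot> a" "f \<in> Arr C" "g \<in> Arr C" "Dom C f = Cod C a" "Dom C g = Cod C a"
  shows "f = g"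
proof -
  have "f = (f \<cdot> a) \<cdot> inv_arr C a" "g = (g \<cdot> a) \<cdot> inv_arr C a"
    using assms(1,3-6) by (simp_all add: iso_arr)
  then show ?thesis using assms(2) by simp
qed

lemma iso_moveL:
  assumes "is_iso C a" "a \<cdot> f = g" "f \<in> Arr C" "Cod C f = Dom C a"
  shows "f = inv_arr C a \<cdot> g"
  using assms iso_inv_tail by metis

end

text \<open>The monoidal axioms of \<open>tensor_category\<close> without linearity, so that they
  also cover the category of transformations, whose linear structure is unspecified.\<close>

locale strict_monoidal = category C
  for C :: "('k, 'o, 'a, 'm) moncat_scheme" (structure) +
  assumes tensO_ob [simp]: "\<lbrakk>X \<in> Ob C; Y \<in> Ob C\<rbrakk> \<Longrightarrow> X \<otimes>\<^sub>o Y \<in> Ob C"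
    and unit_ob [simp]: "Unit C \<in> Ob C"
    and tensA_hom: "\<lbrakk>f \<in> Hom C X X'; g \<in> Hom C Y Y'\<rbrakk>
      \<Longrightarrow> f \<otimes>\<^sub>a g \<in> Hom C (X \<otimes>\<^sub>o Y) (X' \<otimes>\<^sub>o Y')"
    and tensA_ide [simp]: "\<lbrakk>X \<in> Ob C; Y \<in> Ob C\<rbrakk> \<Longrightarrow> Ide C X \<otimes>\<^sub>a Ide C Y = Ide C (X \<otimes>\<^sub>o Y)"
    and tensA_comp: "\<lbrakk>f \<in> Hom C X Y; g \<in> Hom C Y Z; f' \<in> Hom C X' Y'; g' \<in> Hom C Y' Z'\<rbrakk>
      \<Longrightarrow> (g \<cdot> f) \<otimes>\<^sub>a (g' \<cdot> f') = (g \<otimes>\<^sub>a g') \<cdot> (f \<otimes>\<^sub>a f')"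
    and tensO_assoc [simp]: "\<lbrakk>X \<in> Ob C; Y \<in> Ob C; Z \<in> Ob C\<rbrakk>
      \<Longrightarrow> (X \<otimes>\<^sub>o Y) \<otimes>\<^sub>o Z = X \<otimes>\<^sub>o (Y \<otimes>\<^sub>o Z)"
    and tensA_assoc [simp]: "\<lbrakk>f \<in> Arr C; g \<in> Arr C; h \<in> Arr C\<rbrakk>
      \<Longrightarrow> (f \<otimes>\<^sub>a g) \<otimes>\<^sub>a h = f \<otimes>\<^sub>a (g \<otimes>\<^sub>a h)"
    and tensO_unit: "X \<in> Ob C \<Longrightarrow> Unit C \<otimes>\<^sub>o X = X \<and> X \<otimes>\<^sub>o Unit C = X"
    and tensA_unit: "f \<in> Arr C \<Longrightarrow> Ide C (Unit C) \<otimes>\<^sub>a f = f \<and> f \<otimes>\<^sub>a Ide C (Unit C) = f"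
begin

lemma tensO_unit_left [simp]: "X \<in> Ob C \<Longrightarrow> Unit C \<otimes>\<^sub>o X = X"
  and tensO_unit_right [simp]: "X \<in> Ob C \<Longrightarrow> X \<otimes>\<^sub>o Unit C = X"
  and tensA_unit_left [simp]: "f \<in> Arr C \<Longrightarrow> Ide C (Unit C) \<otimes>\<^sub>a f = f"
  and tensA_unit_right [simp]: "f \<in> Arr C \<Longrightarrow> f \<otimes>\<^sub>a Ide C (Unit C) = f"
  by (simp_all add: tensO_unit tensA_unit)

lemma tensA_arr [simp]: "f \<in> Arr C \<Longrightarrow> g \<in> Arr C \<Longrightarrow> f \<otimes>\<^sub>a g \<in> Arr C"
  and tensA_dom [simp]: "f \<in> Arr C \<Longrightarrow> g \<in> Arr C \<Longrightarrow> Dom C (f \<otimes>\<^sub>a g) = Dom C f \<otimes>\<^sub>o Dom C g"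
  and tensA_cod [simp]: "f \<in> Arr C \<Longrightarrow> g \<in> Arr C \<Longrightarrow> Cod C (f \<otimes>\<^sub>a g) = Cod C f \<otimes>\<^sub>o Cod C g"
  using tensA_hom[of f "Dom C f" "Cod C f" g "Dom C g" "Cod C g"] by (auto simp: Hom_def)

lemma interchange:
  "\<lbrakk>f \<in> Arr C; g \<in> Arr C; f' \<in> Arr C; g' \<in> Arr C; Dom C g = Cod C f; Dom C g' = Cod C f'\<rbrakk>
    \<Longrightarrow> (g \<otimes>\<^sub>a g') \<cdot> (f \<otimes>\<^sub>a f') = (g \<cdot> f) \<otimes>\<^sub>a (g' \<cdot> f')"
  using tensA_comp[of f "Dom C f" "Cod C f" g "Cod C g" f' "Dom C f'" "Cod C f'" g' "Cod C g'"]
  by (auto simp: Hom_def)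

lemma interchange_tail:
  "\<lbrakk>f \<in> Arr C; g \<in> Arr C; f' \<in> Arr C; g' \<in> Arr C; Dom C g = Cod C f; Dom C g' = Cod C f';
     r \<in> Arr C; Cod C r = Dom C f \<otimes>\<^sub>o Dom C f'\<rbrakk>
    \<Longrightarrow> (g \<otimes>\<^sub>a g') \<cdot> ((f \<otimes>\<^sub>a f') \<cdot> r) = ((g \<cdot> f) \<otimes>\<^sub>a (g' \<cdot> f')) \<cdot> r"
  by (rule comp_tail[OF interchange]) auto

lemma tensA_ide_tail [simp]:
  "\<lbrakk>X \<in> Ob C; Y \<in> Ob C; f \<in> Arr C\<rbrakk> \<Longrightarrow> Ide C X \<otimes>\<^sub>a (Ide C Y \<otimes>\<^sub>a f) = Ide C (X \<otimes>\<^sub>o Y) \<otimes>\<^sub>a f"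
  using tensA_assoc[of "Ide C X" "Ide C Y" f] by simp

lemma tensA_iso [simp]:
  assumes "is_iso C f" "is_iso C g" shows "is_iso C (f \<otimes>\<^sub>a g)"
  by (rule is_isoI[of _ "Dom C f \<otimes>\<^sub>o Dom C g" "Cod C f \<otimes>\<^sub>o Cod C g" "inv_arr C f \<otimes>\<^sub>a inv_arr C g"])
     (use assms in \<open>auto simp: iso_arr Hom_def interchange\<close>)

lemma inv_arr_tensA:
  assumes "is_iso C f" "is_iso C g" shows "inv_arr C (f \<otimes>\<^sub>a g) = inv_arr C f \<otimes>\<^sub>a inv_arr C g"
  by (rule inv_arr_eqI) (use assms in \<open>auto simp: is_inverse_def iso_arr Hom_def interchange\<close>)

text \<open>The inverse at X is the mate of s at a right dual Y: bend Y around with \<open>c\<close>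
  and \<open>e\<close>. Multiplicativity merges s at X and s at Y into s at their product,
  naturality at \<open>e\<close> or \<open>c\<close> replaces this by s at the unit object, and a
  zigzag identity remains.\<close>

lemma half_braiding_is_iso:
  assumes dual: "left_dual C Y X e c"
    and A: "A \<in> Ob C"
    and s: "\<And>Z. Z \<in> Ob C \<Longrightarrow> s Z \<in> Hom C (A \<otimes>\<^sub>o Z) (Z \<otimes>\<^sub>o A)"
    and nat: "\<And>f. f \<in> Arr C \<Longrightarrow> (f \<otimes>\<^sub>a Ide C A) \<cdot> s (Dom C f) = s (Cod C f) \<cdot> (Ide C A \<otimes>\<^sub>a f)"
    and mult: "\<And>Z Z'. Z \<in> Ob C \<Longrightarrow> Z' \<in> Ob C
      \<Longrightarrow> s (Z \<otimes>\<^sub>o Z') = (Ide C Z \<otimes>\<^sub>a s Z') \<cdot> (s Z \<otimes>\<^sub>a Ide C Z')"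
    and unit: "s (Unit C) = Ide C A"
  shows "is_iso C (s X)"
proof -
  have ob [simp]: "X \<in> Ob C" "Y \<in> Ob C" "A \<in> Ob C" using dual A by (auto simp: left_dual_def)
  have [simp]: "e \<in> Arr C" "Dom C e = X \<otimes>\<^sub>o Y" "Cod C e = Unit C"
    "c \<in> Arr C" "Dom C c = Unit C" "Cod C c = Y \<otimes>\<^sub>o X"
    using dual by (auto simp: left_dual_def Hom_def)
  have [simp]: "s Z \<in> Arr C" "Dom C (s Z) = A \<otimes>\<^sub>o Z" "Cod C (s Z) = Z \<otimes>\<^sub>o A" if "Z \<in> Ob C" for Z
    using s[OF that] by (auto simp: Hom_def)
  have zz: "(e \<otimes>\<^sub>a Ide C X) \<cdot> (Ide C X \<otimes>\<^sub>a c) = Ide C X" using dual by (auto simp: left_dual_def)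
  \<comment> \<open>The path X A -> X A Y X -> X Y A X -> A X, tensor signs omitted.\<close>
  define t where "t = (e \<otimes>\<^sub>a Ide C (A \<otimes>\<^sub>o X)) \<cdot> (Ide C X \<otimes>\<^sub>a s Y \<otimes>\<^sub>a Ide C X) \<cdot> (Ide C (X \<otimes>\<^sub>o A) \<otimes>\<^sub>a c)"
  have "(Ide C (X \<otimes>\<^sub>o A) \<otimes>\<^sub>a c) \<cdot> s X = (s X \<otimes>\<^sub>a Ide C (Y \<otimes>\<^sub>o X)) \<cdot> (Ide C (A \<otimes>\<^sub>o X) \<otimes>\<^sub>a c)"
    using interchange[of "s X" "Ide C (X \<otimes>\<^sub>o A)" "Ide C (Unit C)" c] by (simp add: interchange)
  then have "t \<cdot> s X = (e \<otimes>\<^sub>a Ide C (A \<otimes>\<^sub>o X)) \<cdot> (Ide C X \<otimes>\<^sub>a s Y \<otimes>\<^sub>a Ide C X)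
      \<cdot> (s X \<otimes>\<^sub>a Ide C (Y \<otimes>\<^sub>o X)) \<cdot> (Ide C (A \<otimes>\<^sub>o X) \<otimes>\<^sub>a c)"
    unfolding t_def by simp
  also have "(Ide C X \<otimes>\<^sub>a s Y \<otimes>\<^sub>a Ide C X) \<cdot> (s X \<otimes>\<^sub>a Ide C (Y \<otimes>\<^sub>o X)) \<cdot> (Ide C (A \<otimes>\<^sub>o X) \<otimes>\<^sub>a c)
      = (s (X \<otimes>\<^sub>o Y) \<otimes>\<^sub>a Ide C X) \<cdot> (Ide C (A \<otimes>\<^sub>o X) \<otimes>\<^sub>a c)"
    using interchange[of "s X \<otimes>\<^sub>a Ide C Y" "Ide C X \<otimes>\<^sub>a s Y" "Ide C X" "Ide C X"]
    by (intro comp_tail) (simp_all add: mult)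
  \<comment> \<open>Naturality of s at \<open>e\<close>, together with \<open>unit\<close>, carries
    \<open>e\<close> to the other side of A.\<close>
  also have "(e \<otimes>\<^sub>a Ide C (A \<otimes>\<^sub>o X)) \<cdot> (s (X \<otimes>\<^sub>o Y) \<otimes>\<^sub>a Ide C X) \<cdot> (Ide C (A \<otimes>\<^sub>o X) \<otimes>\<^sub>a c)
      = (Ide C A \<otimes>\<^sub>a e \<otimes>\<^sub>a Ide C X) \<cdot> (Ide C (A \<otimes>\<^sub>o X) \<otimes>\<^sub>a c)"
    using interchange[of "s (X \<otimes>\<^sub>o Y)" "e \<otimes>\<^sub>a Ide C A" "Ide C X" "Ide C X"] nat[of e]
    by (intro comp_tail) (simp_all add: unit)
  also have "\<dots> = Ide C (A \<otimes>\<^sub>o X)"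
    using interchange[of "Ide C A" "Ide C A" "Ide C X \<otimes>\<^sub>a c" "e \<otimes>\<^sub>a Ide C X"] zz by simp
  finally have ts: "t \<cdot> s X = Ide C (A \<otimes>\<^sub>o X)" .
  \<comment> \<open>For the other composite \<open>e\<close> first slides past s at X; then s at Y X
    appears and naturality is used at \<open>c\<close>.\<close>
  have "s X \<cdot> (e \<otimes>\<^sub>a Ide C (A \<otimes>\<^sub>o X)) = (e \<otimes>\<^sub>a Ide C (X \<otimes>\<^sub>o A)) \<cdot> (Ide C (X \<otimes>\<^sub>o Y) \<otimes>\<^sub>a s X)"
    using interchange[of e "Ide C (Unit C)" "Ide C (A \<otimes>\<^sub>o X)" "s X"] by (simp add: interchange)
  then have "s X \<cdot> t = (e \<otimes>\<^sub>a Ide C (X \<otimes>\<^sub>o A)) \<cdot> (Ide C (X \<otimes>\<^sub>o Y) \<otimes>\<^sub>a s X)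
      \<cdot> (Ide C X \<otimes>\<^sub>a s Y \<otimes>\<^sub>a Ide C X) \<cdot> (Ide C (X \<otimes>\<^sub>o A) \<otimes>\<^sub>a c)"
    unfolding t_def using comp_tail[of "s X" "e \<otimes>\<^sub>a Ide C (A \<otimes>\<^sub>o X)"] by simp
  also have "(Ide C (X \<otimes>\<^sub>o Y) \<otimes>\<^sub>a s X) \<cdot> (Ide C X \<otimes>\<^sub>a s Y \<otimes>\<^sub>a Ide C X) \<cdot> (Ide C (X \<otimes>\<^sub>o A) \<otimes>\<^sub>a c)
      = (Ide C X \<otimes>\<^sub>a s (Y \<otimes>\<^sub>o X)) \<cdot> (Ide C (X \<otimes>\<^sub>o A) \<otimes>\<^sub>a c)"
    using interchange[of "Ide C X" "Ide C X" "s Y \<otimes>\<^sub>a Ide C X" "Ide C Y \<otimes>\<^sub>a s X"]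
    by (intro comp_tail) (simp_all add: mult)
  also have "\<dots> = Ide C X \<otimes>\<^sub>a c \<otimes>\<^sub>a Ide C A"
    using interchange[of "Ide C X" "Ide C X" "Ide C A \<otimes>\<^sub>a c" "s (Y \<otimes>\<^sub>o X)"] nat[of c] by (simp add: unit)
  also have "(e \<otimes>\<^sub>a Ide C (X \<otimes>\<^sub>o A)) \<cdot> (Ide C X \<otimes>\<^sub>a c \<otimes>\<^sub>a Ide C A) = Ide C (X \<otimes>\<^sub>o A)"
    using interchange[of "Ide C X \<otimes>\<^sub>a c" "e \<otimes>\<^sub>a Ide C X" "Ide C A" "Ide C A"] zz by simp
  finally have st: "s X \<cdot> t = Ide C (X \<otimes>\<^sub>o A)" .
  have "t \<in> Hom C (X \<otimes>\<^sub>o A) (A \<otimes>\<^sub>o X)" unfolding t_def by (simp add: Hom_def)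
  then show ?thesis using is_isoI[OF s] ts st by simp
qed

end

sublocale tensor_category \<subseteq> strict_monoidal C
  by unfold_locales (simp_all add: tensO_ob unit_ob tensA_hom tensA_ide tensA_comp tensO_assoc
    tensA_assoc tensO_unit tensA_unit)

section \<open>Central arrows\<close>

definition wide_subcat :: "('o, 'a, 'm) cat_scheme \<Rightarrow> ('a \<Rightarrow> bool) \<Rightarrow> ('o, 'a, 'm) cat_scheme" where
  "wide_subcat C P = C\<lparr>Arr := {f \<in> Arr C. P f}\<rparr>"

lemma wide_subcat_sel [simp]:
  "Ob (wide_subcat C P) = Ob C" "Arr (wide_subcat C P) = {f \<in> Arr C. P f}"
  "Dom (wide_subcat C P) = Dom C" "Cod (wide_subcat C P) = Cod C"
  "Comp (wide_subcat C P) = Comp C" "Ide (wide_subcat C P) = Ide C"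
  by (simp_all add: wide_subcat_def)

lemma wide_subcat_mon_sel [simp]:
  fixes C :: "('k, 'o, 'a, 'm) moncat_scheme"
  shows "TensO (wide_subcat C P) = TensO C" "TensA (wide_subcat C P) = TensA C"
    "Unit (wide_subcat C P) = Unit C"
  by (simp_all add: wide_subcat_def)

lemma wide_subcat_hom: "f \<in> Hom (wide_subcat C P) X Y \<longleftrightarrow> f \<in> Hom C X Y \<and> P f"
  by (auto simp: Hom_def)

text \<open>The arrows at which all families in S are natural. With the half-braidings of the
  objects G W as S, this expresses compatibility with the action of V.\<close>

definition central_arr ::
    "('k, 'o, 'a, 'm) moncat_scheme \<Rightarrow> ('o \<times> ('o \<Rightarrow> 'a)) set \<Rightarrow> 'a \<Rightarrow> bool" where
  "central_arr C S f \<longleftrightarrow> (\<forall>(B, s)\<in>S. (f \<otimes>\<^sub>a\<^bsub>C\<^esub> Ide C B) \<cdot>\<^bsub>C\<^esub> s (Dom C f)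
     = s (Cod C f) \<cdot>\<^bsub>C\<^esub> (Ide C B \<otimes>\<^sub>a\<^bsub>C\<^esub> f))"

context strict_monoidal
begin

lemma tens_split:
  assumes "f \<in> Arr C" "g \<in> Arr C"
  shows "(f \<otimes>\<^sub>a Ide C (Cod C g)) \<cdot> (Ide C (Dom C f) \<otimes>\<^sub>a g) = f \<otimes>\<^sub>a g"
    and "(Ide C (Cod C f) \<otimes>\<^sub>a g) \<cdot> (f \<otimes>\<^sub>a Ide C (Dom C g)) = f \<otimes>\<^sub>a g"
  using assms by (simp_all add: interchange)

lemma strict_monoidal_wide_subcat:
  assumes ide: "\<And>X. X \<in> Ob C \<Longrightarrow> P (Ide C X)"
    and comp: "\<And>f g. \<lbrakk>f \<in> Arr C; g \<in> Arr C; Dom C g = Cod C f; P f; P g\<rbrakk> \<Longrightarrow> P (g \<cdot> f)"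
    and tens: "\<And>f g. \<lbrakk>f \<in> Arr C; g \<in> Arr C; P f; P g\<rbrakk> \<Longrightarrow> P (f \<otimes>\<^sub>a g)"
  shows "strict_monoidal (wide_subcat C P)"
  by unfold_locales (auto simp: wide_subcat_hom ide tensA_comp comp_ide_left comp_ide_right comp_assoc
    ide_hom intro!: comp_hom tensA_hom comp tens, auto simp: Hom_def)

lemma central_arr_ide:
  assumes "\<And>B s X. (B, s) \<in> S \<Longrightarrow> X \<in> Ob C \<Longrightarrow> B \<in> Ob C \<and> s X \<in> Hom C (B \<otimes>\<^sub>o X) (X \<otimes>\<^sub>o B)"
    and "X \<in> Ob C"
  shows "central_arr C S (Ide C X)"
  using assms by (fastforce simp: central_arr_def Hom_def)

lemma central_arr_comp:
  assumes S: "\<And>B s X. (B, s) \<in> S \<Longrightarrow> X \<in> Ob C \<Longrightarrow> B \<in> Ob C \<and> s X \<in> Hom C (B \<otimes>\<^sub>o X) (X \<otimes>\<^sub>o B)"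
    and [simp]: "f \<in> Arr C" "g \<in> Arr C" "Dom C g = Cod C f"
    and c: "central_arr C S f" "central_arr C S g"
  shows "central_arr C S (g \<cdot> f)"
  unfolding central_arr_def
proof safe
  fix B s assume Bs: "(B, s) \<in> S"
  have [simp]: "B \<in> Ob C" using S[OF Bs, of "Dom C f"] by simp
  have [simp]: "s X \<in> Arr C" "Dom C (s X) = B \<otimes>\<^sub>o X" "Cod C (s X) = X \<otimes>\<^sub>o B" if "X \<in> Ob C" for X
    using S[OF Bs that] by (auto simp: Hom_def)
  have cf: "(f \<otimes>\<^sub>a Ide C B) \<cdot> s (Dom C f) = s (Cod C f) \<cdot> (Ide C B \<otimes>\<^sub>a f)"
    and cg: "(g \<otimes>\<^sub>a Ide C B) \<cdot> s (Cod C f) = s (Cod C g) \<cdot> (Ide C B \<otimes>\<^sub>a g)"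
    using c Bs by (auto simp: central_arr_def)
  have "((g \<cdot> f) \<otimes>\<^sub>a Ide C B) \<cdot> s (Dom C f) = (g \<otimes>\<^sub>a Ide C B) \<cdot> (f \<otimes>\<^sub>a Ide C B) \<cdot> s (Dom C f)"
    using interchange_tail[of f g "Ide C B" "Ide C B" "s (Dom C f)"] by simp
  also have "\<dots> = s (Cod C g) \<cdot> (Ide C B \<otimes>\<^sub>a g) \<cdot> (Ide C B \<otimes>\<^sub>a f)"
    using comp_tail[OF cg, of "Ide C B \<otimes>\<^sub>a f"] by (simp add: cf)
  finally show "((g \<cdot> f) \<otimes>\<^sub>a Ide C B) \<cdot> s (Dom C (g \<cdot> f)) = s (Cod C (g \<cdot> f)) \<cdot> (Ide C B \<otimes>\<^sub>a (g \<cdot> f))"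
    by (simp add: interchange)
qed

text \<open>Multiplicativity splits s at a product, so that g passes through s at its own source and
  f through s at its own source, one after the other.\<close>

lemma central_arr_tens:
  assumes S: "\<And>B s X. (B, s) \<in> S \<Longrightarrow> X \<in> Ob C \<Longrightarrow> B \<in> Ob C \<and> s X \<in> Hom C (B \<otimes>\<^sub>o X) (X \<otimes>\<^sub>o B)"
    and mult: "\<And>B s X Y. (B, s) \<in> S \<Longrightarrow> X \<in> Ob C \<Longrightarrow> Y \<in> Ob C
      \<Longrightarrow> s (X \<otimes>\<^sub>o Y) = (Ide C X \<otimes>\<^sub>a s Y) \<cdot> (s X \<otimes>\<^sub>a Ide C Y)"
    and [simp]: "f \<in> Arr C" "g \<in> Arr C"
    and c: "central_arr C S f" "central_arr C S g"
  shows "central_arr C S (f \<otimes>\<^sub>a g)"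
  unfolding central_arr_def
proof safe
  fix B s assume Bs: "(B, s) \<in> S"
  have [simp]: "B \<in> Ob C" using S[OF Bs, of "Dom C f"] by simp
  have [simp]: "s X \<in> Arr C" "Dom C (s X) = B \<otimes>\<^sub>o X" "Cod C (s X) = X \<otimes>\<^sub>o B" if "X \<in> Ob C" for X
    using S[OF Bs that] by (auto simp: Hom_def)
  let ?X = "Dom C f" and ?X' = "Cod C f" and ?Y = "Dom C g" and ?Y' = "Cod C g"
  have cf: "(f \<otimes>\<^sub>a Ide C B) \<cdot> s ?X = s ?X' \<cdot> (Ide C B \<otimes>\<^sub>a f)"
    and cg: "(g \<otimes>\<^sub>a Ide C B) \<cdot> s ?Y = s ?Y' \<cdot> (Ide C B \<otimes>\<^sub>a g)"
    using c Bs by (auto simp: central_arr_def)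
  have "(f \<otimes>\<^sub>a g \<otimes>\<^sub>a Ide C B) \<cdot> s (?X \<otimes>\<^sub>o ?Y)
      = (f \<otimes>\<^sub>a ((g \<otimes>\<^sub>a Ide C B) \<cdot> s ?Y)) \<cdot> (s ?X \<otimes>\<^sub>a Ide C ?Y)"
    using interchange_tail[of "Ide C ?X" f "s ?Y" "g \<otimes>\<^sub>a Ide C B" "s ?X \<otimes>\<^sub>a Ide C ?Y"]
    by (simp add: mult[OF Bs])
  also have "\<dots> = (Ide C ?X' \<otimes>\<^sub>a s ?Y') \<cdot> (f \<otimes>\<^sub>a Ide C B \<otimes>\<^sub>a g) \<cdot> (s ?X \<otimes>\<^sub>a Ide C ?Y)"
    using interchange_tail[of f "Ide C ?X'" "Ide C B \<otimes>\<^sub>a g" "s ?Y'" "s ?X \<otimes>\<^sub>a Ide C ?Y"] by (simp add: cg)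
  also have "(f \<otimes>\<^sub>a Ide C B \<otimes>\<^sub>a g) \<cdot> (s ?X \<otimes>\<^sub>a Ide C ?Y) = (s ?X' \<cdot> (Ide C B \<otimes>\<^sub>a f)) \<otimes>\<^sub>a g"
    using interchange[of "s ?X" "f \<otimes>\<^sub>a Ide C B" "Ide C ?Y" g] by (simp add: cf)
  also have "\<dots> = (s ?X' \<otimes>\<^sub>a Ide C ?Y') \<cdot> (Ide C B \<otimes>\<^sub>a f \<otimes>\<^sub>a g)"
    using interchange[of "Ide C B \<otimes>\<^sub>a f" "s ?X'" g "Ide C ?Y'"] by simp
  finally show "((f \<otimes>\<^sub>a g) \<otimes>\<^sub>a Ide C B) \<cdot> s (Dom C (f \<otimes>\<^sub>a g))
      = s (Cod C (f \<otimes>\<^sub>a g)) \<cdot> (Ide C B \<otimes>\<^sub>a f \<otimes>\<^sub>a g)"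
    by (simp add: mult[OF Bs])
qed

lemma strict_monoidal_central:
  assumes "\<And>B s X. (B, s) \<in> S \<Longrightarrow> X \<in> Ob C \<Longrightarrow> B \<in> Ob C \<and> s X \<in> Hom C (B \<otimes>\<^sub>o X) (X \<otimes>\<^sub>o B)"
    and "\<And>B s X Y. (B, s) \<in> S \<Longrightarrow> X \<in> Ob C \<Longrightarrow> Y \<in> Ob C
      \<Longrightarrow> s (X \<otimes>\<^sub>o Y) = (Ide C X \<otimes>\<^sub>a s Y) \<cdot> (s X \<otimes>\<^sub>a Ide C Y)"
  shows "strict_monoidal (wide_subcat C (central_arr C S))"
  by (rule strict_monoidal_wide_subcat)
    (rule central_arr_ide central_arr_comp central_arr_tens; use assms in blast)+

end

section \<open>The half-braiding of a corepresenting object\<close>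

text \<open>J is a strict monoidal functor that is the identity on objects. Sharing the objects lets
  equations in E and in C be stated side by side without transport.\<close>

locale strict_extension = strict_monoidal C + E: strict_monoidal E
  for C :: "('k, 'o, 'a, 'm) moncat_scheme" (structure) and E :: "('l, 'o, 'e, 'n) moncat_scheme" +
  fixes J :: "'a \<Rightarrow> 'e"
  assumes ob_E [simp]: "Ob E = Ob C"
    and tensO_E [simp]: "\<lbrakk>X \<in> Ob C; Y \<in> Ob C\<rbrakk> \<Longrightarrow> X \<otimes>\<^sub>o\<^bsub>E\<^esub> Y = X \<otimes>\<^sub>o Y"
    and unit_E [simp]: "Unit E = Unit C"
    and J_hom: "f \<in> Hom C X Y \<Longrightarrow> J f \<in> Hom E X Y"
    and J_ide [simp]: "X \<in> Ob C \<Longrightarrow> J (Ide C X) = Ide E X"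
    and J_comp [simp]: "\<lbrakk>f \<in> Arr C; g \<in> Arr C; Dom C g = Cod C f\<rbrakk> \<Longrightarrow> J (g \<cdot> f) = J g \<cdot>\<^bsub>E\<^esub> J f"
    and J_tens [simp]: "\<lbrakk>f \<in> Arr C; g \<in> Arr C\<rbrakk> \<Longrightarrow> J (f \<otimes>\<^sub>a g) = J f \<otimes>\<^sub>a\<^bsub>E\<^esub> J g"
begin

lemma J_arr [simp]: "f \<in> Arr C \<Longrightarrow> J f \<in> Arr E"
  and J_dom [simp]: "f \<in> Arr C \<Longrightarrow> Dom E (J f) = Dom C f"
  and J_cod [simp]: "f \<in> Arr C \<Longrightarrow> Cod E (J f) = Cod C f"
  using J_hom[of f "Dom C f" "Cod C f"] by (auto simp: Hom_def)

lemma E_unit [simp]: "f \<in> Arr E \<Longrightarrow> Ide E (Unit C) \<otimes>\<^sub>a\<^bsub>E\<^esub> f = f"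
  "f \<in> Arr E \<Longrightarrow> f \<otimes>\<^sub>a\<^bsub>E\<^esub> Ide E (Unit C) = f"
  using E.tensA_unit by auto

end

locale corepresented = strict_extension C E J
  for C :: "('k, 'o, 'a, 'm) moncat_scheme" (structure) and E :: "('l, 'o, 'e, 'n) moncat_scheme"
    and J :: "'a \<Rightarrow> 'e" +
  fixes A :: 'o and ep :: 'e
  assumes left_duals: "X \<in> Ob C \<Longrightarrow> \<exists>Y e c. left_dual C X Y e c"
    and right_duals: "X \<in> Ob C \<Longrightarrow> \<exists>Y e c. left_dual C Y X e c"
    and A_ob [simp]: "A \<in> Ob C"
    and ep_hom: "ep \<in> Hom E A (Unit C)"
    and universal: "\<lbrakk>Z \<in> Ob C; z \<in> Hom E Z (Unit C)\<rbrakk> \<Longrightarrow> \<exists>!f. f \<in> Hom C Z A \<and> ep \<cdot>\<^bsub>E\<^esub> J f = z"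
begin

lemma ep_simps [simp]: "ep \<in> Arr E" "Dom E ep = A" "Cod E ep = Unit C"
  using ep_hom by (auto simp: Hom_def)

text \<open>Duality moves \<open>X\<close> to the other side, which reduces this to \<open>X = 1\<close>.\<close>

lemma universal_tens:
  assumes [simp]: "X \<in> Ob C" "Z \<in> Ob C" and z: "z \<in> Hom E Z X"
  shows "\<exists>!f. f \<in> Hom C Z (X \<otimes>\<^sub>o A) \<and> (Ide E X \<otimes>\<^sub>a\<^bsub>E\<^esub> ep) \<cdot>\<^bsub>E\<^esub> J f = z"
proof -
  obtain Y e c where dual: "left_dual C X Y e c" using left_duals[OF assms(1)] by blast
  have [simp]: "Y \<in> Ob C" "e \<in> Arr C" "Dom C e = Y \<otimes>\<^sub>o X" "Cod C e = Unit C"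
    "c \<in> Arr C" "Dom C c = Unit C" "Cod C c = X \<otimes>\<^sub>o Y"
    using dual by (auto simp: left_dual_def Hom_def)
  have zz: "(Ide C X \<otimes>\<^sub>a e) \<cdot> (c \<otimes>\<^sub>a Ide C X) = Ide C X" using dual by (auto simp: left_dual_def)
  have zzJ: "(Ide E X \<otimes>\<^sub>a\<^bsub>E\<^esub> J e) \<cdot>\<^bsub>E\<^esub> (J c \<otimes>\<^sub>a\<^bsub>E\<^esub> Ide E X) = Ide E X"
    using arg_cong[OF zz, of J] by simp
  have [simp]: "z \<in> Arr E" "Dom E z = Z" "Cod E z = X" using z by (auto simp: Hom_def)
  \<comment> \<open>The transpose Y Z -> Y X -> 1 of z, to which the universal property of A
    applies.\<close>
  let ?z' = "J e \<cdot>\<^bsub>E\<^esub> (Ide E Y \<otimes>\<^sub>a\<^bsub>E\<^esub> z)"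
  have ex1: "\<exists>!f'. f' \<in> Hom C (Y \<otimes>\<^sub>o Z) A \<and> ep \<cdot>\<^bsub>E\<^esub> J f' = ?z'"
    by (rule universal) (auto simp: Hom_def)
  then obtain f' where f': "f' \<in> Hom C (Y \<otimes>\<^sub>o Z) A" "ep \<cdot>\<^bsub>E\<^esub> J f' = ?z'" by blast
  have [simp]: "f' \<in> Arr C" "Dom C f' = Y \<otimes>\<^sub>o Z" "Cod C f' = A" using f' by (auto simp: Hom_def)
  show ?thesis
  proof (rule ex_ex1I)
    have "(Ide E X \<otimes>\<^sub>a\<^bsub>E\<^esub> ep) \<cdot>\<^bsub>E\<^esub> J ((Ide C X \<otimes>\<^sub>a f') \<cdot> (c \<otimes>\<^sub>a Ide C Z))
        = (Ide E X \<otimes>\<^sub>a\<^bsub>E\<^esub> ?z') \<cdot>\<^bsub>E\<^esub> (J c \<otimes>\<^sub>a\<^bsub>E\<^esub> Ide E Z)"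
      using f'(2) by (simp add: E.interchange_tail)
    also have "\<dots> = (Ide E X \<otimes>\<^sub>a\<^bsub>E\<^esub> J e) \<cdot>\<^bsub>E\<^esub> (Ide E (X \<otimes>\<^sub>o Y) \<otimes>\<^sub>a\<^bsub>E\<^esub> z) \<cdot>\<^bsub>E\<^esub> (J c \<otimes>\<^sub>a\<^bsub>E\<^esub> Ide E Z)"
      using E.interchange_tail[of "Ide E X" "Ide E X" "Ide E Y \<otimes>\<^sub>a\<^bsub>E\<^esub> z" "J e" "J c \<otimes>\<^sub>a\<^bsub>E\<^esub> Ide E Z"] by simp
    also have "(Ide E (X \<otimes>\<^sub>o Y) \<otimes>\<^sub>a\<^bsub>E\<^esub> z) \<cdot>\<^bsub>E\<^esub> (J c \<otimes>\<^sub>a\<^bsub>E\<^esub> Ide E Z) = (J c \<otimes>\<^sub>a\<^bsub>E\<^esub> Ide E X) \<cdot>\<^bsub>E\<^esub> z"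
      using E.tens_split[of "J c" z] by simp
    also have "(Ide E X \<otimes>\<^sub>a\<^bsub>E\<^esub> J e) \<cdot>\<^bsub>E\<^esub> (J c \<otimes>\<^sub>a\<^bsub>E\<^esub> Ide E X) \<cdot>\<^bsub>E\<^esub> z = z"
      using E.comp_tail[OF zzJ, of z] by simp
    finally show "\<exists>f. f \<in> Hom C Z (X \<otimes>\<^sub>o A) \<and> (Ide E X \<otimes>\<^sub>a\<^bsub>E\<^esub> ep) \<cdot>\<^bsub>E\<^esub> J f = z"
      by (intro exI[of _ "(Ide C X \<otimes>\<^sub>a f') \<cdot> (c \<otimes>\<^sub>a Ide C Z)"]) (simp add: Hom_def)
  next
    have eq: "f = (Ide C X \<otimes>\<^sub>a f') \<cdot> (c \<otimes>\<^sub>a Ide C Z)"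
      if f: "f \<in> Hom C Z (X \<otimes>\<^sub>o A) \<and> (Ide E X \<otimes>\<^sub>a\<^bsub>E\<^esub> ep) \<cdot>\<^bsub>E\<^esub> J f = z" for f
    proof -
      have [simp]: "f \<in> Arr C" "Dom C f = Z" "Cod C f = X \<otimes>\<^sub>o A" using f by (auto simp: Hom_def)
      \<comment> \<open>The transpose of an arbitrary solution f. Followed by \<open>ep\<close> it
        equals the transpose of z, hence it is f', and transposing back by the zigzag identity
        recovers f.\<close>
      let ?g = "(e \<otimes>\<^sub>a Ide C A) \<cdot> (Ide C Y \<otimes>\<^sub>a f)"
      have "ep \<cdot>\<^bsub>E\<^esub> J ?g = (J e \<cdot>\<^bsub>E\<^esub> (Ide E (Y \<otimes>\<^sub>o X) \<otimes>\<^sub>a\<^bsub>E\<^esub> ep)) \<cdot>\<^bsub>E\<^esub> (Ide E Y \<otimes>\<^sub>a\<^bsub>E\<^esub> J f)"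
        using E.tens_split[of "J e" ep] E.comp_tail[of ep "J e \<otimes>\<^sub>a\<^bsub>E\<^esub> Ide E A"] by simp
      also have "\<dots> = ?z'"
        using E.interchange[of "Ide E Y" "Ide E Y" "J f" "Ide E X \<otimes>\<^sub>a\<^bsub>E\<^esub> ep"] f by simp
      finally have "?g = f'" using ex1 f' by (auto simp: Hom_def)
      then have "(Ide C X \<otimes>\<^sub>a f') \<cdot> (c \<otimes>\<^sub>a Ide C Z)
          = (Ide C X \<otimes>\<^sub>a e \<otimes>\<^sub>a Ide C A) \<cdot> (Ide C (X \<otimes>\<^sub>o Y) \<otimes>\<^sub>a f) \<cdot> (c \<otimes>\<^sub>a Ide C Z)"
        using interchange_tail[of "Ide C X" "Ide C X" "Ide C Y \<otimes>\<^sub>a f" "e \<otimes>\<^sub>a Ide C A" "c \<otimes>\<^sub>a Ide C Z"] by simp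
      also have "(Ide C (X \<otimes>\<^sub>o Y) \<otimes>\<^sub>a f) \<cdot> (c \<otimes>\<^sub>a Ide C Z) = (c \<otimes>\<^sub>a Ide C (X \<otimes>\<^sub>o A)) \<cdot> f"
        using tens_split[of c f] by simp
      also have "(Ide C X \<otimes>\<^sub>a e \<otimes>\<^sub>a Ide C A) \<cdot> (c \<otimes>\<^sub>a Ide C (X \<otimes>\<^sub>o A)) \<cdot> f = f"
        using comp_tail[OF interchange[of "c \<otimes>\<^sub>a Ide C X" "Ide C X \<otimes>\<^sub>a e" "Ide C A" "Ide C A"], of f] zz
        by simp
      finally show ?thesis ..
    qed
    show "f = g" if "f \<in> Hom C Z (X \<otimes>\<^sub>o A) \<and> (Ide E X \<otimes>\<^sub>a\<^bsub>E\<^esub> ep) \<cdot>\<^bsub>E\<^esub> J f = z"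
      "g \<in> Hom C Z (X \<otimes>\<^sub>o A) \<and> (Ide E X \<otimes>\<^sub>a\<^bsub>E\<^esub> ep) \<cdot>\<^bsub>E\<^esub> J g = z" for f g
      using eq[OF that(1)] eq[OF that(2)] by simp
  qed
qed

lemma universal_eqI:
  assumes "f \<in> Arr C" "g \<in> Arr C" "Dom C g = Dom C f" "Cod C f = X \<otimes>\<^sub>o A" "Cod C g = X \<otimes>\<^sub>o A" "X \<in> Ob C"
    and "(Ide E X \<otimes>\<^sub>a\<^bsub>E\<^esub> ep) \<cdot>\<^bsub>E\<^esub> J f = (Ide E X \<otimes>\<^sub>a\<^bsub>E\<^esub> ep) \<cdot>\<^bsub>E\<^esub> J g"
  shows "f = g"
proof -
  have "(Ide E X \<otimes>\<^sub>a\<^bsub>E\<^esub> ep) \<cdot>\<^bsub>E\<^esub> J g \<in> Hom E (Dom C f) X" using assms(1-6) by (simp add: Hom_def)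
  from universal_tens[OF _ _ this] assms show ?thesis by (auto simp: Hom_def)
qed

section \<open>The arrows s determined by their composites with X tensor \<open>ep\<close>\<close>

context
  fixes s
  assumes s_hom: "\<And>X. X \<in> Ob C \<Longrightarrow> s X \<in> Hom C (A \<otimes>\<^sub>o X) (X \<otimes>\<^sub>o A)"
    and s_ep: "\<And>X. X \<in> Ob C \<Longrightarrow> (Ide E X \<otimes>\<^sub>a\<^bsub>E\<^esub> ep) \<cdot>\<^bsub>E\<^esub> J (s X) = ep \<otimes>\<^sub>a\<^bsub>E\<^esub> Ide E X"
begin

lemma s_simps:
  "X \<in> Ob C \<Longrightarrow> s X \<in> Arr C" "X \<in> Ob C \<Longrightarrow> Dom C (s X) = A \<otimes>\<^sub>o X" "X \<in> Ob C \<Longrightarrow> Cod C (s X) = X \<otimes>\<^sub>o A"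
  using s_hom by (auto simp: Hom_def)

text \<open>After composing with Y tensor \<open>ep\<close>, where Y is the target of f, both sides
  are \<open>ep\<close> tensor \<open>J f\<close>: the interchange law in E moves \<open>ep\<close>
  past f, and \<open>s_ep\<close> exchanges the two factors.\<close>

lemma s_natural:
  assumes [simp]: "f \<in> Arr C"
  shows "(f \<otimes>\<^sub>a Ide C A) \<cdot> s (Dom C f) = s (Cod C f) \<cdot> (Ide C A \<otimes>\<^sub>a f)"
proof (rule universal_eqI[of _ _ "Cod C f"])
  note s_simps [simp]
  let ?X = "Dom C f" and ?Y = "Cod C f"
  have "(Ide E ?Y \<otimes>\<^sub>a\<^bsub>E\<^esub> ep) \<cdot>\<^bsub>E\<^esub> J ((f \<otimes>\<^sub>a Ide C A) \<cdot> s ?X) = (J f \<otimes>\<^sub>a\<^bsub>E\<^esub> ep) \<cdot>\<^bsub>E\<^esub> J (s ?X)"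
    by (simp add: E.interchange_tail)
  also have "\<dots> = J f \<cdot>\<^bsub>E\<^esub> (ep \<otimes>\<^sub>a\<^bsub>E\<^esub> Ide E ?X)"
    using s_ep[of ?X] E.comp_tail[OF E.tens_split(1)[of "J f" ep], of "J (s ?X)"] by simp
  also have "\<dots> = ep \<otimes>\<^sub>a\<^bsub>E\<^esub> J f" using E.tens_split(2)[of ep "J f"] by simp
  also have "\<dots> = (Ide E ?Y \<otimes>\<^sub>a\<^bsub>E\<^esub> ep) \<cdot>\<^bsub>E\<^esub> J (s ?Y \<cdot> (Ide C A \<otimes>\<^sub>a f))"
    using E.comp_tail[OF s_ep[of ?Y]] E.tens_split(1)[of ep "J f"] by simp
  finally show "(Ide E ?Y \<otimes>\<^sub>a\<^bsub>E\<^esub> ep) \<cdot>\<^bsub>E\<^esub> J ((f \<otimes>\<^sub>a Ide C A) \<cdot> s ?X)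
      = (Ide E ?Y \<otimes>\<^sub>a\<^bsub>E\<^esub> ep) \<cdot>\<^bsub>E\<^esub> J (s ?Y \<cdot> (Ide C A \<otimes>\<^sub>a f))" .
qed (simp_all add: s_simps)

text \<open>Composing with the test arrow lets \<open>s_ep\<close> carry \<open>ep\<close> first
  past Y and then past X, which is what \<open>s_ep\<close> for the product does at once.\<close>

lemma s_tens:
  assumes [simp]: "X \<in> Ob C" "Y \<in> Ob C"
  shows "s (X \<otimes>\<^sub>o Y) = (Ide C X \<otimes>\<^sub>a s Y) \<cdot> (s X \<otimes>\<^sub>a Ide C Y)"
proof (rule universal_eqI[of _ _ "X \<otimes>\<^sub>o Y"])
  note s_simps [simp]
  have "(Ide E (X \<otimes>\<^sub>o Y) \<otimes>\<^sub>a\<^bsub>E\<^esub> ep) \<cdot>\<^bsub>E\<^esub> J ((Ide C X \<otimes>\<^sub>a s Y) \<cdot> (s X \<otimes>\<^sub>a Ide C Y))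
      = (Ide E X \<otimes>\<^sub>a\<^bsub>E\<^esub> (ep \<otimes>\<^sub>a\<^bsub>E\<^esub> Ide E Y)) \<cdot>\<^bsub>E\<^esub> (J (s X) \<otimes>\<^sub>a\<^bsub>E\<^esub> Ide E Y)"
    using E.interchange_tail[of "Ide E X" "Ide E X" "J (s Y)" "Ide E Y \<otimes>\<^sub>a\<^bsub>E\<^esub> ep" "J (s X) \<otimes>\<^sub>a\<^bsub>E\<^esub> Ide E Y"]
    by (simp add: s_ep)
  also have "\<dots> = ep \<otimes>\<^sub>a\<^bsub>E\<^esub> Ide E (X \<otimes>\<^sub>o Y)"
    using E.interchange[of "J (s X)" "Ide E X \<otimes>\<^sub>a\<^bsub>E\<^esub> ep" "Ide E Y" "Ide E Y"] by (simp add: s_ep)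
  finally show "(Ide E (X \<otimes>\<^sub>o Y) \<otimes>\<^sub>a\<^bsub>E\<^esub> ep) \<cdot>\<^bsub>E\<^esub> J (s (X \<otimes>\<^sub>o Y))
      = (Ide E (X \<otimes>\<^sub>o Y) \<otimes>\<^sub>a\<^bsub>E\<^esub> ep) \<cdot>\<^bsub>E\<^esub> J ((Ide C X \<otimes>\<^sub>a s Y) \<cdot> (s X \<otimes>\<^sub>a Ide C Y))"
    by (simp add: s_ep)
qed (simp_all add: s_simps)

lemma s_unit: "s (Unit C) = Ide C A"
  by (rule universal_eqI[of _ _ "Unit C"]) (use s_ep[of "Unit C"] s_simps[of "Unit C"] in simp_all)

text \<open>Invertibility is the remaining condition; it comes from the value of s at a right dual
  of X.\<close>

lemma half_braiding_s:
  assumes "s \<in> extensional (Ob C)"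
  shows "half_braiding C A s"
proof -
  have "is_iso C (s X)" if "X \<in> Ob C" for X
    using right_duals[OF that] half_braiding_is_iso[OF _ A_ob s_hom s_natural s_tens s_unit] by blast
  then show ?thesis using assms s_hom s_natural s_tens unfolding half_braiding_def by auto
qed

text \<open>The assumption \<open>central\<close> says that \<open>ep\<close> commutes with r, so B
  tensor \<open>ep\<close> does not distinguish s after r from the identity. With the half-braiding
  of G W at A as r, this yields the condition that defines the relative center.\<close>

lemma s_inverse:
  assumes [simp]: "B \<in> Ob C" and r: "r \<in> Hom C (B \<otimes>\<^sub>o A) (A \<otimes>\<^sub>o B)"
    and central: "(ep \<otimes>\<^sub>a\<^bsub>E\<^esub> Ide E B) \<cdot>\<^bsub>E\<^esub> J r = Ide E B \<otimes>\<^sub>a\<^bsub>E\<^esub> ep"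
  shows "s B \<cdot> r = Ide C (B \<otimes>\<^sub>o A)"
proof (rule universal_eqI[of _ _ B])
  have [simp]: "r \<in> Arr C" "Dom C r = B \<otimes>\<^sub>o A" "Cod C r = A \<otimes>\<^sub>o B" using r by (auto simp: Hom_def)
  note s_simps [simp]
  show "(Ide E B \<otimes>\<^sub>a\<^bsub>E\<^esub> ep) \<cdot>\<^bsub>E\<^esub> J (s B \<cdot> r) = (Ide E B \<otimes>\<^sub>a\<^bsub>E\<^esub> ep) \<cdot>\<^bsub>E\<^esub> J (Ide C (B \<otimes>\<^sub>o A))"
    using E.comp_tail[OF s_ep[of B], of "J r"] central by simp
qed (use r in \<open>auto simp: Hom_def s_simps\<close>)

text \<open>The assumption \<open>z\<close> is the condition on pairs for the transformation induced
  by f. Testing the claim with X tensor \<open>ep\<close> reduces it to this condition.\<close>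

lemma universal_half_braiding:
  assumes [simp]: "X \<in> Ob C" "Z \<in> Ob C" and f: "f \<in> Hom C Z A" and t: "t \<in> Hom C (Z \<otimes>\<^sub>o X) (X \<otimes>\<^sub>o Z)"
    and z: "(Ide E X \<otimes>\<^sub>a\<^bsub>E\<^esub> (ep \<cdot>\<^bsub>E\<^esub> J f)) \<cdot>\<^bsub>E\<^esub> J t = (ep \<cdot>\<^bsub>E\<^esub> J f) \<otimes>\<^sub>a\<^bsub>E\<^esub> Ide E X"
  shows "(Ide C X \<otimes>\<^sub>a f) \<cdot> t = s X \<cdot> (f \<otimes>\<^sub>a Ide C X)"
proof (rule universal_eqI[of _ _ X])
  have [simp]: "f \<in> Arr C" "Dom C f = Z" "Cod C f = A"
    "t \<in> Arr C" "Dom C t = Z \<otimes>\<^sub>o X" "Cod C t = X \<otimes>\<^sub>o Z" using f t by (auto simp: Hom_def)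
  note s_simps [simp]
  have "(Ide E X \<otimes>\<^sub>a\<^bsub>E\<^esub> ep) \<cdot>\<^bsub>E\<^esub> J (s X \<cdot> (f \<otimes>\<^sub>a Ide C X)) = (ep \<cdot>\<^bsub>E\<^esub> J f) \<otimes>\<^sub>a\<^bsub>E\<^esub> Ide E X"
    using E.comp_tail[OF s_ep[of X]] by (simp add: E.interchange)
  then show "(Ide E X \<otimes>\<^sub>a\<^bsub>E\<^esub> ep) \<cdot>\<^bsub>E\<^esub> J ((Ide C X \<otimes>\<^sub>a f) \<cdot> t) = (Ide E X \<otimes>\<^sub>a\<^bsub>E\<^esub> ep) \<cdot>\<^bsub>E\<^esub> J (s X \<cdot> (f \<otimes>\<^sub>a Ide C X))"
    using z by (simp add: E.interchange_tail)
qed (use f t in \<open>auto simp: Hom_def s_simps\<close>)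

end

end

section \<open>Natural transformations between actions\<close>

locale module_action = C: strict_monoidal C + category M
  for C :: "('k, 'o, 'a, 'm) moncat_scheme"
    and M :: "('l, 'o, 'a, 'mo, 'ma, 'n) modcat_scheme" (structure) +
  assumes actO_ob [simp]: "\<lbrakk>X \<in> Ob C; N \<in> Ob M\<rbrakk> \<Longrightarrow> X \<rhd>\<^sub>o N \<in> Ob M"
    and actA_hom: "\<lbrakk>f \<in> Hom C X X'; g \<in> Hom M N N'\<rbrakk> \<Longrightarrow> f \<rhd>\<^sub>a g \<in> Hom M (X \<rhd>\<^sub>o N) (X' \<rhd>\<^sub>o N')"
    and actA_ide [simp]: "\<lbrakk>X \<in> Ob C; N \<in> Ob M\<rbrakk> \<Longrightarrow> Ide C X \<rhd>\<^sub>a Ide M N = Ide M (X \<rhd>\<^sub>o N)"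
    and actA_comp: "\<lbrakk>f \<in> Hom C X X'; f' \<in> Hom C X' X''; g \<in> Hom M N N'; g' \<in> Hom M N' N''\<rbrakk>
      \<Longrightarrow> (f' \<cdot>\<^bsub>C\<^esub> f) \<rhd>\<^sub>a (g' \<cdot> g) = (f' \<rhd>\<^sub>a g') \<cdot> (f \<rhd>\<^sub>a g)"
    and assoc_hom: "\<lbrakk>X \<in> Ob C; Y \<in> Ob C; N \<in> Ob M\<rbrakk> \<Longrightarrow>
      Assoc M X Y N \<in> Hom M ((X \<otimes>\<^sub>o\<^bsub>C\<^esub> Y) \<rhd>\<^sub>o N) (X \<rhd>\<^sub>o Y \<rhd>\<^sub>o N) \<and> is_iso M (Assoc M X Y N)"
    and assoc_natural: "\<lbrakk>f \<in> Hom C X X'; f' \<in> Hom C Y Y'; g \<in> Hom M N N'\<rbrakk> \<Longrightarrow>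
      (f \<rhd>\<^sub>a f' \<rhd>\<^sub>a g) \<cdot> Assoc M X Y N = Assoc M X' Y' N' \<cdot> ((f \<otimes>\<^sub>a\<^bsub>C\<^esub> f') \<rhd>\<^sub>a g)"
    and assoc_pentagon: "\<lbrakk>X \<in> Ob C; Y \<in> Ob C; Z \<in> Ob C; N \<in> Ob M\<rbrakk> \<Longrightarrow>
      Assoc M X Y (Z \<rhd>\<^sub>o N) \<cdot> Assoc M (X \<otimes>\<^sub>o\<^bsub>C\<^esub> Y) Z N
        = (Ide C X \<rhd>\<^sub>a Assoc M Y Z N) \<cdot> Assoc M X (Y \<otimes>\<^sub>o\<^bsub>C\<^esub> Z) N"
    and lunit_hom: "N \<in> Ob M \<Longrightarrow> LUnit M N \<in> Hom M (Unit C \<rhd>\<^sub>o N) N \<and> is_iso M (LUnit M N)"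
    and lunit_natural: "g \<in> Hom M N N' \<Longrightarrow>
      g \<cdot> LUnit M N = LUnit M N' \<cdot> (Ide C (Unit C) \<rhd>\<^sub>a g)"
    and lunit_triangle: "\<lbrakk>X \<in> Ob C; N \<in> Ob M\<rbrakk> \<Longrightarrow>
      (Ide C X \<rhd>\<^sub>a LUnit M N) \<cdot> Assoc M X (Unit C) N = Ide M (X \<rhd>\<^sub>o N)"
begin

lemma actA_arr [simp]: "f \<in> Arr C \<Longrightarrow> g \<in> Arr M \<Longrightarrow> f \<rhd>\<^sub>a g \<in> Arr M"
  and actA_dom [simp]: "f \<in> Arr C \<Longrightarrow> g \<in> Arr M \<Longrightarrow> Dom M (f \<rhd>\<^sub>a g) = Dom C f \<rhd>\<^sub>o Dom M g"
  and actA_cod [simp]: "f \<in> Arr C \<Longrightarrow> g \<in> Arr M \<Longrightarrow> Cod M (f \<rhd>\<^sub>a g) = Cod C f \<rhd>\<^sub>o Cod M g"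
  using actA_hom[of f "Dom C f" "Cod C f" g "Dom M g" "Cod M g"] by (auto simp: Hom_def)

lemma act_interchange:
  "\<lbrakk>f \<in> Arr C; f' \<in> Arr C; g \<in> Arr M; g' \<in> Arr M; Dom C f' = Cod C f; Dom M g' = Cod M g\<rbrakk>
    \<Longrightarrow> (f' \<rhd>\<^sub>a g') \<cdot> (f \<rhd>\<^sub>a g) = (f' \<cdot>\<^bsub>C\<^esub> f) \<rhd>\<^sub>a (g' \<cdot> g)"
  using actA_comp[of f "Dom C f" "Cod C f" f' "Cod C f'" g "Dom M g" "Cod M g" g' "Cod M g'"]
  by (auto simp: Hom_def)

lemma act_interchange_tail:
  "\<lbrakk>f \<in> Arr C; f' \<in> Arr C; g \<in> Arr M; g' \<in> Arr M; Dom C f' = Cod C f; Dom M g' = Cod M g;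
     r \<in> Arr M; Cod M r = Dom C f \<rhd>\<^sub>o Dom M g\<rbrakk>
    \<Longrightarrow> (f' \<rhd>\<^sub>a g') \<cdot> ((f \<rhd>\<^sub>a g) \<cdot> r) = ((f' \<cdot>\<^bsub>C\<^esub> f) \<rhd>\<^sub>a (g' \<cdot> g)) \<cdot> r"
  by (rule comp_tail[OF act_interchange]) auto

lemma act_ide_comp:
  "\<lbrakk>X \<in> Ob C; g \<in> Arr M; g' \<in> Arr M; Dom M g' = Cod M g\<rbrakk>
    \<Longrightarrow> Ide C X \<rhd>\<^sub>a (g' \<cdot> g) = (Ide C X \<rhd>\<^sub>a g') \<cdot> (Ide C X \<rhd>\<^sub>a g)"
  using act_interchange[of "Ide C X" "Ide C X" g g'] by simp

lemma act_comp_ide: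
  "\<lbrakk>N \<in> Ob M; f \<in> Arr C; f' \<in> Arr C; Dom C f' = Cod C f\<rbrakk>
    \<Longrightarrow> (f' \<cdot>\<^bsub>C\<^esub> f) \<rhd>\<^sub>a Ide M N = (f' \<rhd>\<^sub>a Ide M N) \<cdot> (f \<rhd>\<^sub>a Ide M N)"
  using act_interchange[of f f' "Ide M N" "Ide M N"] by simp

lemma act_split:
  assumes "f \<in> Arr C" "g \<in> Arr M"
  shows "(f \<rhd>\<^sub>a Ide M (Cod M g)) \<cdot> (Ide C (Dom C f) \<rhd>\<^sub>a g) = f \<rhd>\<^sub>a g"
    and "(Ide C (Cod C f) \<rhd>\<^sub>a g) \<cdot> (f \<rhd>\<^sub>a Ide M (Dom M g)) = f \<rhd>\<^sub>a g"
  using assms by (simp_all add: act_interchange)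

lemma act_iso [simp]:
  assumes "is_iso C f" "is_iso M g" shows "is_iso M (f \<rhd>\<^sub>a g)"
  by (rule is_isoI[of _ "Dom C f \<rhd>\<^sub>o Dom M g" "Cod C f \<rhd>\<^sub>o Cod M g" "inv_arr C f \<rhd>\<^sub>a inv_arr M g"])
     (use assms in \<open>auto simp: iso_arr C.iso_arr Hom_def act_interchange\<close>)

lemma inv_arr_act:
  assumes "is_iso C f" "is_iso M g" shows "inv_arr M (f \<rhd>\<^sub>a g) = inv_arr C f \<rhd>\<^sub>a inv_arr M g"
  by (rule inv_arr_eqI) (use assms in \<open>auto simp: is_inverse_def iso_arr C.iso_arr Hom_def act_interchange\<close>)

lemma assoc_simps [simp]:
  assumes "X \<in> Ob C" "Y \<in> Ob C" "N \<in> Ob M"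
  shows "Assoc M X Y N \<in> Arr M" "Dom M (Assoc M X Y N) = (X \<otimes>\<^sub>o\<^bsub>C\<^esub> Y) \<rhd>\<^sub>o N"
    "Cod M (Assoc M X Y N) = X \<rhd>\<^sub>o Y \<rhd>\<^sub>o N" "is_iso M (Assoc M X Y N)"
  using assoc_hom[OF assms] by (auto simp: Hom_def)

lemma lunit_simps [simp]:
  assumes "N \<in> Ob M"
  shows "LUnit M N \<in> Arr M" "Dom M (LUnit M N) = Unit C \<rhd>\<^sub>o N" "Cod M (LUnit M N) = N"
    "is_iso M (LUnit M N)"
  using lunit_hom[OF assms] by (auto simp: Hom_def)

lemma assoc_nat:
  assumes "f \<in> Arr C" "f' \<in> Arr C" "g \<in> Arr M"
  shows "(f \<rhd>\<^sub>a f' \<rhd>\<^sub>a g) \<cdot> Assoc M (Dom C f) (Dom C f') (Dom M g)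
    = Assoc M (Cod C f) (Cod C f') (Cod M g) \<cdot> ((f \<otimes>\<^sub>a\<^bsub>C\<^esub> f') \<rhd>\<^sub>a g)"
  using assoc_natural[of f "Dom C f" "Cod C f" f' "Dom C f'" "Cod C f'" g "Dom M g" "Cod M g"] assms
  by (auto simp: Hom_def)

lemma assoc_nat_ide:
  assumes "f \<in> Arr C" "Y \<in> Ob C" "N \<in> Ob M"
  shows "(f \<rhd>\<^sub>a Ide M (Y \<rhd>\<^sub>o N)) \<cdot> Assoc M (Dom C f) Y N = Assoc M (Cod C f) Y N \<cdot> ((f \<otimes>\<^sub>a\<^bsub>C\<^esub> Ide C Y) \<rhd>\<^sub>a Ide M N)"
  using assoc_nat[of f "Ide C Y" "Ide M N"] assms by simp

lemma lunit_nat: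
  "g \<in> Arr M \<Longrightarrow> g \<cdot> LUnit M (Dom M g) = LUnit M (Cod M g) \<cdot> (Ide C (Unit C) \<rhd>\<^sub>a g)"
  using lunit_natural[of g "Dom M g" "Cod M g"] by (auto simp: Hom_def)

text \<open>By naturality the unit isomorphisms conjugate f into the action of 1 on f. This permits
  equations to be checked after acting with 1.\<close>

lemma unit_act_faithful:
  assumes "f \<in> Arr M" "g \<in> Arr M" "Dom M f = Dom M g" "Cod M f = Cod M g"
    "Ide C (Unit C) \<rhd>\<^sub>a f = Ide C (Unit C) \<rhd>\<^sub>a g"
  shows "f = g"
  by (rule iso_cancel_right[of "LUnit M (Dom M f)"]) (use assms lunit_nat[of f] lunit_nat[of g] in simp_all)

text \<open>The triangle identity solved for the inverse. In this form, as in
  \<open>inv_lunit_act\<close>, unit isomorphisms become associativity isomorphisms and cancel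
  against those in the tensor product of transformations.\<close>

lemma act_inv_lunit:
  assumes "X \<in> Ob C" "N \<in> Ob M"
  shows "Ide C X \<rhd>\<^sub>a inv_arr M (LUnit M N) = Assoc M X (Unit C) N"
  using iso_moveL[of "Ide C X \<rhd>\<^sub>a LUnit M N" "Assoc M X (Unit C) N" "Ide M (X \<rhd>\<^sub>o N)"]
    lunit_triangle[of X N] assms inv_arr_act[of "Ide C X" "LUnit M N"] by simp

text \<open>Kelly's argument that the second triangle identity follows from the first one.\<close>

lemma lunit_assoc:
  assumes [simp]: "X \<in> Ob C" "N \<in> Ob M"
  shows "LUnit M (X \<rhd>\<^sub>o N) \<cdot> Assoc M (Unit C) X N = Ide M (X \<rhd>\<^sub>o N)"
proof (rule unit_act_faithful)
  let ?u = "Unit C"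
  \<comment> \<open>The pentagon for 1, 1, X: since the tensor product is strict, the last factor is
    the same on both sides and cancels.\<close>
  have "Assoc M ?u ?u (X \<rhd>\<^sub>o N) = Ide C ?u \<rhd>\<^sub>a Assoc M ?u X N"
    by (rule iso_cancel_right[of "Assoc M ?u X N"]) (use assoc_pentagon[of ?u ?u X N] in simp_all)
  then show "Ide C ?u \<rhd>\<^sub>a (LUnit M (X \<rhd>\<^sub>o N) \<cdot> Assoc M ?u X N) = Ide C ?u \<rhd>\<^sub>a Ide M (X \<rhd>\<^sub>o N)"
    using lunit_triangle[of ?u "X \<rhd>\<^sub>o N"] by (simp add: act_ide_comp)
qed simp_all

lemma inv_lunit_act:
  assumes "X \<in> Ob C" "N \<in> Ob M"
  shows "inv_arr M (LUnit M (X \<rhd>\<^sub>o N)) = Assoc M (Unit C) X N"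
  using iso_moveL[of "LUnit M (X \<rhd>\<^sub>o N)" "Assoc M (Unit C) X N" "Ide M (X \<rhd>\<^sub>o N)"]
    lunit_assoc[of X N] assms by simp

end

sublocale module_category \<subseteq> module_action C M
  by unfold_locales (use actO_ob actA_hom actA_ide actA_comp assoc_hom assoc_natural assoc_pentagon
    lunit_hom lunit_natural lunit_triangle in auto)

text \<open>The values outside \<open>Ob M\<close> are fixed so that transformations with equal
  components give equal arrows of \<open>trans_cat\<close>.\<close>

definition act_trans ::
    "('k, 'o, 'a, 'm) moncat_scheme \<Rightarrow> ('l, 'o, 'a, 'mo, 'ma, 'n) modcat_scheme
      \<Rightarrow> 'o \<Rightarrow> 'o \<Rightarrow> ('mo \<Rightarrow> 'ma) \<Rightarrow> bool" where
  "act_trans C M X Y z \<longleftrightarrow> X \<in> Ob C \<and> Y \<in> Ob C \<and> z \<in> extensional (Ob M) \<and>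
     (\<forall>N\<in>Ob M. z N \<in> Hom M (X \<rhd>\<^sub>o\<^bsub>M\<^esub> N) (Y \<rhd>\<^sub>o\<^bsub>M\<^esub> N)) \<and>
     (\<forall>f\<in>Arr M. z (Cod M f) \<cdot>\<^bsub>M\<^esub> (Ide C X \<rhd>\<^sub>a\<^bsub>M\<^esub> f) = (Ide C Y \<rhd>\<^sub>a\<^bsub>M\<^esub> f) \<cdot>\<^bsub>M\<^esub> z (Dom M f))"

text \<open>Conjugating with the associativity isomorphisms of the action makes the tensor product strict.
  The linear structure is irrelevant and left unspecified.\<close>

definition trans_cat ::
    "('k, 'o, 'a, 'm) moncat_scheme \<Rightarrow> ('l, 'o, 'a, 'mo, 'ma, 'n) modcat_scheme
      \<Rightarrow> ('k, 'o, 'o \<times> ('mo \<Rightarrow> 'ma) \<times> 'o) moncat" where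
  "trans_cat C M = \<lparr>
     Ob = Ob C,
     Arr = {(X, z, Y). act_trans C M X Y z},
     Dom = (\<lambda>(X, z, Y). X),
     Cod = (\<lambda>(X, z, Y). Y),
     Comp = (\<lambda>(Y', w, W) (X, z, Y). (X, \<lambda>N\<in>Ob M. w N \<cdot>\<^bsub>M\<^esub> z N, W)),
     Ide = (\<lambda>X. (X, \<lambda>N\<in>Ob M. Ide M (X \<rhd>\<^sub>o\<^bsub>M\<^esub> N), X)),
     Add = undefined, Zero = undefined, Scale = undefined,
     TensO = TensO C,
     TensA = (\<lambda>(X, z, Y) (X', w, Y'). (X \<otimes>\<^sub>o\<^bsub>C\<^esub> X',
       \<lambda>N\<in>Ob M. inv_arr M (Assoc M Y Y' N) \<cdot>\<^bsub>M\<^esub> z (Y' \<rhd>\<^sub>o\<^bsub>M\<^esub> N) \<cdot>\<^bsub>M\<^esub> (Ide C X \<rhd>\<^sub>a\<^bsub>M\<^esub> w N)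
         \<cdot>\<^bsub>M\<^esub> Assoc M X X' N,
       Y \<otimes>\<^sub>o\<^bsub>C\<^esub> Y')),
     Unit = Unit C\<rparr>"

definition act_arr ::
    "('k, 'o, 'a, 'm) moncat_scheme \<Rightarrow> ('l, 'o, 'a, 'mo, 'ma, 'n) modcat_scheme
      \<Rightarrow> 'a \<Rightarrow> 'o \<times> ('mo \<Rightarrow> 'ma) \<times> 'o" where
  "act_arr C M f = (Dom C f, \<lambda>N\<in>Ob M. f \<rhd>\<^sub>a\<^bsub>M\<^esub> Ide M N, Cod C f)"

lemma trans_cat_sel [simp]:
  "Ob (trans_cat C M) = Ob C" "Dom (trans_cat C M) (X, z, Y) = X" "Cod (trans_cat C M) (X, z, Y) = Y"
  "Comp (trans_cat C M) (Y', w, W) (X, z, Y) = (X, \<lambda>N\<in>Ob M. w N \<cdot>\<^bsub>M\<^esub> z N, W)"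
  "Ide (trans_cat C M) X = (X, \<lambda>N\<in>Ob M. Ide M (X \<rhd>\<^sub>o\<^bsub>M\<^esub> N), X)"
  "TensO (trans_cat C M) = TensO C" "Unit (trans_cat C M) = Unit C"
  "TensA (trans_cat C M) (X, z, Y) (X', w, Y') = (X \<otimes>\<^sub>o\<^bsub>C\<^esub> X',
       \<lambda>N\<in>Ob M. inv_arr M (Assoc M Y Y' N) \<cdot>\<^bsub>M\<^esub> z (Y' \<rhd>\<^sub>o\<^bsub>M\<^esub> N) \<cdot>\<^bsub>M\<^esub> (Ide C X \<rhd>\<^sub>a\<^bsub>M\<^esub> w N)
         \<cdot>\<^bsub>M\<^esub> Assoc M X X' N,
       Y \<otimes>\<^sub>o\<^bsub>C\<^esub> Y')"
  by (simp_all add: trans_cat_def)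

lemma trans_cat_arr: "x \<in> Arr (trans_cat C M) \<longleftrightarrow> (\<exists>X z Y. x = (X, z, Y) \<and> act_trans C M X Y z)"
  by (auto simp: trans_cat_def)

lemma trans_cat_hom: "x \<in> Hom (trans_cat C M) X Y \<longleftrightarrow> (\<exists>z. x = (X, z, Y) \<and> act_trans C M X Y z)"
  by (auto simp: trans_cat_def Hom_def)

section \<open>Transformations between actions form a strict monoidal category\<close>

context module_action
begin

lemma act_transD:
  assumes "act_trans C M X Y z"
  shows "X \<in> Ob C" "Y \<in> Ob C" "z \<in> extensional (Ob M)"
    "N \<in> Ob M \<Longrightarrow> z N \<in> Arr M" "N \<in> Ob M \<Longrightarrow> Dom M (z N) = X \<rhd>\<^sub>o N" "N \<in> Ob M \<Longrightarrow> Cod M (z N) = Y \<rhd>\<^sub>o N"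
    "f \<in> Arr M \<Longrightarrow> z (Cod M f) \<cdot> (Ide C X \<rhd>\<^sub>a f) = (Ide C Y \<rhd>\<^sub>a f) \<cdot> z (Dom M f)"
  using assms by (auto simp: act_trans_def Hom_def)

lemma act_trans_ide: "X \<in> Ob C \<Longrightarrow> act_trans C M X X (\<lambda>N\<in>Ob M. Ide M (X \<rhd>\<^sub>o N))"
  by (auto simp: act_trans_def Hom_def)

lemma act_trans_arr: "f \<in> Arr C \<Longrightarrow> act_trans C M (Dom C f) (Cod C f) (\<lambda>N\<in>Ob M. f \<rhd>\<^sub>a Ide M N)"
  by (auto simp: act_trans_def Hom_def act_split)

lemma act_trans_comp:
  assumes z: "act_trans C M X Y z" and w: "act_trans C M Y W w"
  shows "act_trans C M X W (\<lambda>N\<in>Ob M. w N \<cdot> z N)"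
proof -
  note [simp] = act_transD(1-6)[OF z] act_transD(1-6)[OF w]
  have "(w (Cod M f) \<cdot> z (Cod M f)) \<cdot> (Ide C X \<rhd>\<^sub>a f) = (Ide C W \<rhd>\<^sub>a f) \<cdot> w (Dom M f) \<cdot> z (Dom M f)"
    if [simp]: "f \<in> Arr M" for f
    using act_transD(7)[OF z, of f] comp_tail[OF act_transD(7)[OF w, of f], of "z (Dom M f)"] by simp
  then show ?thesis by (auto simp: act_trans_def Hom_def)
qed

lemma act_trans_tens:
  assumes z: "act_trans C M X Y z" and w: "act_trans C M X' Y' w"
  shows "act_trans C M (X \<otimes>\<^sub>o\<^bsub>C\<^esub> X') (Y \<otimes>\<^sub>o\<^bsub>C\<^esub> Y')
    (\<lambda>N\<in>Ob M. inv_arr M (Assoc M Y Y' N) \<cdot> z (Y' \<rhd>\<^sub>o N) \<cdot> (Ide C X \<rhd>\<^sub>a w N) \<cdot> Assoc M X X' N)"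
proof -
  note [simp] = act_transD(1-6)[OF z] act_transD(1-6)[OF w]
  have "inv_arr M (Assoc M Y Y' (Cod M f)) \<cdot> z (Y' \<rhd>\<^sub>o Cod M f) \<cdot> (Ide C X \<rhd>\<^sub>a w (Cod M f))
        \<cdot> Assoc M X X' (Cod M f) \<cdot> (Ide C (X \<otimes>\<^sub>o\<^bsub>C\<^esub> X') \<rhd>\<^sub>a f)
      = (Ide C (Y \<otimes>\<^sub>o\<^bsub>C\<^esub> Y') \<rhd>\<^sub>a f) \<cdot> inv_arr M (Assoc M Y Y' (Dom M f)) \<cdot> z (Y' \<rhd>\<^sub>o Dom M f)
        \<cdot> (Ide C X \<rhd>\<^sub>a w (Dom M f)) \<cdot> Assoc M X X' (Dom M f)" (is "?l = ?r")
    if [simp]: "f \<in> Arr M" for f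
  proof (rule iso_cancel_left[of "Assoc M Y Y' (Cod M f)"])
    have "Assoc M Y Y' (Cod M f) \<cdot> ?l = z (Y' \<rhd>\<^sub>o Cod M f) \<cdot> (Ide C X \<rhd>\<^sub>a w (Cod M f))
        \<cdot> (Ide C X \<rhd>\<^sub>a Ide C X' \<rhd>\<^sub>a f) \<cdot> Assoc M X X' (Dom M f)"
      using assoc_nat[of "Ide C X" "Ide C X'" f] by simp
    also have "\<dots> = z (Y' \<rhd>\<^sub>o Cod M f) \<cdot> (Ide C X \<rhd>\<^sub>a Ide C Y' \<rhd>\<^sub>a f) \<cdot> (Ide C X \<rhd>\<^sub>a w (Dom M f))
        \<cdot> Assoc M X X' (Dom M f)"
      using act_transD(7)[OF w, of f] by (simp add: act_interchange_tail)
    also have "\<dots> = (Ide C Y \<rhd>\<^sub>a Ide C Y' \<rhd>\<^sub>a f) \<cdot> z (Y' \<rhd>\<^sub>o Dom M f) \<cdot> (Ide C X \<rhd>\<^sub>a w (Dom M f))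
        \<cdot> Assoc M X X' (Dom M f)"
      using comp_tail[OF act_transD(7)[OF z, of "Ide C Y' \<rhd>\<^sub>a f"],
          of "(Ide C X \<rhd>\<^sub>a w (Dom M f)) \<cdot> Assoc M X X' (Dom M f)"] by simp
    also have "\<dots> = Assoc M Y Y' (Cod M f) \<cdot> ?r"
      using comp_tail[OF assoc_nat[of "Ide C Y" "Ide C Y'" f, symmetric]] by simp
    finally show "Assoc M Y Y' (Cod M f) \<cdot> ?l = Assoc M Y Y' (Cod M f) \<cdot> ?r" .
  qed simp_all
  then show ?thesis by (auto simp: act_trans_def Hom_def)
qed

text \<open>Apart from cancelling associativity isomorphisms, the interchange law is the naturality
  of z at the component of w'.\<close>

lemma trans_tens_comp:
  assumes z: "act_trans C M X Y z" and z': "act_trans C M Y W z'"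
    and w: "act_trans C M X' Y' w" and w': "act_trans C M Y' W' w'" and [simp]: "N \<in> Ob M"
  shows "inv_arr M (Assoc M W W' N) \<cdot> (z' (W' \<rhd>\<^sub>o N) \<cdot> z (W' \<rhd>\<^sub>o N)) \<cdot> (Ide C X \<rhd>\<^sub>a (w' N \<cdot> w N)) \<cdot> Assoc M X X' N
    = (inv_arr M (Assoc M W W' N) \<cdot> z' (W' \<rhd>\<^sub>o N) \<cdot> (Ide C Y \<rhd>\<^sub>a w' N) \<cdot> Assoc M Y Y' N)
      \<cdot> (inv_arr M (Assoc M Y Y' N) \<cdot> z (Y' \<rhd>\<^sub>o N) \<cdot> (Ide C X \<rhd>\<^sub>a w N) \<cdot> Assoc M X X' N)"
proof -
  note [simp] = act_transD(1-6)[OF z] act_transD(1-6)[OF w] act_transD(1-6)[OF z'] act_transD(1-6)[OF w']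
  show ?thesis
    using comp_tail[OF act_transD(7)[OF z, of "w' N"], of "(Ide C X \<rhd>\<^sub>a w N) \<cdot> Assoc M X X' N"]
    by (simp add: act_ide_comp)
qed

text \<open>Strict associativity comes from two pentagons: one for the sources, which rearranges the
  right end of the chain, and the inverse of one for the targets, which rearranges its left
  end.\<close>

lemma trans_tens_assoc:
  assumes z: "act_trans C M X Y z" and w: "act_trans C M X' Y' w" and u: "act_trans C M X'' Y'' u"
    and [simp]: "N \<in> Ob M"
  shows "inv_arr M (Assoc M (Y \<otimes>\<^sub>o\<^bsub>C\<^esub> Y') Y'' N)
      \<cdot> (inv_arr M (Assoc M Y Y' (Y'' \<rhd>\<^sub>o N)) \<cdot> z (Y' \<rhd>\<^sub>o Y'' \<rhd>\<^sub>o N) \<cdot> (Ide C X \<rhd>\<^sub>a w (Y'' \<rhd>\<^sub>o N))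
        \<cdot> Assoc M X X' (Y'' \<rhd>\<^sub>o N))
      \<cdot> (Ide C (X \<otimes>\<^sub>o\<^bsub>C\<^esub> X') \<rhd>\<^sub>a u N) \<cdot> Assoc M (X \<otimes>\<^sub>o\<^bsub>C\<^esub> X') X'' N
    = inv_arr M (Assoc M Y (Y' \<otimes>\<^sub>o\<^bsub>C\<^esub> Y'') N) \<cdot> z ((Y' \<otimes>\<^sub>o\<^bsub>C\<^esub> Y'') \<rhd>\<^sub>o N)
      \<cdot> (Ide C X \<rhd>\<^sub>a (inv_arr M (Assoc M Y' Y'' N) \<cdot> w (Y'' \<rhd>\<^sub>o N) \<cdot> (Ide C X' \<rhd>\<^sub>a u N) \<cdot> Assoc M X' X'' N))
      \<cdot> Assoc M X (X' \<otimes>\<^sub>o\<^bsub>C\<^esub> X'') N" (is "?l = ?r")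
proof -
  note [simp] = act_transD(1-6)[OF z] act_transD(1-6)[OF w] act_transD(1-6)[OF u]
  \<comment> \<open>The common core of both sides; in front of it stand only inverse associativity
    isomorphisms of the targets.\<close>
  let ?t = "z (Y' \<rhd>\<^sub>o Y'' \<rhd>\<^sub>o N) \<cdot> (Ide C X \<rhd>\<^sub>a w (Y'' \<rhd>\<^sub>o N)) \<cdot> (Ide C X \<rhd>\<^sub>a Ide C X' \<rhd>\<^sub>a u N)
      \<cdot> (Ide C X \<rhd>\<^sub>a Assoc M X' X'' N) \<cdot> Assoc M X (X' \<otimes>\<^sub>o\<^bsub>C\<^esub> X'') N"
  have *: "Assoc M X X' (Y'' \<rhd>\<^sub>o N) \<cdot> (Ide C (X \<otimes>\<^sub>o\<^bsub>C\<^esub> X') \<rhd>\<^sub>a u N) \<cdot> Assoc M (X \<otimes>\<^sub>o\<^bsub>C\<^esub> X') X'' N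
      = (Ide C X \<rhd>\<^sub>a Ide C X' \<rhd>\<^sub>a u N) \<cdot> (Ide C X \<rhd>\<^sub>a Assoc M X' X'' N) \<cdot> Assoc M X (X' \<otimes>\<^sub>o\<^bsub>C\<^esub> X'') N"
    using comp_tail[OF assoc_nat[of "Ide C X" "Ide C X'" "u N", symmetric]] assoc_pentagon[of X X' X'' N]
    by simp
  have l: "?l = inv_arr M (Assoc M (Y \<otimes>\<^sub>o\<^bsub>C\<^esub> Y') Y'' N) \<cdot> inv_arr M (Assoc M Y Y' (Y'' \<rhd>\<^sub>o N)) \<cdot> ?t"
    by (simp add: *)
  have r: "?r = inv_arr M (Assoc M Y (Y' \<otimes>\<^sub>o\<^bsub>C\<^esub> Y'') N) \<cdot> (Ide C Y \<rhd>\<^sub>a inv_arr M (Assoc M Y' Y'' N)) \<cdot> ?t"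
    using comp_tail[OF act_transD(7)[OF z, of "inv_arr M (Assoc M Y' Y'' N)"],
        of "(Ide C X \<rhd>\<^sub>a w (Y'' \<rhd>\<^sub>o N)) \<cdot> (Ide C X \<rhd>\<^sub>a Ide C X' \<rhd>\<^sub>a u N)
      \<cdot> (Ide C X \<rhd>\<^sub>a Assoc M X' X'' N) \<cdot> Assoc M X (X' \<otimes>\<^sub>o\<^bsub>C\<^esub> X'') N"]
    by (simp add: act_ide_comp)
  have "inv_arr M (Assoc M (Y \<otimes>\<^sub>o\<^bsub>C\<^esub> Y') Y'' N) \<cdot> inv_arr M (Assoc M Y Y' (Y'' \<rhd>\<^sub>o N))
      = inv_arr M (Assoc M Y (Y' \<otimes>\<^sub>o\<^bsub>C\<^esub> Y'') N) \<cdot> (Ide C Y \<rhd>\<^sub>a inv_arr M (Assoc M Y' Y'' N))"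
    using arg_cong[OF assoc_pentagon[of Y Y' Y'' N], of "inv_arr M"]
      inv_arr_act[of "Ide C Y" "Assoc M Y' Y'' N"]
    by (simp add: inv_arr_comp)
  from comp_tail[OF this, of ?t] show ?thesis unfolding l r by simp
qed

lemma act_trans_eqI:
  assumes "act_trans C M X Y z" "\<And>N. N \<in> Ob M \<Longrightarrow> w N = z N"
  shows "(\<lambda>N\<in>Ob M. w N) = z"
  using assms act_transD(3)[OF assms(1)] by (auto simp: fun_eq_iff restrict_def dest: extensional_arb)

text \<open>The left unit law rests on the second triangle identity and the naturality of the unit
  isomorphism, the right unit law on the naturality of z at an inverse unit isomorphism.\<close>

lemma trans_unit_tens:
  assumes z: "act_trans C M X Y z" and [simp]: "N \<in> Ob M"
  shows "inv_arr M (Assoc M (Unit C) Y N) \<cdot> (Ide C (Unit C) \<rhd>\<^sub>a z N) \<cdot> Assoc M (Unit C) X N = z N"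
    and "inv_arr M (Assoc M Y (Unit C) N) \<cdot> z (Unit C \<rhd>\<^sub>o N) \<cdot> Assoc M X (Unit C) N = z N"
proof -
  note [simp] = act_transD(1-6)[OF z]
  have "(Ide C (Unit C) \<rhd>\<^sub>a z N) \<cdot> Assoc M (Unit C) X N = Assoc M (Unit C) Y N \<cdot> z N"
    by (rule iso_cancel_left[of "LUnit M (Y \<rhd>\<^sub>o N)"])
      (use lunit_assoc[of X N] comp_tail[OF lunit_assoc[of Y N]] comp_tail[OF lunit_nat[symmetric, of "z N"]]
        in simp_all)
  then show "inv_arr M (Assoc M (Unit C) Y N) \<cdot> (Ide C (Unit C) \<rhd>\<^sub>a z N) \<cdot> Assoc M (Unit C) X N = z N"
    by simp
  have "z (Unit C \<rhd>\<^sub>o N) \<cdot> Assoc M X (Unit C) N = Assoc M Y (Unit C) N \<cdot> z N"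
    using act_transD(7)[OF z, of "inv_arr M (LUnit M N)"] by (simp add: act_inv_lunit)
  then show "inv_arr M (Assoc M Y (Unit C) N) \<cdot> z (Unit C \<rhd>\<^sub>o N) \<cdot> Assoc M X (Unit C) N = z N"
    by simp
qed

lemma strict_monoidal_trans_cat: "strict_monoidal (trans_cat C M)"
proof
  fix X Y Z W X' Y' Z' f g h f' g'
  show "f \<in> Arr (trans_cat C M) \<Longrightarrow> Dom (trans_cat C M) f \<in> Ob (trans_cat C M)"
    "f \<in> Arr (trans_cat C M) \<Longrightarrow> Cod (trans_cat C M) f \<in> Ob (trans_cat C M)"
    "X \<in> Ob (trans_cat C M) \<Longrightarrow> Ide (trans_cat C M) X \<in> Hom (trans_cat C M) X X"
    "f \<in> Hom (trans_cat C M) X Y \<Longrightarrow> g \<in> Hom (trans_cat C M) Y Z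
      \<Longrightarrow> g \<cdot>\<^bsub>trans_cat C M\<^esub> f \<in> Hom (trans_cat C M) X Z"
    by (auto simp: trans_cat_arr trans_cat_hom act_transD(1-6) act_trans_ide act_trans_comp)
  show "f \<in> Hom (trans_cat C M) X Y \<Longrightarrow> f \<cdot>\<^bsub>trans_cat C M\<^esub> Ide (trans_cat C M) X = f"
    "f \<in> Hom (trans_cat C M) X Y \<Longrightarrow> Ide (trans_cat C M) Y \<cdot>\<^bsub>trans_cat C M\<^esub> f = f"
    "\<lbrakk>f \<in> Hom (trans_cat C M) W X; g \<in> Hom (trans_cat C M) X Y; h \<in> Hom (trans_cat C M) Y Z\<rbrakk>
      \<Longrightarrow> (h \<cdot>\<^bsub>trans_cat C M\<^esub> g) \<cdot>\<^bsub>trans_cat C M\<^esub> f = h \<cdot>\<^bsub>trans_cat C M\<^esub> g \<cdot>\<^bsub>trans_cat C M\<^esub> f"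
    by (auto simp: trans_cat_hom act_transD(1-6) intro!: act_trans_eqI restrict_ext)
  show "X \<in> Ob (trans_cat C M) \<Longrightarrow> Y \<in> Ob (trans_cat C M) \<Longrightarrow> X \<otimes>\<^sub>o\<^bsub>trans_cat C M\<^esub> Y \<in> Ob (trans_cat C M)"
    "Unit (trans_cat C M) \<in> Ob (trans_cat C M)"
    "\<lbrakk>X \<in> Ob (trans_cat C M); Y \<in> Ob (trans_cat C M); Z \<in> Ob (trans_cat C M)\<rbrakk> \<Longrightarrow>
      (X \<otimes>\<^sub>o\<^bsub>trans_cat C M\<^esub> Y) \<otimes>\<^sub>o\<^bsub>trans_cat C M\<^esub> Z = X \<otimes>\<^sub>o\<^bsub>trans_cat C M\<^esub> Y \<otimes>\<^sub>o\<^bsub>trans_cat C M\<^esub> Z"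
    "X \<in> Ob (trans_cat C M) \<Longrightarrow> Unit (trans_cat C M) \<otimes>\<^sub>o\<^bsub>trans_cat C M\<^esub> X = X
      \<and> X \<otimes>\<^sub>o\<^bsub>trans_cat C M\<^esub> Unit (trans_cat C M) = X"
    by simp_all
  show "f \<in> Hom (trans_cat C M) X X' \<Longrightarrow> g \<in> Hom (trans_cat C M) Y Y'
      \<Longrightarrow> f \<otimes>\<^sub>a\<^bsub>trans_cat C M\<^esub> g \<in> Hom (trans_cat C M) (X \<otimes>\<^sub>o\<^bsub>trans_cat C M\<^esub> Y) (X' \<otimes>\<^sub>o\<^bsub>trans_cat C M\<^esub> Y')"
    by (auto simp: trans_cat_hom act_trans_tens)
  show "\<lbrakk>X \<in> Ob (trans_cat C M); Y \<in> Ob (trans_cat C M)\<rbrakk> \<Longrightarrow>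
      Ide (trans_cat C M) X \<otimes>\<^sub>a\<^bsub>trans_cat C M\<^esub> Ide (trans_cat C M) Y = Ide (trans_cat C M) (X \<otimes>\<^sub>o\<^bsub>trans_cat C M\<^esub> Y)"
    by (auto simp: restrict_def fun_eq_iff)
  show "\<lbrakk>f \<in> Hom (trans_cat C M) X Y; g \<in> Hom (trans_cat C M) Y Z;
      f' \<in> Hom (trans_cat C M) X' Y'; g' \<in> Hom (trans_cat C M) Y' Z'\<rbrakk>
    \<Longrightarrow> (g \<cdot>\<^bsub>trans_cat C M\<^esub> f) \<otimes>\<^sub>a\<^bsub>trans_cat C M\<^esub> (g' \<cdot>\<^bsub>trans_cat C M\<^esub> f')
      = (g \<otimes>\<^sub>a\<^bsub>trans_cat C M\<^esub> g') \<cdot>\<^bsub>trans_cat C M\<^esub> (f \<otimes>\<^sub>a\<^bsub>trans_cat C M\<^esub> f')"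
    by (clarsimp simp: trans_cat_hom, rule restrict_ext)
      (simp add: trans_tens_comp act_transD(1-6) del: comp_assoc_arr)
  show "\<lbrakk>f \<in> Arr (trans_cat C M); g \<in> Arr (trans_cat C M); h \<in> Arr (trans_cat C M)\<rbrakk>
    \<Longrightarrow> (f \<otimes>\<^sub>a\<^bsub>trans_cat C M\<^esub> g) \<otimes>\<^sub>a\<^bsub>trans_cat C M\<^esub> h = f \<otimes>\<^sub>a\<^bsub>trans_cat C M\<^esub> g \<otimes>\<^sub>a\<^bsub>trans_cat C M\<^esub> h"
    by (clarsimp simp: trans_cat_arr act_transD(1-6), rule restrict_ext)
      (simp add: trans_tens_assoc act_transD(1-6) del: comp_assoc_arr)
  show "f \<in> Arr (trans_cat C M) \<Longrightarrow> Ide (trans_cat C M) (Unit (trans_cat C M)) \<otimes>\<^sub>a\<^bsub>trans_cat C M\<^esub> f = f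
      \<and> f \<otimes>\<^sub>a\<^bsub>trans_cat C M\<^esub> Ide (trans_cat C M) (Unit (trans_cat C M)) = f"
    by (auto simp: trans_cat_arr act_transD(1-6) trans_unit_tens intro!: act_trans_eqI)
qed

text \<open>The functor is strict because naturality of \<open>Assoc\<close> absorbs exactly the
  conjugation built into the tensor product of \<open>trans_cat\<close>.\<close>

lemma strict_extension_trans_cat: "strict_extension C (trans_cat C M) (act_arr C M)"
proof -
  interpret E: strict_monoidal "trans_cat C M" by (rule strict_monoidal_trans_cat)
  show ?thesis
  proof
    fix X Y f g
    show "f \<in> Hom C X Y \<Longrightarrow> act_arr C M f \<in> Hom (trans_cat C M) X Y"
      using act_trans_arr[of f] by (auto simp: trans_cat_arr act_arr_def Hom_def)
    show "X \<in> Ob C \<Longrightarrow> act_arr C M (Ide C X) = Ide (trans_cat C M) X"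
      by (auto simp: act_arr_def fun_eq_iff restrict_def)
    show "\<lbrakk>f \<in> Arr C; g \<in> Arr C; Dom C g = Cod C f\<rbrakk>
      \<Longrightarrow> act_arr C M (g \<cdot>\<^bsub>C\<^esub> f) = act_arr C M g \<cdot>\<^bsub>trans_cat C M\<^esub> act_arr C M f"
      by (auto simp: act_arr_def act_comp_ide fun_eq_iff restrict_def)
    assume [simp]: "f \<in> Arr C" "g \<in> Arr C"
    have "inv_arr M (Assoc M (Cod C f) (Cod C g) N) \<cdot> (f \<rhd>\<^sub>a Ide M (Cod C g \<rhd>\<^sub>o N))
        \<cdot> (Ide C (Dom C f) \<rhd>\<^sub>a g \<rhd>\<^sub>a Ide M N) \<cdot> Assoc M (Dom C f) (Dom C g) N
        = (f \<otimes>\<^sub>a\<^bsub>C\<^esub> g) \<rhd>\<^sub>a Ide M N" if [simp]: "N \<in> Ob M" for N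
      using assoc_nat[of f g "Ide M N"] by (simp add: act_interchange_tail)
    then show "act_arr C M (f \<otimes>\<^sub>a\<^bsub>C\<^esub> g) = act_arr C M f \<otimes>\<^sub>a\<^bsub>trans_cat C M\<^esub> act_arr C M g"
      by (auto simp: act_arr_def fun_eq_iff restrict_def)
  qed simp_all
qed

end

text \<open>A natural transformation from \<open>Z \<rhd> -\<close> to the identity is an arrow to the unit object.\<close>

definition to_unit ::
    "('k, 'o, 'a, 'm) moncat_scheme \<Rightarrow> ('l, 'o, 'a, 'mo, 'ma, 'n) modcat_scheme
      \<Rightarrow> 'o \<Rightarrow> ('mo \<Rightarrow> 'ma) \<Rightarrow> 'o \<times> ('mo \<Rightarrow> 'ma) \<times> 'o" where
  "to_unit C M Z z = (Z, \<lambda>N\<in>Ob M. inv_arr M (LUnit M N) \<cdot>\<^bsub>M\<^esub> z N, Unit C)"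

context module_action
begin

context
  fixes Z z
  assumes Z [simp]: "Z \<in> Ob C"
    and z_hom: "\<And>N. N \<in> Ob M \<Longrightarrow> z N \<in> Hom M (Z \<rhd>\<^sub>o N) N"
begin

lemma to_unit_z_simps:
  "N \<in> Ob M \<Longrightarrow> z N \<in> Arr M" "N \<in> Ob M \<Longrightarrow> Dom M (z N) = Z \<rhd>\<^sub>o N" "N \<in> Ob M \<Longrightarrow> Cod M (z N) = N"
  using z_hom by (auto simp: Hom_def)

lemma to_unit_hom:
  assumes nat: "\<And>f. f \<in> Arr M \<Longrightarrow> z (Cod M f) \<cdot> (Ide C Z \<rhd>\<^sub>a f) = f \<cdot> z (Dom M f)"
  shows "to_unit C M Z z \<in> Hom (trans_cat C M) Z (Unit C)"
proof -
  note to_unit_z_simps [simp]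
  have "inv_arr M (LUnit M (Cod M f)) \<cdot> f \<cdot> z (Dom M f)
      = (Ide C (Unit C) \<rhd>\<^sub>a f) \<cdot> inv_arr M (LUnit M (Dom M f)) \<cdot> z (Dom M f)" if [simp]: "f \<in> Arr M" for f
    by (rule iso_cancel_left[of "LUnit M (Cod M f)"]) (simp_all add: comp_tail[OF lunit_nat[symmetric]])
  then show ?thesis by (auto simp: to_unit_def trans_cat_arr act_trans_def Hom_def nat)
qed

text \<open>The inverse unit isomorphism in \<open>to_unit\<close> cancels against the inverse
  associativity isomorphism of the tensor product. Here and in \<open>tens_to_unit\<close> the
  transformations that occur in the condition on pairs remain.\<close>

lemma to_unit_tens:
  assumes [simp]: "X \<in> Ob C"
  shows "to_unit C M Z z \<otimes>\<^sub>a\<^bsub>trans_cat C M\<^esub> Ide (trans_cat C M) X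
    = (Z \<otimes>\<^sub>o\<^bsub>C\<^esub> X, \<lambda>N\<in>Ob M. z (X \<rhd>\<^sub>o N) \<cdot> Assoc M Z X N, X)"
  by (auto simp: to_unit_def fun_eq_iff restrict_def inv_lunit_act to_unit_z_simps)

lemma tens_to_unit:
  assumes [simp]: "X \<in> Ob C"
  shows "Ide (trans_cat C M) X \<otimes>\<^sub>a\<^bsub>trans_cat C M\<^esub> to_unit C M Z z
    = (X \<otimes>\<^sub>o\<^bsub>C\<^esub> Z, \<lambda>N\<in>Ob M. (Ide C X \<rhd>\<^sub>a z N) \<cdot> Assoc M X Z N, X)"
  by (auto simp: to_unit_def fun_eq_iff restrict_def act_ide_comp act_inv_lunit to_unit_z_simps)

lemma to_unit_comp:
  assumes [simp]: "f \<in> Arr C" "Cod C f = Z"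
  shows "to_unit C M Z z \<cdot>\<^bsub>trans_cat C M\<^esub> act_arr C M f = to_unit C M (Dom C f) (\<lambda>N. z N \<cdot> (f \<rhd>\<^sub>a Ide M N))"
  by (auto simp: to_unit_def act_arr_def fun_eq_iff restrict_def to_unit_z_simps)

end

lemma to_unit_eq_iff:
  assumes "\<And>N. N \<in> Ob M \<Longrightarrow> z N \<in> Hom M (Z \<rhd>\<^sub>o N) N" "\<And>N. N \<in> Ob M \<Longrightarrow> w N \<in> Hom M (Z \<rhd>\<^sub>o N) N"
  shows "to_unit C M Z z = to_unit C M Z w \<longleftrightarrow> (\<forall>N\<in>Ob M. z N = w N)"
proof
  assume eq: "to_unit C M Z z = to_unit C M Z w"
  show "\<forall>N\<in>Ob M. z N = w N"
  proof
    fix N assume N [simp]: "N \<in> Ob M"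
    have "inv_arr M (LUnit M N) \<cdot> z N = inv_arr M (LUnit M N) \<cdot> w N"
      using fun_cong[of _ _ N] eq by (auto simp: to_unit_def fun_eq_iff restrict_def split: if_splits)
    then show "z N = w N"
      by (rule iso_cancel_left[rotated]) (use assms[OF N] in \<open>auto simp: Hom_def\<close>)
  qed
qed (auto simp: to_unit_def)

lemma to_unit_surj:
  assumes h: "h \<in> Hom (trans_cat C M) Z (Unit C)"
  obtains z where "h = to_unit C M Z z" "\<And>N. N \<in> Ob M \<Longrightarrow> z N \<in> Hom M (Z \<rhd>\<^sub>o N) N"
    "\<And>f. f \<in> Arr M \<Longrightarrow> z (Cod M f) \<cdot> (Ide C Z \<rhd>\<^sub>a f) = f \<cdot> z (Dom M f)"
proof -
  obtain w where w: "h = (Z, w, Unit C)" "act_trans C M Z (Unit C) w" using h by (auto simp: trans_cat_hom)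
  note [simp] = act_transD(1-6)[OF w(2)]
  have [simp]: "Z \<in> Ob C" using act_transD(1)[OF w(2)] by simp
  let ?z = "\<lambda>N. LUnit M N \<cdot> w N"
  have "h = to_unit C M Z ?z"
    using w(1) act_trans_eqI[OF w(2), symmetric, of "\<lambda>N. inv_arr M (LUnit M N) \<cdot> ?z N"]
    by (simp add: to_unit_def)
  moreover have "?z N \<in> Hom M (Z \<rhd>\<^sub>o N) N" if "N \<in> Ob M" for N using that by (auto simp: Hom_def)
  moreover have "?z (Cod M f) \<cdot> (Ide C Z \<rhd>\<^sub>a f) = f \<cdot> ?z (Dom M f)" if [simp]: "f \<in> Arr M" for f
    using act_transD(7)[OF w(2), of f] comp_tail[OF lunit_nat[of f], of "w (Dom M f)"] by simp
  ultimately show thesis using that by blast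
qed

end

section \<open>Actions restricted along a central functor\<close>

lemma restrict_module_sel [simp]:
  "Ob (restrict_module G C M) = Ob M" "Arr (restrict_module G C M) = Arr M"
  "Dom (restrict_module G C M) = Dom M" "Cod (restrict_module G C M) = Cod M"
  "Comp (restrict_module G C M) = Comp M" "Ide (restrict_module G C M) = Ide M"
  "Add (restrict_module G C M) = Add M" "Zero (restrict_module G C M) = Zero M"
  "Scale (restrict_module G C M) = Scale M"
  "ActO (restrict_module G C M) W N = fst (FO G W) \<rhd>\<^sub>o\<^bsub>M\<^esub> N"
  "ActA (restrict_module G C M) w g = center_arr (FA G w) \<rhd>\<^sub>a\<^bsub>M\<^esub> g"
  "Assoc (restrict_module G C M) U W N = Assoc M (fst (FO G U)) (fst (FO G W)) N
       \<cdot>\<^bsub>M\<^esub> (inv_arr C (center_arr (MulIso G U W)) \<rhd>\<^sub>a\<^bsub>M\<^esub> Ide M N)"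
  "LUnit (restrict_module G C M) N = LUnit M N \<cdot>\<^bsub>M\<^esub> (inv_arr C (center_arr (UnitIso G)) \<rhd>\<^sub>a\<^bsub>M\<^esub> Ide M N)"
  by (simp_all add: restrict_module_def)

lemma restrict_module_hom [simp]: "Hom (restrict_module G C M) X Y = Hom M X Y"
  by (simp add: Hom_def)

lemma restrict_module_iso [simp]:
  "is_iso (restrict_module G C M) f = is_iso M f" "inv_arr (restrict_module G C M) f = inv_arr M f"
  by (simp_all add: is_iso_def inv_arr_def is_inverse_def)

lemma restrict_module_right_exact [simp]:
  "right_exact K (restrict_module G C M) (restrict_module G C M) F = right_exact K M M F"
  by (simp add: right_exact_def linear_functor_def is_functor_def is_cokernel_def)

text \<open>Transposing f from Q -> B |> N to Y |> Q -> N and back returns f, up to a unit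
  isomorphism. It is the zigzag identity acting on N, once the associativity isomorphisms have been
  moved out of the way.\<close>

lemma (in module_action) dual_mate:
  assumes [simp]: "B \<in> Ob C" "Y \<in> Ob C" "N \<in> Ob M" and e: "e \<in> Hom C (Y \<otimes>\<^sub>o\<^bsub>C\<^esub> B) (Unit C)"
    and c: "c \<in> Hom C (Unit C) (B \<otimes>\<^sub>o\<^bsub>C\<^esub> Y)"
    and zz: "(Ide C B \<otimes>\<^sub>a\<^bsub>C\<^esub> e) \<cdot>\<^bsub>C\<^esub> (c \<otimes>\<^sub>a\<^bsub>C\<^esub> Ide C B) = Ide C B"
    and f [simp]: "f \<in> Arr M" "Cod M f = B \<rhd>\<^sub>o N"
  shows "(Ide C B \<rhd>\<^sub>a (LUnit M N \<cdot> (e \<rhd>\<^sub>a Ide M N) \<cdot> inv_arr M (Assoc M Y B N)))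
      \<cdot> (Ide C B \<rhd>\<^sub>a Ide C Y \<rhd>\<^sub>a f) \<cdot> Assoc M B Y (Dom M f) \<cdot> (c \<rhd>\<^sub>a Ide M (Dom M f))
      = f \<cdot> LUnit M (Dom M f)"
proof -
  have [simp]: "e \<in> Arr C" "Dom C e = Y \<otimes>\<^sub>o\<^bsub>C\<^esub> B" "Cod C e = Unit C"
    "c \<in> Arr C" "Dom C c = Unit C" "Cod C c = B \<otimes>\<^sub>o\<^bsub>C\<^esub> Y"
    using e c by (auto simp: Hom_def)
  let ?I = "Ide C B" and ?u = "Unit C" and ?Q = "Dom M f"
  have 1: "(?I \<rhd>\<^sub>a Ide C Y \<rhd>\<^sub>a f) \<cdot> Assoc M B Y ?Q \<cdot> (c \<rhd>\<^sub>a Ide M ?Q)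
      = Assoc M B Y (B \<rhd>\<^sub>o N) \<cdot> (c \<rhd>\<^sub>a Ide M (B \<rhd>\<^sub>o N)) \<cdot> (Ide C ?u \<rhd>\<^sub>a f)"
    using comp_tail[OF assoc_nat[of ?I "Ide C Y" f]] by (simp add: act_interchange)
  \<comment> \<open>The pentagon for B, Y, B with two of its isomorphisms moved to the other
    side.\<close>
  have 2: "(?I \<rhd>\<^sub>a inv_arr M (Assoc M Y B N)) \<cdot> Assoc M B Y (B \<rhd>\<^sub>o N)
      = Assoc M B (Y \<otimes>\<^sub>o\<^bsub>C\<^esub> B) N \<cdot> inv_arr M (Assoc M (B \<otimes>\<^sub>o\<^bsub>C\<^esub> Y) B N)"
  proof (rule iso_cancel_right[of "Assoc M (B \<otimes>\<^sub>o\<^bsub>C\<^esub> Y) B N"])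
    show "((?I \<rhd>\<^sub>a inv_arr M (Assoc M Y B N)) \<cdot> Assoc M B Y (B \<rhd>\<^sub>o N)) \<cdot> Assoc M (B \<otimes>\<^sub>o\<^bsub>C\<^esub> Y) B N
      = (Assoc M B (Y \<otimes>\<^sub>o\<^bsub>C\<^esub> B) N \<cdot> inv_arr M (Assoc M (B \<otimes>\<^sub>o\<^bsub>C\<^esub> Y) B N)) \<cdot> Assoc M (B \<otimes>\<^sub>o\<^bsub>C\<^esub> Y) B N"
      using assoc_pentagon[of B Y B N] by (simp add: act_interchange_tail)
  qed simp_all
  \<comment> \<open>Here the second triangle identity enters: the associativity isomorphism with
    first entry 1 is inverse to a unit isomorphism.\<close>
  have 3: "inv_arr M (Assoc M (B \<otimes>\<^sub>o\<^bsub>C\<^esub> Y) B N) \<cdot> (c \<rhd>\<^sub>a Ide M (B \<rhd>\<^sub>o N))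
      = ((c \<otimes>\<^sub>a\<^bsub>C\<^esub> ?I) \<rhd>\<^sub>a Ide M N) \<cdot> LUnit M (B \<rhd>\<^sub>o N)"
  proof (rule iso_cancel_right[of "Assoc M ?u B N"])
    show "(inv_arr M (Assoc M (B \<otimes>\<^sub>o\<^bsub>C\<^esub> Y) B N) \<cdot> (c \<rhd>\<^sub>a Ide M (B \<rhd>\<^sub>o N))) \<cdot> Assoc M ?u B N
      = (((c \<otimes>\<^sub>a\<^bsub>C\<^esub> ?I) \<rhd>\<^sub>a Ide M N) \<cdot> LUnit M (B \<rhd>\<^sub>o N)) \<cdot> Assoc M ?u B N"
      using assoc_nat_ide[of c B N] by (simp add: lunit_assoc)
  qed simp_all
  have 4: "(?I \<rhd>\<^sub>a e \<rhd>\<^sub>a Ide M N) \<cdot> Assoc M B (Y \<otimes>\<^sub>o\<^bsub>C\<^esub> B) N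
      = Assoc M B ?u N \<cdot> ((?I \<otimes>\<^sub>a\<^bsub>C\<^esub> e) \<rhd>\<^sub>a Ide M N)"
    using assoc_nat[of ?I e "Ide M N"] by simp
  let ?r = "LUnit M (B \<rhd>\<^sub>o N) \<cdot> (Ide C ?u \<rhd>\<^sub>a f)"
  have "(?I \<rhd>\<^sub>a (LUnit M N \<cdot> (e \<rhd>\<^sub>a Ide M N) \<cdot> inv_arr M (Assoc M Y B N)))
      \<cdot> (?I \<rhd>\<^sub>a Ide C Y \<rhd>\<^sub>a f) \<cdot> Assoc M B Y ?Q \<cdot> (c \<rhd>\<^sub>a Ide M ?Q)
      = (?I \<rhd>\<^sub>a LUnit M N) \<cdot> (?I \<rhd>\<^sub>a e \<rhd>\<^sub>a Ide M N) \<cdot> (?I \<rhd>\<^sub>a inv_arr M (Assoc M Y B N))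
        \<cdot> Assoc M B Y (B \<rhd>\<^sub>o N) \<cdot> (c \<rhd>\<^sub>a Ide M (B \<rhd>\<^sub>o N)) \<cdot> (Ide C ?u \<rhd>\<^sub>a f)"
    unfolding 1 by (simp add: act_ide_comp)
  also have "\<dots> = (?I \<rhd>\<^sub>a LUnit M N) \<cdot> (?I \<rhd>\<^sub>a e \<rhd>\<^sub>a Ide M N) \<cdot> Assoc M B (Y \<otimes>\<^sub>o\<^bsub>C\<^esub> B) N
        \<cdot> ((c \<otimes>\<^sub>a\<^bsub>C\<^esub> ?I) \<rhd>\<^sub>a Ide M N) \<cdot> ?r"
    using comp_tail[OF 2, of "(c \<rhd>\<^sub>a Ide M (B \<rhd>\<^sub>o N)) \<cdot> (Ide C ?u \<rhd>\<^sub>a f)"]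
      comp_tail[OF 3, of "Ide C ?u \<rhd>\<^sub>a f"] by simp
  also have "\<dots> = (?I \<rhd>\<^sub>a LUnit M N) \<cdot> Assoc M B ?u N \<cdot> ((?I \<otimes>\<^sub>a\<^bsub>C\<^esub> e) \<rhd>\<^sub>a Ide M N)
        \<cdot> ((c \<otimes>\<^sub>a\<^bsub>C\<^esub> ?I) \<rhd>\<^sub>a Ide M N) \<cdot> ?r"
    using comp_tail[OF 4, of "((c \<otimes>\<^sub>a\<^bsub>C\<^esub> ?I) \<rhd>\<^sub>a Ide M N) \<cdot> ?r"] by simp
  also have "((?I \<otimes>\<^sub>a\<^bsub>C\<^esub> e) \<rhd>\<^sub>a Ide M N) \<cdot> ((c \<otimes>\<^sub>a\<^bsub>C\<^esub> ?I) \<rhd>\<^sub>a Ide M N) \<cdot> ?r = ?r"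
    using zz by (simp add: act_interchange_tail)
  also have "(?I \<rhd>\<^sub>a LUnit M N) \<cdot> Assoc M B ?u N \<cdot> ?r = ?r"
    using comp_tail[OF lunit_triangle[of B N], of ?r] by simp
  also have "?r = f \<cdot> LUnit M ?Q" using lunit_nat[of f] by simp
  finally show ?thesis .
qed

text \<open>By \<open>dual_mate\<close> an arrow into B |> N is recovered from its transpose, up to
  a unit isomorphism that can be cancelled.\<close>

lemma (in module_action) dual_mate_inj:
  assumes ob: "B \<in> Ob C" "Y \<in> Ob C" "N \<in> Ob M" and e: "e \<in> Hom C (Y \<otimes>\<^sub>o\<^bsub>C\<^esub> B) (Unit C)"
    and c: "c \<in> Hom C (Unit C) (B \<otimes>\<^sub>o\<^bsub>C\<^esub> Y)"
    and zz: "(Ide C B \<otimes>\<^sub>a\<^bsub>C\<^esub> e) \<cdot>\<^bsub>C\<^esub> (c \<otimes>\<^sub>a\<^bsub>C\<^esub> Ide C B) = Ide C B"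
    and f: "f \<in> Arr M" "Cod M f = B \<rhd>\<^sub>o N" and g: "g \<in> Arr M" "Cod M g = B \<rhd>\<^sub>o N" "Dom M f = Dom M g"
    and eq: "(LUnit M N \<cdot> (e \<rhd>\<^sub>a Ide M N) \<cdot> inv_arr M (Assoc M Y B N)) \<cdot> (Ide C Y \<rhd>\<^sub>a f)
      = (LUnit M N \<cdot> (e \<rhd>\<^sub>a Ide M N) \<cdot> inv_arr M (Assoc M Y B N)) \<cdot> (Ide C Y \<rhd>\<^sub>a g)"
  shows "f = g"
proof (rule iso_cancel_right[of "LUnit M (Dom M g)"])
  define E where "E = LUnit M N \<cdot> (e \<rhd>\<^sub>a Ide M N) \<cdot> inv_arr M (Assoc M Y B N)"
  have [simp]: "e \<in> Arr C" "Dom C e = Y \<otimes>\<^sub>o\<^bsub>C\<^esub> B" "Cod C e = Unit C"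
    "c \<in> Arr C" "Dom C c = Unit C" "Cod C c = B \<otimes>\<^sub>o\<^bsub>C\<^esub> Y"
    using e c by (auto simp: Hom_def)
  have [simp]: "E \<in> Arr M" "Dom M E = Y \<rhd>\<^sub>o B \<rhd>\<^sub>o N"
    unfolding E_def by (simp_all add: ob)
  let ?t = "Assoc M B Y (Dom M g) \<cdot> (c \<rhd>\<^sub>a Ide M (Dom M g))"
  have *: "h \<cdot> LUnit M (Dom M g) = (Ide C B \<rhd>\<^sub>a (E \<cdot> (Ide C Y \<rhd>\<^sub>a h))) \<cdot> ?t"
    if h [simp]: "h \<in> Arr M" "Cod M h = B \<rhd>\<^sub>o N" "Dom M h = Dom M g" for h
  proof -
    have "h \<cdot> LUnit M (Dom M g) = (Ide C B \<rhd>\<^sub>a E) \<cdot> (Ide C B \<rhd>\<^sub>a Ide C Y \<rhd>\<^sub>a h) \<cdot> ?t"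
      using dual_mate[OF ob e c zz h(1,2)] unfolding E_def h(3) by (rule sym)
    also have "\<dots> = ((Ide C B \<rhd>\<^sub>a E) \<cdot> (Ide C B \<rhd>\<^sub>a Ide C Y \<rhd>\<^sub>a h)) \<cdot> ?t"
      by (rule comp_assoc_arr[symmetric]) (use ob g in simp_all)
    finally show ?thesis using ob by (simp only: act_ide_comp[of B "Ide C Y \<rhd>\<^sub>a h" E] actA_arr actA_cod
      \<open>E \<in> Arr M\<close> \<open>Dom M E = Y \<rhd>\<^sub>o B \<rhd>\<^sub>o N\<close> h C.ide_arr C.ide_cod)
  qed
  show "f \<cdot> LUnit M (Dom M g) = g \<cdot> LUnit M (Dom M g)"
    using *[OF f g(3)] *[OF g(1,2) refl] eq unfolding E_def by simp
qed (use f g in simp_all)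

locale central_action = V: tensor_category K V + module_category K C M
  for K :: "('k, 'r) ring_scheme" and V :: "('k, 'v, 'w) brcat"
    and C :: "('k, 'o, 'a) moncat" and M :: "('k, 'o, 'a, 'mo, 'ma) modcat" (structure) +
  fixes G :: "('v, 'w, ('o, 'a) cob, ('o, 'a) carr) monfunc"
  assumes G_monoidal: "monoidal_functor V (center C) G"
begin

abbreviation comp_C :: "'a \<Rightarrow> 'a \<Rightarrow> 'a"  (infixr \<open>\<bullet>\<close> 75)
  where "g \<bullet> f \<equiv> g \<cdot>\<^bsub>C\<^esub> f"
abbreviation tensO_C :: "'o \<Rightarrow> 'o \<Rightarrow> 'o"  (infixr \<open>\<otimes>\<^sub>C\<close> 80)
  where "X \<otimes>\<^sub>C Y \<equiv> X \<otimes>\<^sub>o\<^bsub>C\<^esub> Y"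
abbreviation B :: "'v \<Rightarrow> 'o" where "B W \<equiv> fst (FO G W)"
abbreviation hb :: "'v \<Rightarrow> 'o \<Rightarrow> 'a" where "hb W \<equiv> snd (FO G W)"
abbreviation Gm :: "'w \<Rightarrow> 'a" where "Gm w \<equiv> center_arr (FA G w)"
abbreviation mu :: "'v \<Rightarrow> 'v \<Rightarrow> 'a" where "mu U W \<equiv> center_arr (MulIso G U W)"
abbreviation gu :: 'a where "gu \<equiv> center_arr (UnitIso G)"

section \<open>The central functor, read off in terms of arrows of C\<close>

lemma center_homD:
  assumes "x \<in> Hom (center C) P Q"
  shows "center_arr x \<in> Hom C (fst P) (fst Q)" "x = (P, center_arr x, Q)"
    "X \<in> Ob C \<Longrightarrow> (Ide C X \<otimes>\<^sub>a\<^bsub>C\<^esub> center_arr x) \<bullet> snd P X = snd Q X \<bullet> (center_arr x \<otimes>\<^sub>a\<^bsub>C\<^esub> Ide C X)"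
  using assms by (auto simp: C.in_center_hom center_arr_def)

lemma center_isoD:
  assumes x: "x \<in> Hom (center C) P Q" and iso: "is_iso (center C) x"
  shows "is_iso C (center_arr x)"
proof -
  interpret Z: category "center C" by (rule C.category_center)
  obtain y where y: "is_inverse (center C) x y" using iso by (auto simp: is_iso_def)
  have dx: "Dom (center C) x = P" "Cod (center C) x = Q" using x by (auto simp: Hom_def)
  have y': "y \<in> Hom (center C) Q P" using y dx by (auto simp: is_inverse_def)
  obtain a b where ab: "x = (P, a, Q)" "y = (Q, b, P)"
    using center_homD(2)[OF x] center_homD(2)[OF y'] by metis
  have "a \<in> Hom C (fst P) (fst Q)" "b \<in> Hom C (fst Q) (fst P)"
    using center_homD(1)[OF x] center_homD(1)[OF y'] ab by (auto simp: center_arr_def)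
  moreover have "b \<bullet> a = Ide C (fst P)" "a \<bullet> b = Ide C (fst Q)"
    using y dx ab by (auto simp: is_inverse_def C.center_sel)
  ultimately show ?thesis using ab C.is_isoI by (auto simp: center_arr_def)
qed

lemma G_ob: "W \<in> Ob V \<Longrightarrow> half_braiding C (B W) (hb W)"
  using G_monoidal by (auto simp: monoidal_functor_def is_functor_def C.center_sel split: prod.splits)

lemma G_hom: "w \<in> Arr V \<Longrightarrow> FA G w \<in> Hom (center C) (FO G (Dom V w)) (FO G (Cod V w))"
  using G_monoidal unfolding monoidal_functor_def is_functor_def by (auto simp: Hom_def)

lemma mul_iso:
  "U \<in> Ob V \<Longrightarrow> W \<in> Ob V \<Longrightarrow> MulIso G U W \<in> Hom (center C) (center_tensO C (FO G U) (FO G W)) (FO G (U \<otimes>\<^sub>o\<^bsub>V\<^esub> W))"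
  "U \<in> Ob V \<Longrightarrow> W \<in> Ob V \<Longrightarrow> is_iso (center C) (MulIso G U W)"
  using G_monoidal unfolding monoidal_functor_def by (auto simp: center_def)

lemma unit_iso:
  "UnitIso G \<in> Hom (center C) (Unit C, \<lambda>X\<in>Ob C. Ide C X) (FO G (Unit V))" "is_iso (center C) (UnitIso G)"
  using G_monoidal unfolding monoidal_functor_def by (auto simp: center_def)

lemma fst_center_tensO [simp]: "fst (center_tensO C P Q) = fst P \<otimes>\<^sub>C fst Q"
  by (auto simp: center_tensO_def split: prod.splits)

lemma snd_center_tensO:
  "X \<in> Ob C \<Longrightarrow> snd (center_tensO C P Q) X = (snd P X \<otimes>\<^sub>a\<^bsub>C\<^esub> Ide C (fst Q)) \<bullet> (Ide C (fst P) \<otimes>\<^sub>a\<^bsub>C\<^esub> snd Q X)"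
  by (auto simp: center_tensO_def split: prod.splits)

lemma B_ob [simp]: "W \<in> Ob V \<Longrightarrow> B W \<in> Ob C"
  using G_ob by (auto simp: half_braiding_def)

lemma hb_simps [simp]:
  assumes "W \<in> Ob V" "X \<in> Ob C"
  shows "hb W X \<in> Arr C" "Dom C (hb W X) = B W \<otimes>\<^sub>C X" "Cod C (hb W X) = X \<otimes>\<^sub>C B W" "is_iso C (hb W X)"
  using G_ob[OF assms(1)] assms(2) by (auto simp: half_braiding_def Hom_def)

lemma hb_natural:
  assumes "W \<in> Ob V" "f \<in> Arr C"
  shows "(f \<otimes>\<^sub>a\<^bsub>C\<^esub> Ide C (B W)) \<bullet> hb W (Dom C f) = hb W (Cod C f) \<bullet> (Ide C (B W) \<otimes>\<^sub>a\<^bsub>C\<^esub> f)"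
  using G_ob[OF assms(1)] assms(2) by (auto simp: half_braiding_def)

lemma hb_tens:
  assumes "W \<in> Ob V" "X \<in> Ob C" "Y \<in> Ob C"
  shows "hb W (X \<otimes>\<^sub>C Y) = (Ide C X \<otimes>\<^sub>a\<^bsub>C\<^esub> hb W Y) \<bullet> (hb W X \<otimes>\<^sub>a\<^bsub>C\<^esub> Ide C Y)"
  using G_ob[OF assms(1)] assms(2,3) by (auto simp: half_braiding_def)

text \<open>Multiplicativity at 1 tensor 1 makes this arrow idempotent, and an idempotent
  isomorphism is an identity.\<close>

lemma hb_unit: "W \<in> Ob V \<Longrightarrow> hb W (Unit C) = Ide C (B W)"
proof -
  assume [simp]: "W \<in> Ob V"
  have "hb W (Unit C) \<bullet> hb W (Unit C) = hb W (Unit C)" using hb_tens[of W "Unit C" "Unit C"] by simp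
  then show ?thesis
    using C.iso_cancel_left[of "hb W (Unit C)" "hb W (Unit C)" "Ide C (B W)"] by simp
qed

lemma Gm_simps [simp]:
  assumes "w \<in> Arr V"
  shows "Gm w \<in> Arr C" "Dom C (Gm w) = B (Dom V w)" "Cod C (Gm w) = B (Cod V w)"
  using center_homD(1)[OF G_hom[OF assms]] by (auto simp: Hom_def)

lemma mu_simps [simp]:
  assumes "U \<in> Ob V" "W \<in> Ob V"
  shows "mu U W \<in> Arr C" "Dom C (mu U W) = B U \<otimes>\<^sub>C B W" "Cod C (mu U W) = B (U \<otimes>\<^sub>o\<^bsub>V\<^esub> W)" "is_iso C (mu U W)"
  using center_homD(1)[OF mul_iso(1)[OF assms]] center_isoD[OF mul_iso(1)[OF assms] mul_iso(2)[OF assms]]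
  by (auto simp: Hom_def)

lemma gu_simps [simp]:
  "gu \<in> Arr C" "Dom C gu = Unit C" "Cod C gu = B (Unit V)" "is_iso C gu"
  using center_homD(1)[OF unit_iso(1)] center_isoD[OF unit_iso(1) unit_iso(2)] by (auto simp: Hom_def)

lemma center_comp_arr:
  "center_arr (y \<cdot>\<^bsub>center C\<^esub> x) = center_arr y \<bullet> center_arr x"
  by (cases x; cases y) (simp add: C.center_sel center_arr_def)

lemma center_tens_arr:
  "center_arr (x \<otimes>\<^sub>a\<^bsub>center C\<^esub> y) = center_arr x \<otimes>\<^sub>a\<^bsub>C\<^esub> center_arr y"
  by (cases x; cases y) (simp add: center_def center_arr_def)

lemma center_ide_arr: "center_arr (Ide (center C) P) = Ide C (fst P)"
  by (simp add: center_def center_arr_def)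

lemma Gm_ide [simp]: "W \<in> Ob V \<Longrightarrow> Gm (Ide V W) = Ide C (B W)"
  using G_monoidal unfolding monoidal_functor_def is_functor_def by (auto simp: center_ide_arr)

lemma Gm_comp [simp]:
  assumes "w \<in> Arr V" "w' \<in> Arr V" "Dom V w' = Cod V w"
  shows "Gm (w' \<cdot>\<^bsub>V\<^esub> w) = Gm w' \<bullet> Gm w"
proof -
  have "FA G (w' \<cdot>\<^bsub>V\<^esub> w) = FA G w' \<cdot>\<^bsub>center C\<^esub> FA G w"
    using G_monoidal assms V.in_hom[of w] V.in_hom[of w'] unfolding monoidal_functor_def is_functor_def
    by metis
  then show ?thesis by (simp add: center_comp_arr)
qed

lemma mu_natural:
  assumes "w \<in> Arr V" "w' \<in> Arr V"
  shows "Gm (w \<otimes>\<^sub>a\<^bsub>V\<^esub> w') \<bullet> mu (Dom V w) (Dom V w') = mu (Cod V w) (Cod V w') \<bullet> (Gm w \<otimes>\<^sub>a\<^bsub>C\<^esub> Gm w')"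
proof -
  have "FA G (w \<otimes>\<^sub>a\<^bsub>V\<^esub> w') \<cdot>\<^bsub>center C\<^esub> MulIso G (Dom V w) (Dom V w')
      = MulIso G (Cod V w) (Cod V w') \<cdot>\<^bsub>center C\<^esub> (FA G w \<otimes>\<^sub>a\<^bsub>center C\<^esub> FA G w')"
    using G_monoidal assms unfolding monoidal_functor_def by blast
  from arg_cong[OF this, of center_arr] show ?thesis by (simp add: center_comp_arr center_tens_arr)
qed

lemma mu_assoc:
  assumes "U \<in> Ob V" "W \<in> Ob V" "W' \<in> Ob V"
  shows "mu (U \<otimes>\<^sub>o\<^bsub>V\<^esub> W) W' \<bullet> (mu U W \<otimes>\<^sub>a\<^bsub>C\<^esub> Ide C (B W'))
    = mu U (W \<otimes>\<^sub>o\<^bsub>V\<^esub> W') \<bullet> (Ide C (B U) \<otimes>\<^sub>a\<^bsub>C\<^esub> mu W W')"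
proof -
  have "MulIso G (U \<otimes>\<^sub>o\<^bsub>V\<^esub> W) W' \<cdot>\<^bsub>center C\<^esub> (MulIso G U W \<otimes>\<^sub>a\<^bsub>center C\<^esub> Ide (center C) (FO G W'))
    = MulIso G U (W \<otimes>\<^sub>o\<^bsub>V\<^esub> W') \<cdot>\<^bsub>center C\<^esub> (Ide (center C) (FO G U) \<otimes>\<^sub>a\<^bsub>center C\<^esub> MulIso G W W')"
    using G_monoidal assms unfolding monoidal_functor_def by blast
  from arg_cong[OF this, of center_arr] show ?thesis
    by (simp add: center_comp_arr center_tens_arr center_ide_arr)
qed

lemma mu_unit:
  assumes "W \<in> Ob V"
  shows "mu (Unit V) W \<bullet> (gu \<otimes>\<^sub>a\<^bsub>C\<^esub> Ide C (B W)) = Ide C (B W)"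
    and "mu W (Unit V) \<bullet> (Ide C (B W) \<otimes>\<^sub>a\<^bsub>C\<^esub> gu) = Ide C (B W)"
proof -
  have "MulIso G (Unit V) W \<cdot>\<^bsub>center C\<^esub> (UnitIso G \<otimes>\<^sub>a\<^bsub>center C\<^esub> Ide (center C) (FO G W)) = Ide (center C) (FO G W)"
    and "MulIso G W (Unit V) \<cdot>\<^bsub>center C\<^esub> (Ide (center C) (FO G W) \<otimes>\<^sub>a\<^bsub>center C\<^esub> UnitIso G) = Ide (center C) (FO G W)"
    using G_monoidal assms unfolding monoidal_functor_def by blast+
  from this[THEN arg_cong, of center_arr]
  show "mu (Unit V) W \<bullet> (gu \<otimes>\<^sub>a\<^bsub>C\<^esub> Ide C (B W)) = Ide C (B W)"
    "mu W (Unit V) \<bullet> (Ide C (B W) \<otimes>\<^sub>a\<^bsub>C\<^esub> gu) = Ide C (B W)"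
    by (simp_all add: center_comp_arr center_tens_arr center_ide_arr)
qed

lemma hb_Gm:
  assumes "w \<in> Arr V" "X \<in> Ob C"
  shows "(Ide C X \<otimes>\<^sub>a\<^bsub>C\<^esub> Gm w) \<bullet> hb (Dom V w) X = hb (Cod V w) X \<bullet> (Gm w \<otimes>\<^sub>a\<^bsub>C\<^esub> Ide C X)"
  using center_homD(3)[OF G_hom[OF assms(1)] assms(2)] .

lemma hb_mu:
  assumes "U \<in> Ob V" "W \<in> Ob V" "X \<in> Ob C"
  shows "(Ide C X \<otimes>\<^sub>a\<^bsub>C\<^esub> mu U W) \<bullet> (hb U X \<otimes>\<^sub>a\<^bsub>C\<^esub> Ide C (B W)) \<bullet> (Ide C (B U) \<otimes>\<^sub>a\<^bsub>C\<^esub> hb W X)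
    = hb (U \<otimes>\<^sub>o\<^bsub>V\<^esub> W) X \<bullet> (mu U W \<otimes>\<^sub>a\<^bsub>C\<^esub> Ide C X)"
  using center_homD(3)[OF mul_iso(1)[OF assms(1,2)] assms(3)] by (simp add: snd_center_tensO assms(3))

lemma hb_gu: "X \<in> Ob C \<Longrightarrow> Ide C X \<otimes>\<^sub>a\<^bsub>C\<^esub> gu = hb (Unit V) X \<bullet> (gu \<otimes>\<^sub>a\<^bsub>C\<^esub> Ide C X)"
  using center_homD(3)[OF unit_iso(1), of X] by simp

text \<open>A strong monoidal functor preserves duals: its structure isomorphisms transport
  evaluation and coevaluation. The result is stated for underlying arrows in C, where the action on
  M is available.\<close>

lemma G_left_dual:
  assumes dual: "left_dual V W Y e c"
  shows "inv_arr C gu \<bullet> Gm e \<bullet> mu Y W \<in> Hom C (B Y \<otimes>\<^sub>C B W) (Unit C)"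
    and "inv_arr C (mu W Y) \<bullet> Gm c \<bullet> gu \<in> Hom C (Unit C) (B W \<otimes>\<^sub>C B Y)"
    and "(Ide C (B W) \<otimes>\<^sub>a\<^bsub>C\<^esub> (inv_arr C gu \<bullet> Gm e \<bullet> mu Y W))
      \<bullet> ((inv_arr C (mu W Y) \<bullet> Gm c \<bullet> gu) \<otimes>\<^sub>a\<^bsub>C\<^esub> Ide C (B W)) = Ide C (B W)"
proof -
  have [simp]: "W \<in> Ob V" "Y \<in> Ob V" "e \<in> Arr V" "Dom V e = Y \<otimes>\<^sub>o\<^bsub>V\<^esub> W" "Cod V e = Unit V"
    "c \<in> Arr V" "Dom V c = Unit V" "Cod V c = W \<otimes>\<^sub>o\<^bsub>V\<^esub> Y"
    and zz: "(Ide V W \<otimes>\<^sub>a\<^bsub>V\<^esub> e) \<cdot>\<^bsub>V\<^esub> (c \<otimes>\<^sub>a\<^bsub>V\<^esub> Ide V W) = Ide V W"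
    using dual unfolding left_dual_def Hom_def by blast+
  let ?I = "Ide C (B W)"
  show "inv_arr C gu \<bullet> Gm e \<bullet> mu Y W \<in> Hom C (B Y \<otimes>\<^sub>C B W) (Unit C)"
    "inv_arr C (mu W Y) \<bullet> Gm c \<bullet> gu \<in> Hom C (Unit C) (B W \<otimes>\<^sub>C B Y)"
    by (simp_all add: Hom_def)
  have split1: "?I \<otimes>\<^sub>a\<^bsub>C\<^esub> (inv_arr C gu \<bullet> Gm e \<bullet> mu Y W)
      = (?I \<otimes>\<^sub>a\<^bsub>C\<^esub> inv_arr C gu) \<bullet> (?I \<otimes>\<^sub>a\<^bsub>C\<^esub> Gm e) \<bullet> (?I \<otimes>\<^sub>a\<^bsub>C\<^esub> mu Y W)"
    by (simp add: C.interchange)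
  have split2: "(inv_arr C (mu W Y) \<bullet> Gm c \<bullet> gu) \<otimes>\<^sub>a\<^bsub>C\<^esub> ?I
      = (inv_arr C (mu W Y) \<otimes>\<^sub>a\<^bsub>C\<^esub> ?I) \<bullet> (Gm c \<otimes>\<^sub>a\<^bsub>C\<^esub> ?I) \<bullet> (gu \<otimes>\<^sub>a\<^bsub>C\<^esub> ?I)"
    by (simp add: C.interchange)
  \<comment> \<open>The unit coherence of G, solved for the inverse of its unit isomorphism.\<close>
  have u: "?I \<otimes>\<^sub>a\<^bsub>C\<^esub> inv_arr C gu = mu W (Unit V)"
  proof (rule C.iso_cancel_right[of "?I \<otimes>\<^sub>a\<^bsub>C\<^esub> gu"])
    show "(?I \<otimes>\<^sub>a\<^bsub>C\<^esub> inv_arr C gu) \<bullet> (?I \<otimes>\<^sub>a\<^bsub>C\<^esub> gu) = mu W (Unit V) \<bullet> (?I \<otimes>\<^sub>a\<^bsub>C\<^esub> gu)"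
      by (simp add: C.interchange mu_unit)
  qed simp_all
  \<comment> \<open>Named tails of the chain, so that the structure isomorphisms can be moved from
    the left end one at a time.\<close>
  define r where "r = (Gm c \<otimes>\<^sub>a\<^bsub>C\<^esub> ?I) \<bullet> (gu \<otimes>\<^sub>a\<^bsub>C\<^esub> ?I)"
  have [simp]: "r \<in> Arr C" "Cod C r = B (W \<otimes>\<^sub>o\<^bsub>V\<^esub> Y) \<otimes>\<^sub>C B W" by (simp_all add: r_def)
  define x where "x = (inv_arr C (mu W Y) \<otimes>\<^sub>a\<^bsub>C\<^esub> ?I) \<bullet> r"
  have [simp]: "x \<in> Arr C" "Cod C x = B W \<otimes>\<^sub>C B Y \<otimes>\<^sub>C B W" by (simp_all add: x_def)
  define y where "y = (?I \<otimes>\<^sub>a\<^bsub>C\<^esub> mu Y W) \<bullet> x"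
  have [simp]: "y \<in> Arr C" "Cod C y = B W \<otimes>\<^sub>C B (Y \<otimes>\<^sub>o\<^bsub>V\<^esub> W)" by (simp_all add: y_def)
  have mx: "(mu W Y \<otimes>\<^sub>a\<^bsub>C\<^esub> ?I) \<bullet> x = r" by (simp add: x_def C.interchange_tail)
  \<comment> \<open>Associativity of the structure isomorphisms of G regroups W, Y, W from the
    evaluation side to the coevaluation side.\<close>
  have my: "mu W (Y \<otimes>\<^sub>o\<^bsub>V\<^esub> W) \<bullet> y = mu (W \<otimes>\<^sub>o\<^bsub>V\<^esub> Y) W \<bullet> r"
    using C.comp_tail[OF mu_assoc[of W Y W, symmetric], of x] by (simp add: mx y_def)
  have "(?I \<otimes>\<^sub>a\<^bsub>C\<^esub> (inv_arr C gu \<bullet> Gm e \<bullet> mu Y W))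
      \<bullet> ((inv_arr C (mu W Y) \<bullet> Gm c \<bullet> gu) \<otimes>\<^sub>a\<^bsub>C\<^esub> ?I)
      = mu W (Unit V) \<bullet> (?I \<otimes>\<^sub>a\<^bsub>C\<^esub> Gm e) \<bullet> y"
    unfolding split1 split2 u r_def[symmetric] x_def[symmetric] by (simp add: y_def)
  also have "\<dots> = Gm (Ide V W \<otimes>\<^sub>a\<^bsub>V\<^esub> e) \<bullet> mu W (Y \<otimes>\<^sub>o\<^bsub>V\<^esub> W) \<bullet> y"
    using C.comp_tail[OF mu_natural[of "Ide V W" e, symmetric], of y] by simp
  also have "mu W (Y \<otimes>\<^sub>o\<^bsub>V\<^esub> W) \<bullet> y = Gm (c \<otimes>\<^sub>a\<^bsub>V\<^esub> Ide V W) \<bullet> mu (Unit V) W \<bullet> (gu \<otimes>\<^sub>a\<^bsub>C\<^esub> ?I)"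
    unfolding my r_def using C.comp_tail[OF mu_natural[of c "Ide V W", symmetric], of "gu \<otimes>\<^sub>a\<^bsub>C\<^esub> ?I"] by simp
  also have "Gm (Ide V W \<otimes>\<^sub>a\<^bsub>V\<^esub> e) \<bullet> Gm (c \<otimes>\<^sub>a\<^bsub>V\<^esub> Ide V W) \<bullet> mu (Unit V) W \<bullet> (gu \<otimes>\<^sub>a\<^bsub>C\<^esub> ?I) = ?I"
    using arg_cong[OF zz, of Gm] by (simp add: mu_unit)
  finally show "(?I \<otimes>\<^sub>a\<^bsub>C\<^esub> (inv_arr C gu \<bullet> Gm e \<bullet> mu Y W))
      \<bullet> ((inv_arr C (mu W Y) \<bullet> Gm c \<bullet> gu) \<otimes>\<^sub>a\<^bsub>C\<^esub> ?I) = ?I" .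
qed


abbreviation tau :: "'v \<Rightarrow> 'o \<Rightarrow> 'a" where "tau W X \<equiv> inv_arr C (hb W X)"

section \<open>Inverse half-braidings of the objects G W\<close>

lemma tau_natural:
  assumes [simp]: "W \<in> Ob V" "f \<in> Arr C"
  shows "(Ide C (B W) \<otimes>\<^sub>a\<^bsub>C\<^esub> f) \<bullet> tau W (Dom C f) = tau W (Cod C f) \<bullet> (f \<otimes>\<^sub>a\<^bsub>C\<^esub> Ide C (B W))"
  by (rule C.iso_cancel_left[of "hb W (Cod C f)"])
    (use C.comp_tail[OF hb_natural[symmetric, of W f], of "tau W (Dom C f)"] in simp_all)

lemma tau_Gm:
  assumes [simp]: "w \<in> Arr V" "X \<in> Ob C"
  shows "(Gm w \<otimes>\<^sub>a\<^bsub>C\<^esub> Ide C X) \<bullet> tau (Dom V w) X = tau (Cod V w) X \<bullet> (Ide C X \<otimes>\<^sub>a\<^bsub>C\<^esub> Gm w)"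
  by (rule C.iso_cancel_left[of "hb (Cod V w) X"])
    (use C.comp_tail[OF hb_Gm[symmetric, of w X], of "tau (Dom V w) X"] in simp_all)

lemma tau_gu:
  assumes [simp]: "X \<in> Ob C"
  shows "(inv_arr C gu \<otimes>\<^sub>a\<^bsub>C\<^esub> Ide C X) \<bullet> tau (Unit V) X = Ide C X \<otimes>\<^sub>a\<^bsub>C\<^esub> inv_arr C gu"
proof (rule C.iso_cancel_left[of "Ide C X \<otimes>\<^sub>a\<^bsub>C\<^esub> gu"])
  have "(Ide C X \<otimes>\<^sub>a\<^bsub>C\<^esub> gu) \<bullet> (inv_arr C gu \<otimes>\<^sub>a\<^bsub>C\<^esub> Ide C X) = hb (Unit V) X"
    by (simp add: hb_gu C.interchange)
  then show "(Ide C X \<otimes>\<^sub>a\<^bsub>C\<^esub> gu) \<bullet> (inv_arr C gu \<otimes>\<^sub>a\<^bsub>C\<^esub> Ide C X) \<bullet> tau (Unit V) X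
    = (Ide C X \<otimes>\<^sub>a\<^bsub>C\<^esub> gu) \<bullet> (Ide C X \<otimes>\<^sub>a\<^bsub>C\<^esub> inv_arr C gu)"
    using C.comp_tail[of "Ide C X \<otimes>\<^sub>a\<^bsub>C\<^esub> gu" "inv_arr C gu \<otimes>\<^sub>a\<^bsub>C\<^esub> Ide C X" _ "tau (Unit V) X"]
    by (simp add: C.interchange)
qed simp_all

lemma tau_mu:
  assumes [simp]: "U \<in> Ob V" "W \<in> Ob V" "X \<in> Ob C"
  shows "(inv_arr C (mu U W) \<otimes>\<^sub>a\<^bsub>C\<^esub> Ide C X) \<bullet> tau (U \<otimes>\<^sub>o\<^bsub>V\<^esub> W) X
    = (Ide C (B U) \<otimes>\<^sub>a\<^bsub>C\<^esub> tau W X) \<bullet> (tau U X \<otimes>\<^sub>a\<^bsub>C\<^esub> Ide C (B W)) \<bullet> (Ide C X \<otimes>\<^sub>a\<^bsub>C\<^esub> inv_arr C (mu U W))"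
    (is "?l = ?r")
proof -
  \<comment> \<open>\<open>hb_mu\<close> gives two factorisations of this arrow; inverting each of
    them gives one side of the claim.\<close>
  define f where "f = (Ide C X \<otimes>\<^sub>a\<^bsub>C\<^esub> mu U W) \<bullet> (hb U X \<otimes>\<^sub>a\<^bsub>C\<^esub> Ide C (B W)) \<bullet> (Ide C (B U) \<otimes>\<^sub>a\<^bsub>C\<^esub> hb W X)"
  have f: "f = hb (U \<otimes>\<^sub>o\<^bsub>V\<^esub> W) X \<bullet> (mu U W \<otimes>\<^sub>a\<^bsub>C\<^esub> Ide C X)" unfolding f_def by (rule hb_mu) fact+
  have "inv_arr C f = ?l" unfolding f by (simp add: C.inv_arr_comp C.inv_arr_tensA)
  moreover have "inv_arr C f = ?r" unfolding f_def by (simp add: C.inv_arr_comp C.inv_arr_tensA)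
  ultimately show ?thesis by simp
qed

abbreviation sw :: "'o \<Rightarrow> 'v \<Rightarrow> 'mo \<Rightarrow> 'ma" where "sw \<equiv> swap G C M"

section \<open>The functors X |> - as V-module functors\<close>

lemma swap_simps [simp]:
  assumes "X \<in> Ob C" "W \<in> Ob V" "N \<in> Ob M"
  shows "sw X W N \<in> Arr M" "Dom M (sw X W N) = X \<rhd>\<^sub>o B W \<rhd>\<^sub>o N" "Cod M (sw X W N) = B W \<rhd>\<^sub>o X \<rhd>\<^sub>o N"
    "is_iso M (sw X W N)"
  unfolding swap_def using assms by simp_all

lemma swap_assoc:
  assumes [simp]: "X \<in> Ob C" "W \<in> Ob V" "N \<in> Ob M"
  shows "sw X W N \<cdot> Assoc M X (B W) N = Assoc M (B W) X N \<cdot> (tau W X \<rhd>\<^sub>a Ide M N)"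
  unfolding swap_def by simp

text \<open>Precomposed with an associativity isomorphism, \<open>swap\<close> is the action of
  \<open>tau\<close>. Naturality in all three variables thus reduces to that of \<open>tau\<close>
  in C and of \<open>Assoc\<close>.\<close>

lemma swap_natural:
  assumes [simp]: "f \<in> Arr C" "w \<in> Arr V" "g \<in> Arr M"
  shows "sw (Cod C f) (Cod V w) (Cod M g) \<cdot> (f \<rhd>\<^sub>a Gm w \<rhd>\<^sub>a g) = (Gm w \<rhd>\<^sub>a f \<rhd>\<^sub>a g) \<cdot> sw (Dom C f) (Dom V w) (Dom M g)"
proof (rule iso_cancel_right[of "Assoc M (Dom C f) (B (Dom V w)) (Dom M g)"])
  let ?X = "Dom C f" and ?X' = "Cod C f" and ?W = "Dom V w" and ?W' = "Cod V w" and ?N = "Dom M g" and ?N' = "Cod M g"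
  have "(sw ?X' ?W' ?N' \<cdot> (f \<rhd>\<^sub>a Gm w \<rhd>\<^sub>a g)) \<cdot> Assoc M ?X (B ?W) ?N
      = sw ?X' ?W' ?N' \<cdot> Assoc M ?X' (B ?W') ?N' \<cdot> ((f \<otimes>\<^sub>a\<^bsub>C\<^esub> Gm w) \<rhd>\<^sub>a g)"
    using assoc_nat[of f "Gm w" g] by simp
  also have "\<dots> = Assoc M (B ?W') ?X' ?N' \<cdot> (tau ?W' ?X' \<rhd>\<^sub>a Ide M ?N') \<cdot> ((f \<otimes>\<^sub>a\<^bsub>C\<^esub> Gm w) \<rhd>\<^sub>a g)"
    using comp_tail[OF swap_assoc[of ?X' ?W' ?N'], of "(f \<otimes>\<^sub>a\<^bsub>C\<^esub> Gm w) \<rhd>\<^sub>a g"] by simp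
  also have "\<dots> = Assoc M (B ?W') ?X' ?N' \<cdot> ((tau ?W' ?X' \<bullet> (f \<otimes>\<^sub>a\<^bsub>C\<^esub> Gm w)) \<rhd>\<^sub>a g)"
    by (simp add: act_interchange)
  also have "tau ?W' ?X' \<bullet> (f \<otimes>\<^sub>a\<^bsub>C\<^esub> Gm w) = (Gm w \<otimes>\<^sub>a\<^bsub>C\<^esub> f) \<bullet> tau ?W ?X"
  proof -
    have "tau ?W' ?X' \<bullet> (f \<otimes>\<^sub>a\<^bsub>C\<^esub> Gm w) = tau ?W' ?X' \<bullet> (f \<otimes>\<^sub>a\<^bsub>C\<^esub> Ide C (B ?W')) \<bullet> (Ide C ?X \<otimes>\<^sub>a\<^bsub>C\<^esub> Gm w)"
      using C.tens_split(1)[of f "Gm w"] by simp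
    also have "\<dots> = (Ide C (B ?W') \<otimes>\<^sub>a\<^bsub>C\<^esub> f) \<bullet> tau ?W' ?X \<bullet> (Ide C ?X \<otimes>\<^sub>a\<^bsub>C\<^esub> Gm w)"
      using C.comp_tail[OF tau_natural[symmetric, of ?W' f], of "Ide C ?X \<otimes>\<^sub>a\<^bsub>C\<^esub> Gm w"] by simp
    also have "\<dots> = (Ide C (B ?W') \<otimes>\<^sub>a\<^bsub>C\<^esub> f) \<bullet> (Gm w \<otimes>\<^sub>a\<^bsub>C\<^esub> Ide C ?X) \<bullet> tau ?W ?X"
      using tau_Gm[of w ?X] by simp
    also have "\<dots> = (Gm w \<otimes>\<^sub>a\<^bsub>C\<^esub> f) \<bullet> tau ?W ?X" by (simp add: C.interchange_tail)
    finally show ?thesis .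
  qed
  also have "Assoc M (B ?W') ?X' ?N' \<cdot> (((Gm w \<otimes>\<^sub>a\<^bsub>C\<^esub> f) \<bullet> tau ?W ?X) \<rhd>\<^sub>a g)
      = Assoc M (B ?W') ?X' ?N' \<cdot> ((Gm w \<otimes>\<^sub>a\<^bsub>C\<^esub> f) \<rhd>\<^sub>a g) \<cdot> (tau ?W ?X \<rhd>\<^sub>a Ide M ?N)"
    by (simp add: act_interchange)
  also have "\<dots> = (Gm w \<rhd>\<^sub>a f \<rhd>\<^sub>a g) \<cdot> Assoc M (B ?W) ?X ?N \<cdot> (tau ?W ?X \<rhd>\<^sub>a Ide M ?N)"
    using comp_tail[OF assoc_nat[symmetric, of "Gm w" f g], of "tau ?W ?X \<rhd>\<^sub>a Ide M ?N"] by simp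
  also have "\<dots> = ((Gm w \<rhd>\<^sub>a f \<rhd>\<^sub>a g) \<cdot> sw ?X ?W ?N) \<cdot> Assoc M ?X (B ?W) ?N"
    using swap_assoc[of ?X ?W ?N] by simp
  finally show "(sw ?X' ?W' ?N' \<cdot> (f \<rhd>\<^sub>a Gm w \<rhd>\<^sub>a g)) \<cdot> Assoc M ?X (B ?W) ?N
    = ((Gm w \<rhd>\<^sub>a f \<rhd>\<^sub>a g) \<cdot> sw ?X ?W ?N) \<cdot> Assoc M ?X (B ?W) ?N" .
qed simp_all

text \<open>The unit axiom of the module functor X |> -. Both triangle identities occur, because the
  unit object stands to the left of X on one side and to its right on the other.\<close>

lemma swap_unit:
  assumes [simp]: "X \<in> Ob C" "N \<in> Ob M"
  shows "(LUnit M (X \<rhd>\<^sub>o N) \<cdot> (inv_arr C gu \<rhd>\<^sub>a Ide M (X \<rhd>\<^sub>o N))) \<cdot> sw X (Unit V) N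
    = Ide C X \<rhd>\<^sub>a (LUnit M N \<cdot> (inv_arr C gu \<rhd>\<^sub>a Ide M N))"
proof (rule iso_cancel_right[of "Assoc M X (B (Unit V)) N"])
  let ?g = "inv_arr C gu"
  have "((LUnit M (X \<rhd>\<^sub>o N) \<cdot> (?g \<rhd>\<^sub>a Ide M (X \<rhd>\<^sub>o N))) \<cdot> sw X (Unit V) N) \<cdot> Assoc M X (B (Unit V)) N
      = LUnit M (X \<rhd>\<^sub>o N) \<cdot> (?g \<rhd>\<^sub>a Ide M (X \<rhd>\<^sub>o N)) \<cdot> Assoc M (B (Unit V)) X N \<cdot> (tau (Unit V) X \<rhd>\<^sub>a Ide M N)"
    by (simp add: swap_assoc)
  also have "(?g \<rhd>\<^sub>a Ide M (X \<rhd>\<^sub>o N)) \<cdot> Assoc M (B (Unit V)) X N \<cdot> (tau (Unit V) X \<rhd>\<^sub>a Ide M N)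
      = Assoc M (Unit C) X N \<cdot> ((?g \<otimes>\<^sub>a\<^bsub>C\<^esub> Ide C X) \<rhd>\<^sub>a Ide M N) \<cdot> (tau (Unit V) X \<rhd>\<^sub>a Ide M N)"
    using comp_tail[OF assoc_nat_ide[of ?g X N], of "tau (Unit V) X \<rhd>\<^sub>a Ide M N"] by simp
  also have "((?g \<otimes>\<^sub>a\<^bsub>C\<^esub> Ide C X) \<rhd>\<^sub>a Ide M N) \<cdot> (tau (Unit V) X \<rhd>\<^sub>a Ide M N) = (Ide C X \<otimes>\<^sub>a\<^bsub>C\<^esub> ?g) \<rhd>\<^sub>a Ide M N"
    using tau_gu[of X] by (simp add: act_interchange)
  also have "LUnit M (X \<rhd>\<^sub>o N) \<cdot> Assoc M (Unit C) X N \<cdot> ((Ide C X \<otimes>\<^sub>a\<^bsub>C\<^esub> ?g) \<rhd>\<^sub>a Ide M N)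
      = (Ide C X \<otimes>\<^sub>a\<^bsub>C\<^esub> ?g) \<rhd>\<^sub>a Ide M N"
    using comp_tail[OF lunit_assoc[of X N], of "(Ide C X \<otimes>\<^sub>a\<^bsub>C\<^esub> ?g) \<rhd>\<^sub>a Ide M N"] by simp
  also have "\<dots> = (Ide C X \<rhd>\<^sub>a LUnit M N) \<cdot> Assoc M X (Unit C) N \<cdot> ((Ide C X \<otimes>\<^sub>a\<^bsub>C\<^esub> ?g) \<rhd>\<^sub>a Ide M N)"
    using comp_tail[OF lunit_triangle[of X N], of "(Ide C X \<otimes>\<^sub>a\<^bsub>C\<^esub> ?g) \<rhd>\<^sub>a Ide M N"] by simp
  also have "\<dots> = (Ide C X \<rhd>\<^sub>a (LUnit M N \<cdot> (?g \<rhd>\<^sub>a Ide M N))) \<cdot> Assoc M X (B (Unit V)) N"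
    using assoc_nat[of "Ide C X" ?g "Ide M N"] by (simp add: act_ide_comp)
  finally show "((LUnit M (X \<rhd>\<^sub>o N) \<cdot> (?g \<rhd>\<^sub>a Ide M (X \<rhd>\<^sub>o N))) \<cdot> sw X (Unit V) N) \<cdot> Assoc M X (B (Unit V)) N
    = (Ide C X \<rhd>\<^sub>a (LUnit M N \<cdot> (?g \<rhd>\<^sub>a Ide M N))) \<cdot> Assoc M X (B (Unit V)) N" .
qed simp_all

text \<open>Moving X past U and then past W is the action of a single arrow of C. Three pentagons
  are used, one for each position of X relative to U and W.\<close>

lemma swap_two:
  assumes [simp]: "X \<in> Ob C" "U \<in> Ob V" "W \<in> Ob V" "N \<in> Ob M"
  shows "(Ide C (B U) \<rhd>\<^sub>a sw X W N) \<cdot> sw X U (B W \<rhd>\<^sub>o N) \<cdot> (Ide C X \<rhd>\<^sub>a Assoc M (B U) (B W) N)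
      \<cdot> Assoc M X (B U \<otimes>\<^sub>C B W) N
    = Assoc M (B U) (B W) (X \<rhd>\<^sub>o N) \<cdot> Assoc M (B U \<otimes>\<^sub>C B W) X N
      \<cdot> (((Ide C (B U) \<otimes>\<^sub>a\<^bsub>C\<^esub> tau W X) \<bullet> (tau U X \<otimes>\<^sub>a\<^bsub>C\<^esub> Ide C (B W))) \<rhd>\<^sub>a Ide M N)"
proof -
  let ?U = "B U" and ?W = "B W"
  have "sw X U (?W \<rhd>\<^sub>o N) \<cdot> (Ide C X \<rhd>\<^sub>a Assoc M ?U ?W N) \<cdot> Assoc M X (?U \<otimes>\<^sub>C ?W) N
      = sw X U (?W \<rhd>\<^sub>o N) \<cdot> Assoc M X ?U (?W \<rhd>\<^sub>o N) \<cdot> Assoc M (X \<otimes>\<^sub>C ?U) ?W N"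
    by (simp add: assoc_pentagon)
  also have "\<dots> = Assoc M ?U X (?W \<rhd>\<^sub>o N) \<cdot> (tau U X \<rhd>\<^sub>a Ide M (?W \<rhd>\<^sub>o N)) \<cdot> Assoc M (X \<otimes>\<^sub>C ?U) ?W N"
    using comp_tail[OF swap_assoc[of X U "?W \<rhd>\<^sub>o N"], of "Assoc M (X \<otimes>\<^sub>C ?U) ?W N"] by simp
  also have "(tau U X \<rhd>\<^sub>a Ide M (?W \<rhd>\<^sub>o N)) \<cdot> Assoc M (X \<otimes>\<^sub>C ?U) ?W N
      = Assoc M (?U \<otimes>\<^sub>C X) ?W N \<cdot> ((tau U X \<otimes>\<^sub>a\<^bsub>C\<^esub> Ide C ?W) \<rhd>\<^sub>a Ide M N)"
    using assoc_nat_ide[of "tau U X" ?W N] by simp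
  also have "Assoc M ?U X (?W \<rhd>\<^sub>o N) \<cdot> Assoc M (?U \<otimes>\<^sub>C X) ?W N \<cdot> ((tau U X \<otimes>\<^sub>a\<^bsub>C\<^esub> Ide C ?W) \<rhd>\<^sub>a Ide M N)
      = (Ide C ?U \<rhd>\<^sub>a Assoc M X ?W N) \<cdot> Assoc M ?U (X \<otimes>\<^sub>C ?W) N \<cdot> ((tau U X \<otimes>\<^sub>a\<^bsub>C\<^esub> Ide C ?W) \<rhd>\<^sub>a Ide M N)"
    using comp_tail[OF assoc_pentagon[of ?U X ?W N], of "(tau U X \<otimes>\<^sub>a\<^bsub>C\<^esub> Ide C ?W) \<rhd>\<^sub>a Ide M N"] by simp
  finally have 1: "sw X U (?W \<rhd>\<^sub>o N) \<cdot> (Ide C X \<rhd>\<^sub>a Assoc M ?U ?W N) \<cdot> Assoc M X (?U \<otimes>\<^sub>C ?W) N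
      = (Ide C ?U \<rhd>\<^sub>a Assoc M X ?W N) \<cdot> Assoc M ?U (X \<otimes>\<^sub>C ?W) N \<cdot> ((tau U X \<otimes>\<^sub>a\<^bsub>C\<^esub> Ide C ?W) \<rhd>\<^sub>a Ide M N)" .
  define r where "r = (tau U X \<otimes>\<^sub>a\<^bsub>C\<^esub> Ide C ?W) \<rhd>\<^sub>a Ide M N"
  have [simp]: "r \<in> Arr M" "Cod M r = (?U \<otimes>\<^sub>C X \<otimes>\<^sub>C ?W) \<rhd>\<^sub>o N" by (simp_all add: r_def)
  have 2: "(Ide C ?U \<rhd>\<^sub>a sw X W N) \<cdot> (Ide C ?U \<rhd>\<^sub>a Assoc M X ?W N) \<cdot> Assoc M ?U (X \<otimes>\<^sub>C ?W) N \<cdot> r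
      = (Ide C ?U \<rhd>\<^sub>a Assoc M ?W X N) \<cdot> (Ide C ?U \<rhd>\<^sub>a tau W X \<rhd>\<^sub>a Ide M N) \<cdot> Assoc M ?U (X \<otimes>\<^sub>C ?W) N \<cdot> r"
  proof -
    have "(Ide C ?U \<rhd>\<^sub>a sw X W N) \<cdot> (Ide C ?U \<rhd>\<^sub>a Assoc M X ?W N)
        = (Ide C ?U \<rhd>\<^sub>a Assoc M ?W X N) \<cdot> (Ide C ?U \<rhd>\<^sub>a tau W X \<rhd>\<^sub>a Ide M N)"
      by (simp add: act_interchange swap_assoc)
    from comp_tail[OF this, of "Assoc M ?U (X \<otimes>\<^sub>C ?W) N \<cdot> r"] show ?thesis by simp
  qed
  have "(Ide C ?U \<rhd>\<^sub>a tau W X \<rhd>\<^sub>a Ide M N) \<cdot> Assoc M ?U (X \<otimes>\<^sub>C ?W) N \<cdot> r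
      = Assoc M ?U (?W \<otimes>\<^sub>C X) N \<cdot> ((Ide C ?U \<otimes>\<^sub>a\<^bsub>C\<^esub> tau W X) \<rhd>\<^sub>a Ide M N) \<cdot> r"
    using comp_tail[OF assoc_nat[of "Ide C ?U" "tau W X" "Ide M N"], of r] by simp
  moreover have "((Ide C ?U \<otimes>\<^sub>a\<^bsub>C\<^esub> tau W X) \<rhd>\<^sub>a Ide M N) \<cdot> r
      = ((Ide C ?U \<otimes>\<^sub>a\<^bsub>C\<^esub> tau W X) \<bullet> (tau U X \<otimes>\<^sub>a\<^bsub>C\<^esub> Ide C ?W)) \<rhd>\<^sub>a Ide M N"
    unfolding r_def by (simp add: act_interchange)
  moreover have "(Ide C ?U \<rhd>\<^sub>a Assoc M ?W X N) \<cdot> Assoc M ?U (?W \<otimes>\<^sub>C X) N \<cdot> s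
      = Assoc M ?U ?W (X \<rhd>\<^sub>o N) \<cdot> Assoc M (?U \<otimes>\<^sub>C ?W) X N \<cdot> s"
    if "s \<in> Arr M" "Cod M s = (?U \<otimes>\<^sub>C ?W \<otimes>\<^sub>C X) \<rhd>\<^sub>o N" for s
    using comp_tail[OF assoc_pentagon[of ?U ?W X N, symmetric], of s] that by simp
  ultimately show ?thesis unfolding 1 2 r_def[symmetric] by simp
qed

text \<open>The multiplicativity axiom of the module functor X |> -: by \<open>tau_mu\<close> the
  inverse half-braiding of G at U tensor W is the composite that appears in
  \<open>swap_two\<close>.\<close>

lemma swap_mult:
  assumes [simp]: "X \<in> Ob C" "U \<in> Ob V" "W \<in> Ob V" "N \<in> Ob M"
  shows "(Assoc M (B U) (B W) (X \<rhd>\<^sub>o N) \<cdot> (inv_arr C (mu U W) \<rhd>\<^sub>a Ide M (X \<rhd>\<^sub>o N))) \<cdot> sw X (U \<otimes>\<^sub>o\<^bsub>V\<^esub> W) N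
    = (Ide C (B U) \<rhd>\<^sub>a sw X W N) \<cdot> sw X U (B W \<rhd>\<^sub>o N)
      \<cdot> (Ide C X \<rhd>\<^sub>a (Assoc M (B U) (B W) N \<cdot> (inv_arr C (mu U W) \<rhd>\<^sub>a Ide M N)))" (is "?l = ?r")
proof (rule iso_cancel_right[of "Assoc M X (B (U \<otimes>\<^sub>o\<^bsub>V\<^esub> W)) N"])
  let ?U = "B U" and ?W = "B W" and ?m = "inv_arr C (mu U W)" and ?UW = "U \<otimes>\<^sub>o\<^bsub>V\<^esub> W"
  have "(?m \<rhd>\<^sub>a Ide M (X \<rhd>\<^sub>o N)) \<cdot> sw X ?UW N \<cdot> Assoc M X (B ?UW) N
      = Assoc M (?U \<otimes>\<^sub>C ?W) X N \<cdot> ((?m \<otimes>\<^sub>a\<^bsub>C\<^esub> Ide C X) \<rhd>\<^sub>a Ide M N) \<cdot> (tau ?UW X \<rhd>\<^sub>a Ide M N)"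
    using comp_tail[OF assoc_nat_ide[of ?m X N], of "tau ?UW X \<rhd>\<^sub>a Ide M N"] by (simp add: swap_assoc)
  also have "((?m \<otimes>\<^sub>a\<^bsub>C\<^esub> Ide C X) \<rhd>\<^sub>a Ide M N) \<cdot> (tau ?UW X \<rhd>\<^sub>a Ide M N)
      = (((Ide C ?U \<otimes>\<^sub>a\<^bsub>C\<^esub> tau W X) \<bullet> (tau U X \<otimes>\<^sub>a\<^bsub>C\<^esub> Ide C ?W)) \<rhd>\<^sub>a Ide M N) \<cdot> ((Ide C X \<otimes>\<^sub>a\<^bsub>C\<^esub> ?m) \<rhd>\<^sub>a Ide M N)"
    using tau_mu[of U W X] by (simp add: act_interchange)
  finally have l: "?l \<cdot> Assoc M X (B ?UW) N = Assoc M ?U ?W (X \<rhd>\<^sub>o N) \<cdot> Assoc M (?U \<otimes>\<^sub>C ?W) X N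
      \<cdot> (((Ide C ?U \<otimes>\<^sub>a\<^bsub>C\<^esub> tau W X) \<bullet> (tau U X \<otimes>\<^sub>a\<^bsub>C\<^esub> Ide C ?W)) \<rhd>\<^sub>a Ide M N) \<cdot> ((Ide C X \<otimes>\<^sub>a\<^bsub>C\<^esub> ?m) \<rhd>\<^sub>a Ide M N)"
    by simp
  define t where "t = (Ide C X \<otimes>\<^sub>a\<^bsub>C\<^esub> ?m) \<rhd>\<^sub>a Ide M N"
  have [simp]: "t \<in> Arr M" "Cod M t = (X \<otimes>\<^sub>C ?U \<otimes>\<^sub>C ?W) \<rhd>\<^sub>o N" by (simp_all add: t_def)
  have "(Ide C X \<rhd>\<^sub>a (Assoc M ?U ?W N \<cdot> (?m \<rhd>\<^sub>a Ide M N))) \<cdot> Assoc M X (B ?UW) N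
      = (Ide C X \<rhd>\<^sub>a Assoc M ?U ?W N) \<cdot> Assoc M X (?U \<otimes>\<^sub>C ?W) N \<cdot> t"
    unfolding t_def using assoc_nat[of "Ide C X" ?m "Ide M N"] by (simp add: act_ide_comp)
  then have "?r \<cdot> Assoc M X (B ?UW) N
      = (Ide C ?U \<rhd>\<^sub>a sw X W N) \<cdot> sw X U (?W \<rhd>\<^sub>o N) \<cdot> (Ide C X \<rhd>\<^sub>a Assoc M ?U ?W N) \<cdot> Assoc M X (?U \<otimes>\<^sub>C ?W) N \<cdot> t"
    by simp
  also have "\<dots> = ((Ide C ?U \<rhd>\<^sub>a sw X W N) \<cdot> sw X U (?W \<rhd>\<^sub>o N) \<cdot> (Ide C X \<rhd>\<^sub>a Assoc M ?U ?W N)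
      \<cdot> Assoc M X (?U \<otimes>\<^sub>C ?W) N) \<cdot> t" by simp
  finally show "?l \<cdot> Assoc M X (B ?UW) N = ?r \<cdot> Assoc M X (B ?UW) N"
    unfolding l swap_two[OF assms] t_def[symmetric] by simp
qed simp_all

end

text \<open>Module transformations from (Z |> -, \<open>swap\<close>) to (F, d). Unlike in
  \<open>act_trans\<close>, values outside \<open>Ob M\<close> are arbitrary, because counits of the
  ends are not normalised there.\<close>

definition module_trans ::
    "('k, 'v, 'w) brcat \<Rightarrow> ('v, 'w, ('o, 'a) cob, ('o, 'a) carr) monfunc
      \<Rightarrow> ('k, 'o, 'a, 'm) moncat_scheme \<Rightarrow> ('k, 'o, 'a, 'mo, 'ma) modcat
      \<Rightarrow> ('mo, 'ma, 'mo, 'ma) func \<Rightarrow> ('v \<Rightarrow> 'mo \<Rightarrow> 'ma) \<Rightarrow> 'o \<Rightarrow> ('mo \<Rightarrow> 'ma) \<Rightarrow> bool" where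
  "module_trans V G C M F d Z z \<longleftrightarrow>
     (\<forall>N\<in>Ob M. z N \<in> Hom M (Z \<rhd>\<^sub>o\<^bsub>M\<^esub> N) (FO F N)) \<and>
     (\<forall>f\<in>Arr M. z (Cod M f) \<cdot>\<^bsub>M\<^esub> (Ide C Z \<rhd>\<^sub>a\<^bsub>M\<^esub> f) = FA F f \<cdot>\<^bsub>M\<^esub> z (Dom M f)) \<and>
     (\<forall>W\<in>Ob V. \<forall>N\<in>Ob M. d W N \<cdot>\<^bsub>M\<^esub> z (fst (FO G W) \<rhd>\<^sub>o\<^bsub>M\<^esub> N)
        = (Ide C (fst (FO G W)) \<rhd>\<^sub>a\<^bsub>M\<^esub> z N) \<cdot>\<^bsub>M\<^esub> swap G C M Z W N)"

context central_action
begin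

abbreviation "RM \<equiv> restrict_module G C M"
abbreviation "mend \<equiv> module_endofunctor K V RM"
abbreviation "mtrans \<equiv> module_trans V G C M"

lemma rho_module_endofunctor:
  assumes [simp]: "X \<in> Ob C"
  shows "mend (rho C M X) (sw X)"
proof -
  have "right_exact K M M (rho C M X)" using act_exact_right[of X] by (simp add: rho_def)
  then show ?thesis
    using swap_natural[of "Ide C X"] swap_mult[of X] swap_unit[of X]
    by (simp add: module_endofunctor_def rho_def Hom_def del: comp_assoc_arr)
qed

text \<open>Serves \<open>lact_str\<close> and \<open>ract_str\<close>, whose values are known only
  at objects of V and M.\<close>

lemma module_endofunctor_cong:
  assumes "mend F d" "\<And>W N. W \<in> Ob V \<Longrightarrow> N \<in> Ob M \<Longrightarrow> d' W N = d W N"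
  shows "mend F d'"
  using assms unfolding module_endofunctor_def by (simp add: right_exact_def linear_functor_def is_functor_def)

lemma id_module_endofunctor: "mend id_func (id_str RM)"
  by (auto simp: module_endofunctor_def id_func_def id_str_def right_exact_def linear_functor_def
    is_functor_def Hom_def)

lemma lact_id [simp]: "lact C M X id_func = rho C M X"
  and ract_id [simp]: "ract C M id_func X = rho C M X"
  by (simp_all add: lact_def ract_def rho_def id_func_def)

text \<open>Equality with \<open>swap\<close> at objects does not make the functions equal, so a
  choice \<open>R\<close> of ends may treat the structures differently.\<close>

lemma lact_str_id [simp]:
  "X \<in> Ob C \<Longrightarrow> W \<in> Ob V \<Longrightarrow> N \<in> Ob M \<Longrightarrow> lact_str G C M X id_func (id_str RM) W N = sw X W N"
  by (simp add: lact_str_def id_func_def id_str_def)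

lemma ract_str_id [simp]:
  "X \<in> Ob C \<Longrightarrow> W \<in> Ob V \<Longrightarrow> N \<in> Ob M \<Longrightarrow> ract_str G C M id_func (id_str RM) X W N = sw X W N"
  by (simp add: ract_str_def id_func_def id_str_def)

lemma module_trans_cong:
  assumes "\<And>W N. W \<in> Ob V \<Longrightarrow> N \<in> Ob M \<Longrightarrow> d' W N = d W N"
  shows "mtrans F d' Z z \<longleftrightarrow> mtrans F d Z z"
  using assms by (simp add: module_trans_def)

lemma module_endofunctor_simps:
  assumes "mend F d"
  shows "N \<in> Ob M \<Longrightarrow> FO F N \<in> Ob M"
    "f \<in> Arr M \<Longrightarrow> FA F f \<in> Arr M" "f \<in> Arr M \<Longrightarrow> Dom M (FA F f) = FO F (Dom M f)"
    "f \<in> Arr M \<Longrightarrow> Cod M (FA F f) = FO F (Cod M f)"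
    "N \<in> Ob M \<Longrightarrow> FA F (Ide M N) = Ide M (FO F N)"
    "W \<in> Ob V \<Longrightarrow> N \<in> Ob M \<Longrightarrow> d W N \<in> Arr M"
    "W \<in> Ob V \<Longrightarrow> N \<in> Ob M \<Longrightarrow> Dom M (d W N) = FO F (B W \<rhd>\<^sub>o N)"
    "W \<in> Ob V \<Longrightarrow> N \<in> Ob M \<Longrightarrow> Cod M (d W N) = B W \<rhd>\<^sub>o FO F N"
  using assms unfolding module_endofunctor_def right_exact_def linear_functor_def is_functor_def
  by (auto simp: Hom_def)

lemma module_endofunctor_comp:
  assumes "mend F d" "f \<in> Arr M" "g \<in> Arr M" "Dom M g = Cod M f"
  shows "FA F (g \<cdot> f) = FA F g \<cdot> FA F f"
  using assms in_hom[of f] in_hom[of g]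
  unfolding module_endofunctor_def right_exact_def linear_functor_def is_functor_def
  by simp metis

end

section \<open>The universal property of the relative ends\<close>

locale relative_ends = central_action K V C M G
  for K :: "('k, 'r) ring_scheme" and V :: "('k, 'v, 'w) brcat"
    and C :: "('k, 'o, 'a) moncat" and M :: "('k, 'o, 'a, 'mo, 'ma) modcat" (structure)
    and G :: "('v, 'w, ('o, 'a) cob, ('o, 'a) carr) monfunc" +
  fixes D :: "('v, 'w) duality" and H :: "('o, 'a, 'mo, 'ma) ihom" and R :: "('v, 'o, 'a, 'mo, 'ma) ends"
  assumes duality: "left_duality V D"
    and ihoms: "internal_homs C M H"
    and ends: "rhobar_ends K V D G C M H R"
begin

abbreviation evl :: "'v \<Rightarrow> 'mo \<Rightarrow> 'ma" where "evl \<equiv> eval_act D RM"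
abbreviation Bd :: "'v \<Rightarrow> 'o" where "Bd W \<equiv> B (Dual D W)"
abbreviation ev :: "'v \<Rightarrow> 'a" where "ev W \<equiv> inv_arr C gu \<bullet> Gm (Ev D W) \<bullet> mu (Dual D W) W"

section \<open>Evaluations acting on M\<close>

lemma dual_simps [simp]:
  assumes "W \<in> Ob V"
  shows "Dual D W \<in> Ob V" "Ev D W \<in> Arr V" "Dom V (Ev D W) = Dual D W \<otimes>\<^sub>o\<^bsub>V\<^esub> W" "Cod V (Ev D W) = Unit V"
  using duality assms by (auto simp: left_duality_def left_dual_def Hom_def)

text \<open>The evaluation in the restricted module is the action of the evaluation from
  \<open>G_left_dual\<close>. This is the identification of G of a dual with the dual of G, with all
  structure isomorphisms in place.\<close>

lemma evl_eq:
  assumes [simp]: "W \<in> Ob V" "N \<in> Ob M"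
  shows "evl W N = LUnit M N \<cdot> (ev W \<rhd>\<^sub>a Ide M N) \<cdot> inv_arr M (Assoc M (Bd W) (B W) N)"
proof -
  have "inv_arr M (Assoc M (Bd W) (B W) N \<cdot> (inv_arr C (mu (Dual D W) W) \<rhd>\<^sub>a Ide M N))
      = (mu (Dual D W) W \<rhd>\<^sub>a Ide M N) \<cdot> inv_arr M (Assoc M (Bd W) (B W) N)"
    by (simp add: inv_arr_comp inv_arr_act)
  then show ?thesis by (simp add: eval_act_def act_comp_ide)
qed

lemma evl_simps [simp]:
  assumes "W \<in> Ob V" "N \<in> Ob M"
  shows "evl W N \<in> Arr M" "Dom M (evl W N) = Bd W \<rhd>\<^sub>o B W \<rhd>\<^sub>o N" "Cod M (evl W N) = N"
  using assms by (simp_all add: evl_eq)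

lemma evl_natural:
  assumes [simp]: "W \<in> Ob V" "g \<in> Arr M"
  shows "evl W (Cod M g) \<cdot> (Ide C (Bd W) \<rhd>\<^sub>a Ide C (B W) \<rhd>\<^sub>a g) = g \<cdot> evl W (Dom M g)"
proof -
  define e where "e = ev W"
  have [simp]: "e \<in> Arr C" "Dom C e = Bd W \<otimes>\<^sub>C B W" "Cod C e = Unit C" by (simp_all add: e_def)
  let ?N = "Dom M g" and ?N' = "Cod M g" and ?BB = "Bd W \<otimes>\<^sub>C B W"
  have 1: "inv_arr M (Assoc M (Bd W) (B W) ?N') \<cdot> (Ide C (Bd W) \<rhd>\<^sub>a Ide C (B W) \<rhd>\<^sub>a g)
      = (Ide C ?BB \<rhd>\<^sub>a g) \<cdot> inv_arr M (Assoc M (Bd W) (B W) ?N)"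
    by (rule iso_cancel_left[of "Assoc M (Bd W) (B W) ?N'"])
      (use comp_tail[OF assoc_nat[symmetric, of "Ide C (Bd W)" "Ide C (B W)" g]] in simp_all)
  have "evl W ?N' \<cdot> (Ide C (Bd W) \<rhd>\<^sub>a Ide C (B W) \<rhd>\<^sub>a g)
      = LUnit M ?N' \<cdot> (e \<rhd>\<^sub>a Ide M ?N') \<cdot> (Ide C ?BB \<rhd>\<^sub>a g) \<cdot> inv_arr M (Assoc M (Bd W) (B W) ?N)"
    by (simp add: evl_eq e_def[symmetric] 1)
  also have "\<dots> = LUnit M ?N' \<cdot> (Ide C (Unit C) \<rhd>\<^sub>a g) \<cdot> (e \<rhd>\<^sub>a Ide M ?N) \<cdot> inv_arr M (Assoc M (Bd W) (B W) ?N)"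
    by (simp add: act_interchange_tail)
  also have "\<dots> = g \<cdot> evl W ?N"
    using comp_tail[OF lunit_nat[of g], of "(e \<rhd>\<^sub>a Ide M ?N) \<cdot> inv_arr M (Assoc M (Bd W) (B W) ?N)"]
      comp_tail[OF lunit_nat[of g, symmetric], of "(e \<rhd>\<^sub>a Ide M ?N) \<cdot> inv_arr M (Assoc M (Bd W) (B W) ?N)"]
    by (simp add: evl_eq e_def[symmetric])
  finally show ?thesis .
qed

text \<open>Composition with the evaluation is transposition along a duality in C, hence injective
  by \<open>dual_mate_inj\<close>.\<close>

lemma evl_cancel:
  assumes [simp]: "W \<in> Ob V" "N \<in> Ob M" and f: "f \<in> Arr M" "Cod M f = B W \<rhd>\<^sub>o N"
    and g: "g \<in> Arr M" "Cod M g = B W \<rhd>\<^sub>o N" "Dom M f = Dom M g"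
    and eq: "evl W N \<cdot> (Ide C (Bd W) \<rhd>\<^sub>a f) = evl W N \<cdot> (Ide C (Bd W) \<rhd>\<^sub>a g)"
  shows "f = g"
proof -
  obtain c where "left_dual V W (Dual D W) (Ev D W) c"
    using duality \<open>W \<in> Ob V\<close> unfolding left_duality_def by blast
  note dual = G_left_dual[OF this]
  show ?thesis
    using dual_mate_inj[OF _ _ _ dual(1) dual(2) dual(3) f g] eq by (simp only: evl_eq assms B_ob dual_simps)
qed

text \<open>A module functor is compatible with evaluations, by its axioms for \<open>W\<^sup>* \<otimes> W\<close>, for the arrow
  \<open>ev\<close> and for the unit.\<close>

lemma evl_module_endofunctor:
  assumes F: "mend F d" and [simp]: "W \<in> Ob V" "N \<in> Ob M"
  shows "evl W (FO F N) \<cdot> (Ide C (Bd W) \<rhd>\<^sub>a d W N) \<cdot> d (Dual D W) (B W \<rhd>\<^sub>o N) = FA F (evl W N)"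
proof -
  note [simp] = module_endofunctor_simps[OF F]
  let ?W' = "Dual D W" and ?FN = "FO F N"
  define a where "a = (\<lambda>N. Assoc RM ?W' W N)"
  define l where "l = (\<lambda>N. LUnit RM N)"
  have a [simp]: "a N \<in> Arr M" "Dom M (a N) = B (?W' \<otimes>\<^sub>o\<^bsub>V\<^esub> W) \<rhd>\<^sub>o N" "Cod M (a N) = Bd W \<rhd>\<^sub>o B W \<rhd>\<^sub>o N" "is_iso M (a N)"
    if "N \<in> Ob M" for N using that by (simp_all add: a_def)
  have l [simp]: "l N \<in> Arr M" "Dom M (l N) = B (Unit V) \<rhd>\<^sub>o N" "Cod M (l N) = N"
    if "N \<in> Ob M" for N using that by (simp_all add: l_def)
  define g where "g = Gm (Ev D W)"
  have [simp]: "g \<in> Arr C" "Dom C g = B (?W' \<otimes>\<^sub>o\<^bsub>V\<^esub> W)" "Cod C g = B (Unit V)" by (simp_all add: g_def)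
  have evl: "evl W N = l N \<cdot> (g \<rhd>\<^sub>a Ide M N) \<cdot> inv_arr M (a N)" for N
    by (simp only: eval_act_def a_def l_def g_def restrict_module_sel(5,6,11) restrict_module_iso)
  have mult: "a ?FN \<cdot> d (?W' \<otimes>\<^sub>o\<^bsub>V\<^esub> W) N = (Ide C (Bd W) \<rhd>\<^sub>a d W N) \<cdot> d ?W' (B W \<rhd>\<^sub>o N) \<cdot> FA F (a N)"
  proof -
    have "Assoc RM ?W' W ?FN \<cdot>\<^bsub>RM\<^esub> d (?W' \<otimes>\<^sub>o\<^bsub>V\<^esub> W) N
      = (Ide V ?W' \<rhd>\<^sub>a\<^bsub>RM\<^esub> d W N) \<cdot>\<^bsub>RM\<^esub> d ?W' (W \<rhd>\<^sub>o\<^bsub>RM\<^esub> N) \<cdot>\<^bsub>RM\<^esub> FA F (Assoc RM ?W' W N)"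
      using F assms(2,3) unfolding module_endofunctor_def by simp
    then show ?thesis unfolding a_def by (simp del: restrict_module_sel(12))
  qed
  have nat: "d (Unit V) N \<cdot> FA F (g \<rhd>\<^sub>a Ide M N) = (g \<rhd>\<^sub>a Ide M ?FN) \<cdot> d (?W' \<otimes>\<^sub>o\<^bsub>V\<^esub> W) N"
  proof -
    have "\<forall>w\<in>Arr V. \<forall>f\<in>Arr M. d (Cod V w) (Cod M f) \<cdot> FA F (Gm w \<rhd>\<^sub>a f)
        = (Gm w \<rhd>\<^sub>a FA F f) \<cdot> d (Dom V w) (Dom M f)"
      using F unfolding module_endofunctor_def by simp
    from this[rule_format, of "Ev D W" "Ide M N"] show ?thesis by (simp add: g_def)
  qed
  have unit: "l ?FN \<cdot> d (Unit V) N = FA F (l N)"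
    using F assms(2,3) unfolding module_endofunctor_def l_def by simp
  define x where "x = FA F (inv_arr M (a N))"
  have [simp]: "x \<in> Arr M" "Dom M x = FO F (Bd W \<rhd>\<^sub>o B W \<rhd>\<^sub>o N)" "Cod M x = FO F (B (?W' \<otimes>\<^sub>o\<^bsub>V\<^esub> W) \<rhd>\<^sub>o N)"
    by (simp_all add: x_def)
  have ax: "FA F (a N) \<cdot> x = Ide M (FO F (Bd W \<rhd>\<^sub>o B W \<rhd>\<^sub>o N))"
    unfolding x_def using module_endofunctor_comp[OF F, of "inv_arr M (a N)" "a N"] by simp
  have "FA F (evl W N) = FA F (l N) \<cdot> FA F (g \<rhd>\<^sub>a Ide M N) \<cdot> x"
    unfolding evl x_def by (simp add: module_endofunctor_comp[OF F])
  also have "\<dots> = l ?FN \<cdot> (d (Unit V) N \<cdot> FA F (g \<rhd>\<^sub>a Ide M N)) \<cdot> x" by (simp add: unit[symmetric])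
  also have "\<dots> = l ?FN \<cdot> (g \<rhd>\<^sub>a Ide M ?FN) \<cdot> d (?W' \<otimes>\<^sub>o\<^bsub>V\<^esub> W) N \<cdot> x" unfolding nat by simp
  \<comment> \<open>An associativity isomorphism at F N and its inverse are inserted to bring
    \<open>mult\<close> into play.\<close>
  also have "d (?W' \<otimes>\<^sub>o\<^bsub>V\<^esub> W) N \<cdot> x = inv_arr M (a ?FN) \<cdot> (a ?FN \<cdot> d (?W' \<otimes>\<^sub>o\<^bsub>V\<^esub> W) N) \<cdot> x" by simp
  also have "(a ?FN \<cdot> d (?W' \<otimes>\<^sub>o\<^bsub>V\<^esub> W) N) \<cdot> x = (Ide C (Bd W) \<rhd>\<^sub>a d W N) \<cdot> d ?W' (B W \<rhd>\<^sub>o N)"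
    unfolding mult by (simp add: ax)
  also have "l ?FN \<cdot> (g \<rhd>\<^sub>a Ide M ?FN) \<cdot> inv_arr M (a ?FN) \<cdot> (Ide C (Bd W) \<rhd>\<^sub>a d W N) \<cdot> d ?W' (B W \<rhd>\<^sub>o N)
      = evl W ?FN \<cdot> (Ide C (Bd W) \<rhd>\<^sub>a d W N) \<cdot> d ?W' (B W \<rhd>\<^sub>o N)"
    unfolding evl by simp
  finally show ?thesis ..
qed

text \<open>Balancing is compatibility with V, transposed along the duality of W. Both sides of the
  balancing equation are evaluations composed with the same invertible \<open>?s\<close>, so
  cancelling \<open>?s\<close> and then the evaluation gives the module condition.\<close>

lemma balanced_iff_module:
  assumes F: "mend F d" and [simp]: "Z \<in> Ob C" "W \<in> Ob V" "N \<in> Ob M"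
    and z: "\<And>N. N \<in> Ob M \<Longrightarrow> z N \<in> Hom M (Z \<rhd>\<^sub>o N) (FO F N)"
  shows "z N \<cdot> (Ide C Z \<rhd>\<^sub>a evl W N) = gamma D G C M F d Z W (B W \<rhd>\<^sub>o N) N (z (B W \<rhd>\<^sub>o N))
    \<longleftrightarrow> d W N \<cdot> z (B W \<rhd>\<^sub>o N) = (Ide C (B W) \<rhd>\<^sub>a z N) \<cdot> sw Z W N"
proof -
  note [simp] = module_endofunctor_simps[OF F]
  have [simp]: "z N \<in> Arr M" "Dom M (z N) = Z \<rhd>\<^sub>o N" "Cod M (z N) = FO F N" if "N \<in> Ob M" for N
    using z[OF that] by (auto simp: Hom_def)
  let ?s = "sw Z (Dual D W) (B W \<rhd>\<^sub>o N)" and ?I = "Ide C (Bd W)"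
  \<comment> \<open>The functor Z |> - is itself a module functor, so its compatibility with
    evaluations expands the left-hand side.\<close>
  have "z N \<cdot> (Ide C Z \<rhd>\<^sub>a evl W N) = z N \<cdot> evl W (Z \<rhd>\<^sub>o N) \<cdot> (?I \<rhd>\<^sub>a sw Z W N) \<cdot> ?s"
    using evl_module_endofunctor[OF rho_module_endofunctor[of Z], of W N] by (simp add: rho_def)
  also have "\<dots> = evl W (FO F N) \<cdot> (?I \<rhd>\<^sub>a Ide C (B W) \<rhd>\<^sub>a z N) \<cdot> (?I \<rhd>\<^sub>a sw Z W N) \<cdot> ?s"
    using comp_tail[OF evl_natural[symmetric, of W "z N"], of "(?I \<rhd>\<^sub>a sw Z W N) \<cdot> ?s"] by simp
  also have "\<dots> = (evl W (FO F N) \<cdot> (?I \<rhd>\<^sub>a ((Ide C (B W) \<rhd>\<^sub>a z N) \<cdot> sw Z W N))) \<cdot> ?s"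
    by (simp add: act_interchange_tail)
  finally have l: "z N \<cdot> (Ide C Z \<rhd>\<^sub>a evl W N) = (evl W (FO F N) \<cdot> (?I \<rhd>\<^sub>a ((Ide C (B W) \<rhd>\<^sub>a z N) \<cdot> sw Z W N))) \<cdot> ?s" .
  have r: "gamma D G C M F d Z W (B W \<rhd>\<^sub>o N) N (z (B W \<rhd>\<^sub>o N))
      = (evl W (FO F N) \<cdot> (?I \<rhd>\<^sub>a (d W N \<cdot> z (B W \<rhd>\<^sub>o N)))) \<cdot> ?s"
    by (simp add: gamma_def)
  show ?thesis
  proof
    assume "z N \<cdot> (Ide C Z \<rhd>\<^sub>a evl W N) = gamma D G C M F d Z W (B W \<rhd>\<^sub>o N) N (z (B W \<rhd>\<^sub>o N))"
    then have "evl W (FO F N) \<cdot> (?I \<rhd>\<^sub>a (d W N \<cdot> z (B W \<rhd>\<^sub>o N)))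
        = evl W (FO F N) \<cdot> (?I \<rhd>\<^sub>a ((Ide C (B W) \<rhd>\<^sub>a z N) \<cdot> sw Z W N))"
      unfolding l r by (rule iso_cancel_right[rotated, OF sym]) simp_all
    then show "d W N \<cdot> z (B W \<rhd>\<^sub>o N) = (Ide C (B W) \<rhd>\<^sub>a z N) \<cdot> sw Z W N"
      by (rule evl_cancel[rotated -1]) simp_all
  qed (simp add: l r)
qed

section \<open>Transposition along the internal Homs\<close>

lemma ihom_ob [simp]: "N \<in> Ob M \<Longrightarrow> N' \<in> Ob M \<Longrightarrow> IHom H N N' \<in> Ob C"
  using ihoms by (simp add: internal_homs_def)

lemma Phi_bij:
  "X \<in> Ob C \<Longrightarrow> N \<in> Ob M \<Longrightarrow> N' \<in> Ob M
    \<Longrightarrow> bij_betw (Phi H X N N') (Hom C X (IHom H N N')) (Hom M (X \<rhd>\<^sub>o N) N')"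
  using ihoms by (simp add: internal_homs_def)

lemma Phi_comp:
  assumes "N \<in> Ob M" "N' \<in> Ob M" "g \<in> Hom C X Y" "f \<in> Hom C Y (IHom H N N')"
  shows "Phi H X N N' (f \<bullet> g) = Phi H Y N N' f \<cdot> (g \<rhd>\<^sub>a Ide M N)"
  using ihoms assms unfolding internal_homs_def by blast

lemma Phi_hom:
  assumes "N \<in> Ob M" "N' \<in> Ob M" "f \<in> Hom C X (IHom H N N')"
  shows "Phi H X N N' f \<in> Hom M (X \<rhd>\<^sub>o N) N'"
proof -
  have "X \<in> Ob C" using assms(3) C.dom_ob by (auto simp: Hom_def)
  then show ?thesis using Phi_bij assms bij_betwE by blast
qed

lemma Phi_inj:
  assumes "N \<in> Ob M" "N' \<in> Ob M" "f \<in> Hom C X (IHom H N N')" "g \<in> Hom C X (IHom H N N')"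
    "Phi H X N N' f = Phi H X N N' g"
  shows "f = g"
proof -
  have "X \<in> Ob C" using assms(3) C.dom_ob by (auto simp: Hom_def)
  then show ?thesis using Phi_bij[of X N N'] assms by (auto simp: bij_betw_def dest: inj_onD)
qed

lemma phi_inv:
  assumes "X \<in> Ob C" "N \<in> Ob M" "N' \<in> Ob M" "z \<in> Hom M (X \<rhd>\<^sub>o N) N'"
  shows "phi_inv C H X N N' z \<in> Hom C X (IHom H N N')" "Phi H X N N' (phi_inv C H X N N' z) = z"
  using Phi_bij[OF assms(1-3)] assms(4) unfolding phi_inv_def bij_betw_def
  by (auto simp: the_inv_into_into f_the_inv_into_f)

lemma ihom_ev_hom:
  assumes "N \<in> Ob M" "N' \<in> Ob M"
  shows "ihom_ev C H N N' \<in> Hom M (IHom H N N' \<rhd>\<^sub>o N) N'"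
  unfolding ihom_ev_def using assms by (intro Phi_hom) (auto intro: C.ide_hom)

lemma Phi_eq_ev:
  assumes "N \<in> Ob M" "N' \<in> Ob M" "f \<in> Hom C X (IHom H N N')"
  shows "Phi H X N N' f = ihom_ev C H N N' \<cdot> (f \<rhd>\<^sub>a Ide M N)"
  using Phi_comp[OF assms(1,2,3) C.ide_hom] assms C.comp_ide_left unfolding ihom_ev_def by simp

text \<open>By naturality of \<open>Phi\<close> the functoriality of the internal Hom becomes
  composition in M. This is how dinaturality of projections turns into naturality of
  transposes.\<close>

lemma ihom_map:
  assumes f: "f \<in> Hom M N' N" and g: "g \<in> Hom M Q Q'" and p: "p \<in> Hom C Z (IHom H N Q)"
  shows "ihom_map C M H f g \<bullet> p \<in> Hom C Z (IHom H N' Q')"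
    and "Phi H Z N' Q' (ihom_map C M H f g \<bullet> p) = g \<cdot> Phi H Z N Q p \<cdot> (Ide C Z \<rhd>\<^sub>a f)"
proof -
  let ?E = "IHom H N Q"
  have [simp]: "f \<in> Arr M" "Dom M f = N'" "Cod M f = N" "g \<in> Arr M" "Dom M g = Q" "Cod M g = Q'"
    "p \<in> Arr C" "Dom C p = Z" "Cod C p = ?E" using f g p by (auto simp: Hom_def)
  have [simp]: "N \<in> Ob M" "N' \<in> Ob M" "Q \<in> Ob M" "Q' \<in> Ob M" "Z \<in> Ob C"
    using dom_ob[of f] cod_ob[of f] dom_ob[of g] cod_ob[of g] C.dom_ob[of p] by simp_all
  have [simp]: "ihom_ev C H N Q \<in> Arr M" "Dom M (ihom_ev C H N Q) = ?E \<rhd>\<^sub>o N" "Cod M (ihom_ev C H N Q) = Q"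
    using ihom_ev_hom[of N Q] by (auto simp: Hom_def)
  let ?z = "g \<cdot> ihom_ev C H N Q \<cdot> (Ide C ?E \<rhd>\<^sub>a f)"
  have m: "ihom_map C M H f g = phi_inv C H ?E N' Q' ?z" by (simp add: ihom_map_def Let_def)
  have z: "?z \<in> Hom M (?E \<rhd>\<^sub>o N') Q'" by (simp add: Hom_def)
  have mh: "ihom_map C M H f g \<in> Hom C ?E (IHom H N' Q')" "Phi H ?E N' Q' (ihom_map C M H f g) = ?z"
    unfolding m using phi_inv[OF _ _ _ z] by simp_all
  show "ihom_map C M H f g \<bullet> p \<in> Hom C Z (IHom H N' Q')" using mh(1) p C.comp_hom by blast
  have "Phi H Z N' Q' (ihom_map C M H f g \<bullet> p) = ?z \<cdot> (p \<rhd>\<^sub>a Ide M N')"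
    using Phi_comp[OF _ _ p mh(1)] mh(2) by simp
  also have "\<dots> = g \<cdot> ihom_ev C H N Q \<cdot> (p \<rhd>\<^sub>a Ide M N) \<cdot> (Ide C Z \<rhd>\<^sub>a f)"
    by (simp add: act_interchange)
  also have "\<dots> = g \<cdot> Phi H Z N Q p \<cdot> (Ide C Z \<rhd>\<^sub>a f)" using Phi_eq_ev[OF _ _ p] by simp
  finally show "Phi H Z N' Q' (ihom_map C M H f g \<bullet> p) = g \<cdot> Phi H Z N Q p \<cdot> (Ide C Z \<rhd>\<^sub>a f)" .
qed

text \<open>A Yoneda argument: \<open>beta\<close> is defined by its effect on the identity of
  \<open>?E\<close>, and since \<open>gamma\<close> is natural in its object of C by
  \<open>swap_natural\<close>, the same formula holds for every p.\<close>

lemma beta: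
  assumes F: "mend F d" and [simp]: "W \<in> Ob V" "N \<in> Ob M" "N' \<in> Ob M"
    and p: "p \<in> Hom C Z (IHom H N (FO F (B W \<rhd>\<^sub>o N')))"
  shows "beta D G C M H F d W N N' \<bullet> p \<in> Hom C Z (IHom H (Bd W \<rhd>\<^sub>o N) (FO F N'))"
    and "Phi H Z (Bd W \<rhd>\<^sub>o N) (FO F N') (beta D G C M H F d W N N' \<bullet> p)
      = gamma D G C M F d Z W N N' (Phi H Z N (FO F (B W \<rhd>\<^sub>o N')) p)"
proof -
  note [simp] = module_endofunctor_simps[OF F]
  let ?Q = "FO F (B W \<rhd>\<^sub>o N')" let ?E = "IHom H N ?Q" and ?I = "Ide C (Bd W)"
  have [simp]: "p \<in> Arr C" "Dom C p = Z" "Cod C p = ?E" using p by (auto simp: Hom_def)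
  have [simp]: "Z \<in> Ob C" using C.dom_ob[of p] by simp
  have [simp]: "ihom_ev C H N ?Q \<in> Arr M" "Dom M (ihom_ev C H N ?Q) = ?E \<rhd>\<^sub>o N" "Cod M (ihom_ev C H N ?Q) = ?Q"
    using ihom_ev_hom[of N ?Q] by (auto simp: Hom_def)
  let ?z = "gamma D G C M F d ?E W N N' (ihom_ev C H N ?Q)"
  have z: "?z \<in> Hom M (?E \<rhd>\<^sub>o Bd W \<rhd>\<^sub>o N) (FO F N')" by (simp add: gamma_def Hom_def)
  have b: "beta D G C M H F d W N N' = phi_inv C H ?E (Bd W \<rhd>\<^sub>o N) (FO F N') ?z" by (simp add: beta_def Let_def)
  have bh: "beta D G C M H F d W N N' \<in> Hom C ?E (IHom H (Bd W \<rhd>\<^sub>o N) (FO F N'))"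
    "Phi H ?E (Bd W \<rhd>\<^sub>o N) (FO F N') (beta D G C M H F d W N N') = ?z"
    unfolding b using phi_inv[OF _ _ _ z] by simp_all
  show "beta D G C M H F d W N N' \<bullet> p \<in> Hom C Z (IHom H (Bd W \<rhd>\<^sub>o N) (FO F N'))"
    using bh(1) p C.comp_hom by blast
  have "Phi H Z (Bd W \<rhd>\<^sub>o N) (FO F N') (beta D G C M H F d W N N' \<bullet> p) = ?z \<cdot> (p \<rhd>\<^sub>a Ide M (Bd W \<rhd>\<^sub>o N))"
    using Phi_comp[OF _ _ p bh(1)] bh(2) by simp
  also have "\<dots> = evl W (FO F N') \<cdot> (?I \<rhd>\<^sub>a (d W N' \<cdot> ihom_ev C H N ?Q)) \<cdot> (?I \<rhd>\<^sub>a p \<rhd>\<^sub>a Ide M N) \<cdot> sw Z (Dual D W) N"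
    using swap_natural[of p "Ide V (Dual D W)" "Ide M N"] by (simp add: gamma_def)
  also have "\<dots> = gamma D G C M F d Z W N N' (Phi H Z N ?Q p)"
    using Phi_eq_ev[OF _ _ p] by (simp add: gamma_def act_interchange_tail)
  finally show "Phi H Z (Bd W \<rhd>\<^sub>o N) (FO F N') (beta D G C M H F d W N N' \<bullet> p)
      = gamma D G C M F d Z W N N' (Phi H Z N ?Q p)" .
qed

abbreviation "bdin F d \<equiv> balanced_dinatural V D RM C
   (\<lambda>N N'. IHom H N (FO F N')) (\<lambda>f g. ihom_map C M H f (FA F g)) (beta D G C M H F d)"

text \<open>Since \<open>Phi\<close> is injective, each equation of the relative end may be
  transposed. Dinaturality becomes naturality, and balancing becomes the module condition by
  \<open>balanced_iff_module\<close>.\<close>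

lemma balanced_dinatural_iff:
  assumes F: "mend F d" and [simp]: "Z \<in> Ob C"
    and p: "\<And>N. N \<in> Ob M \<Longrightarrow> p N \<in> Hom C Z (IHom H N (FO F N))"
    and z: "\<And>N. N \<in> Ob M \<Longrightarrow> z N = Phi H Z N (FO F N) (p N)"
  shows "bdin F d Z p \<longleftrightarrow> mtrans F d Z z"
proof -
  note [simp] = module_endofunctor_simps[OF F]
  have zh: "z N \<in> Hom M (Z \<rhd>\<^sub>o N) (FO F N)" if "N \<in> Ob M" for N
    using z[OF that] Phi_hom[OF _ _ p[OF that]] that by simp
  have [simp]: "z N \<in> Arr M" "Dom M (z N) = Z \<rhd>\<^sub>o N" "Cod M (z N) = FO F N" if "N \<in> Ob M" for N
    using zh[OF that] by (auto simp: Hom_def)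
  have nat: "ihom_map C M H (Ide M X) (FA F f) \<bullet> p X = ihom_map C M H f (FA F (Ide M Y)) \<bullet> p Y
      \<longleftrightarrow> z Y \<cdot> (Ide C Z \<rhd>\<^sub>a f) = FA F f \<cdot> z X" (is "?l = ?r \<longleftrightarrow> _") if f: "f \<in> Hom M X Y" for f X Y
  proof -
    have [simp]: "f \<in> Arr M" "Dom M f = X" "Cod M f = Y" using f by (auto simp: Hom_def)
    have XY [simp]: "X \<in> Ob M" "Y \<in> Ob M" using dom_ob[of f] cod_ob[of f] by simp_all
    have "Ide M X \<in> Hom M X X" "FA F f \<in> Hom M (FO F X) (FO F Y)" "FA F (Ide M Y) \<in> Hom M (FO F Y) (FO F Y)"
      by (simp_all add: Hom_def)
    note l = ihom_map[OF this(1,2) p[OF XY(1)]] and r = ihom_map[OF f this(3) p[OF XY(2)]]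
    have "?l = ?r \<longleftrightarrow> FA F f \<cdot> z X \<cdot> (Ide C Z \<rhd>\<^sub>a Ide M X) = FA F (Ide M Y) \<cdot> z Y \<cdot> (Ide C Z \<rhd>\<^sub>a f)"
      using Phi_inj[OF _ _ l(1) r(1)] l(2) r(2) z by auto
    then show ?thesis by auto
  qed
  have bal: "ihom_map C M H (evl W X) (FA F (Ide M X)) \<bullet> p X
        = beta D G C M H F d W (B W \<rhd>\<^sub>o X) X \<bullet> p (B W \<rhd>\<^sub>o X)
      \<longleftrightarrow> d W X \<cdot> z (B W \<rhd>\<^sub>o X) = (Ide C (B W) \<rhd>\<^sub>a z X) \<cdot> sw Z W X" (is "?l = ?r \<longleftrightarrow> _")
    if [simp]: "W \<in> Ob V" and X [simp]: "X \<in> Ob M" for W X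
  proof -
    have "evl W X \<in> Hom M (Bd W \<rhd>\<^sub>o B W \<rhd>\<^sub>o X) X" "FA F (Ide M X) \<in> Hom M (FO F X) (FO F X)"
      by (simp_all add: Hom_def)
    note l = ihom_map[OF this p[OF X]]
    have BX: "B W \<rhd>\<^sub>o X \<in> Ob M" by simp
    note r = beta[OF F \<open>W \<in> Ob V\<close> BX X p[OF BX]]
    have "?l = ?r \<longleftrightarrow> FA F (Ide M X) \<cdot> z X \<cdot> (Ide C Z \<rhd>\<^sub>a evl W X)
        = gamma D G C M F d Z W (B W \<rhd>\<^sub>o X) X (z (B W \<rhd>\<^sub>o X))"
      using Phi_inj[OF _ _ l(1) r(1)] l(2) r(2) z by auto
    also have "FA F (Ide M X) \<cdot> z X \<cdot> (Ide C Z \<rhd>\<^sub>a evl W X) = z X \<cdot> (Ide C Z \<rhd>\<^sub>a evl W X)" by simp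
    finally show ?thesis using balanced_iff_module[OF F \<open>Z \<in> Ob C\<close> \<open>W \<in> Ob V\<close> X zh] by simp
  qed
  have "bdin F d Z p \<longleftrightarrow>
      (\<forall>X Y. \<forall>f\<in>Hom M X Y. z Y \<cdot> (Ide C Z \<rhd>\<^sub>a f) = FA F f \<cdot> z X) \<and>
      (\<forall>W\<in>Ob V. \<forall>X\<in>Ob M. d W X \<cdot> z (B W \<rhd>\<^sub>o X) = (Ide C (B W) \<rhd>\<^sub>a z X) \<cdot> sw Z W X)"
    unfolding balanced_dinatural_def using p nat bal by simp
  also have "(\<forall>X Y. \<forall>f\<in>Hom M X Y. z Y \<cdot> (Ide C Z \<rhd>\<^sub>a f) = FA F f \<cdot> z X)
      \<longleftrightarrow> (\<forall>f\<in>Arr M. z (Cod M f) \<cdot> (Ide C Z \<rhd>\<^sub>a f) = FA F f \<cdot> z (Dom M f))"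
    by (auto simp: Hom_def)
  finally show ?thesis unfolding module_trans_def using zh by blast
qed

abbreviation "cnt \<equiv> counit C M H R"

text \<open>The relative ends restated without internal Homs: the counit consists of the transposed
  projections, and it is universal among module transformations from Z |> - to F.\<close>

lemma
  assumes F: "mend F d"
  shows R_ob: "fst (R F d) \<in> Ob C"
    and R_proj: "N \<in> Ob M \<Longrightarrow> snd (R F d) N \<in> Hom C (fst (R F d)) (IHom H N (FO F N))"
    and counit_Phi: "N \<in> Ob M \<Longrightarrow> cnt F d N = Phi H (fst (R F d)) N (FO F N) (snd (R F d) N)"
    and counit_module_trans: "mtrans F d (fst (R F d)) (cnt F d)"
    and R_universal: "\<lbrakk>Z \<in> Ob C; mtrans F d Z z\<rbrakk>
      \<Longrightarrow> \<exists>!f. f \<in> Hom C Z (fst (R F d)) \<and> (\<forall>N\<in>Ob M. cnt F d N \<cdot> (f \<rhd>\<^sub>a Ide M N) = z N)"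
proof -
  note [simp] = module_endofunctor_simps[OF F]
  let ?A = "fst (R F d)" and ?p = "snd (R F d)"
  note re = ends[unfolded rhobar_ends_def, rule_format, OF F, unfolded relative_end_def]
  have end1: "bdin F d ?A ?p" by (rule re[THEN conjunct1])
  have end2: "\<exists>!u. u \<in> Hom C E' ?A \<and> (\<forall>X\<in>Ob M. ?p X \<bullet> u = p' X)" if "bdin F d E' p'" for E' p'
    using re[THEN conjunct2, rule_format, OF that] unfolding restrict_module_sel .
  show A [simp]: "?A \<in> Ob C"
    by (rule end1[unfolded balanced_dinatural_def, THEN conjunct1])
  show p: "?p N \<in> Hom C ?A (IHom H N (FO F N))" if "N \<in> Ob M" for N
    using end1[unfolded balanced_dinatural_def, THEN conjunct2, THEN conjunct1] that
    unfolding restrict_module_sel by (rule bspec)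
  show c: "cnt F d N = Phi H ?A N (FO F N) (?p N)" if "N \<in> Ob M" for N
    using Phi_eq_ev[OF that _ p[OF that]] that by (simp add: counit_def)
  show mt: "mtrans F d ?A (cnt F d)"
    using balanced_dinatural_iff[OF F A p c] end1 by blast
  assume Z [simp]: "Z \<in> Ob C" and z: "mtrans F d Z z"
  have zh: "z N \<in> Hom M (Z \<rhd>\<^sub>o N) (FO F N)" if "N \<in> Ob M" for N
    using z that by (simp add: module_trans_def)
  \<comment> \<open>The transpose of z, to which the universal property of the end is
    applied.\<close>
  define q where "q = (\<lambda>N. phi_inv C H Z N (FO F N) (z N))"
  have q: "q N \<in> Hom C Z (IHom H N (FO F N))" "z N = Phi H Z N (FO F N) (q N)" if "N \<in> Ob M" for N
    using phi_inv[OF _ _ _ zh] that by (simp_all add: q_def)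
  have "bdin F d Z q" using balanced_dinatural_iff[OF F Z q] z by blast
  then have ex: "\<exists>!u. u \<in> Hom C Z ?A \<and> (\<forall>X\<in>Ob M. ?p X \<bullet> u = q X)" by (rule end2)
  have iff: "(\<forall>N\<in>Ob M. cnt F d N \<cdot> (u \<rhd>\<^sub>a Ide M N) = z N) \<longleftrightarrow> (\<forall>X\<in>Ob M. ?p X \<bullet> u = q X)"
    if u: "u \<in> Hom C Z ?A" for u
  proof (rule ball_cong[OF refl])
    fix N assume N: "N \<in> Ob M"
    have "cnt F d N \<cdot> (u \<rhd>\<^sub>a Ide M N) = Phi H Z N (FO F N) (?p N \<bullet> u)"
      using Phi_comp[OF N _ u p[OF N]] c[OF N] N by simp
    then show "cnt F d N \<cdot> (u \<rhd>\<^sub>a Ide M N) = z N \<longleftrightarrow> ?p N \<bullet> u = q N"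
      using Phi_inj[OF N _ C.comp_hom[OF u p[OF N]] q(1)[OF N]] q(2)[OF N] N by auto
  qed
  show "\<exists>!f. f \<in> Hom C Z ?A \<and> (\<forall>N\<in>Ob M. cnt F d N \<cdot> (f \<rhd>\<^sub>a Ide M N) = z N)"
    using ex iff by (simp cong: conj_cong)
qed

end

section \<open>The adjoint algebra\<close>

context relative_ends
begin

section \<open>Unit of the adjunction and right adjoint on arrows\<close>

lemma module_trans_simps:
  assumes "mtrans F d Z z" "N \<in> Ob M"
  shows "z N \<in> Arr M" "Dom M (z N) = Z \<rhd>\<^sub>o N" "Cod M (z N) = FO F N"
  using assms by (auto simp: module_trans_def Hom_def)

lemma rho_sel [simp]: "FO (rho C M X) N = X \<rhd>\<^sub>o N" "FA (rho C M X) f = Ide C X \<rhd>\<^sub>a f"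
  by (simp_all add: rho_def)

text \<open>The universal property at the identity transformation of X |> - shows that the definite
  description in \<open>unit\<close> denotes.\<close>

lemma unit:
  assumes [simp]: "X \<in> Ob C"
  shows "unit G C M H R X \<in> Hom C X (fst (R (rho C M X) (sw X)))"
    and "N \<in> Ob M \<Longrightarrow> cnt (rho C M X) (sw X) N \<cdot> (unit G C M H R X \<rhd>\<^sub>a Ide M N) = Ide M (X \<rhd>\<^sub>o N)"
proof -
  have "mtrans (rho C M X) (sw X) X (\<lambda>N. Ide M (X \<rhd>\<^sub>o N))"
    by (auto simp: module_trans_def rho_def Hom_def)
  note ex = R_universal[OF rho_module_endofunctor[OF assms] assms this]
  show "unit G C M H R X \<in> Hom C X (fst (R (rho C M X) (sw X)))"
    "N \<in> Ob M \<Longrightarrow> cnt (rho C M X) (sw X) N \<cdot> (unit G C M H R X \<rhd>\<^sub>a Ide M N) = Ide M (X \<rhd>\<^sub>o N)"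
    using theI'[OF ex] unfolding unit_def by blast+
qed

text \<open>A module transformation t after the counit of F is again a module transformation, so it
  factors uniquely through the counit of F'. Transposing shows that the description in the
  definition of \<open>rhobar_map\<close> singles out this factorisation.\<close>

lemma rhobar_map:
  assumes F: "mend F d" and F': "mend F' d'"
    and t: "\<And>N. N \<in> Ob M \<Longrightarrow> t N \<in> Hom M (FO F N) (FO F' N)"
    and nat: "\<And>f. f \<in> Arr M \<Longrightarrow> t (Cod M f) \<cdot> FA F f = FA F' f \<cdot> t (Dom M f)"
    and mod: "\<And>W N. \<lbrakk>W \<in> Ob V; N \<in> Ob M\<rbrakk> \<Longrightarrow> d' W N \<cdot> t (B W \<rhd>\<^sub>o N) = (Ide C (B W) \<rhd>\<^sub>a t N) \<cdot> d W N"
  shows "rhobar_map C M H R F d F' d' t \<in> Hom C (fst (R F d)) (fst (R F' d'))"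
    and "N \<in> Ob M \<Longrightarrow> cnt F' d' N \<cdot> (rhobar_map C M H R F d F' d' t \<rhd>\<^sub>a Ide M N) = t N \<cdot> cnt F d N"
proof -
  let ?A = "fst (R F d)" and ?A' = "fst (R F' d')"
  note [simp] = module_endofunctor_simps[OF F] module_endofunctor_simps[OF F'] R_ob[OF F] R_ob[OF F']
  note c = counit_module_trans[OF F]
  note [simp] = module_trans_simps[OF c]
  have [simp]: "t N \<in> Arr M" "Dom M (t N) = FO F N" "Cod M (t N) = FO F' N" if "N \<in> Ob M" for N
    using t[OF that] by (auto simp: Hom_def)
  have "mtrans F' d' ?A (\<lambda>N. t N \<cdot> cnt F d N)"
    unfolding module_trans_def
  proof (intro conjI ballI)
    fix f assume [simp]: "f \<in> Arr M"
    have "cnt F d (Cod M f) \<cdot> (Ide C ?A \<rhd>\<^sub>a f) = FA F f \<cdot> cnt F d (Dom M f)"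
      using c by (simp add: module_trans_def)
    then show "(t (Cod M f) \<cdot> cnt F d (Cod M f)) \<cdot> (Ide C ?A \<rhd>\<^sub>a f) = FA F' f \<cdot> (t (Dom M f) \<cdot> cnt F d (Dom M f))"
      using comp_tail[OF nat[of f], of "cnt F d (Dom M f)"] by simp
  next
    fix W N assume [simp]: "W \<in> Ob V" "N \<in> Ob M"
    have "d W N \<cdot> cnt F d (B W \<rhd>\<^sub>o N) = (Ide C (B W) \<rhd>\<^sub>a cnt F d N) \<cdot> sw ?A W N"
      using c by (simp add: module_trans_def)
    then show "d' W N \<cdot> t (B W \<rhd>\<^sub>o N) \<cdot> cnt F d (B W \<rhd>\<^sub>o N) = (Ide C (B W) \<rhd>\<^sub>a (t N \<cdot> cnt F d N)) \<cdot> sw ?A W N"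
      using comp_tail[OF mod[of W N], of "cnt F d (B W \<rhd>\<^sub>o N)"] by (simp add: act_ide_comp)
  qed (simp add: Hom_def)
  note ex = R_universal[OF F' R_ob[OF F] this]
  have "snd (R F' d') N \<bullet> u = ihom_map C M H (Ide M N) (t N) \<bullet> snd (R F d) N
      \<longleftrightarrow> cnt F' d' N \<cdot> (u \<rhd>\<^sub>a Ide M N) = t N \<cdot> cnt F d N"
    if u: "u \<in> Hom C ?A ?A'" and N [simp]: "N \<in> Ob M" for u N
  proof -
    have iN: "Ide M N \<in> Hom M N N" by (simp add: Hom_def)
    note m = ihom_map[OF iN t[OF N] R_proj[OF F N]]
    have "Phi H ?A N (FO F' N) (snd (R F' d') N \<bullet> u) = cnt F' d' N \<cdot> (u \<rhd>\<^sub>a Ide M N)"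
      using Phi_comp[OF N _ u R_proj[OF F' N]] counit_Phi[OF F' N] by simp
    moreover have "Phi H ?A N (FO F' N) (ihom_map C M H (Ide M N) (t N) \<bullet> snd (R F d) N) = t N \<cdot> cnt F d N"
      using m(2) unfolding counit_Phi[OF F N, symmetric] by simp
    ultimately show ?thesis
      using Phi_inj[OF N _ C.comp_hom[OF u R_proj[OF F' N]] m(1)] by auto
  qed
  then have "\<exists>!u. u \<in> Hom C ?A ?A' \<and>
      (\<forall>N\<in>Ob M. snd (R F' d') N \<bullet> u = ihom_map C M H (Ide M N) (t N) \<bullet> snd (R F d) N)"
    and iff: "\<And>u N. u \<in> Hom C ?A ?A' \<Longrightarrow> N \<in> Ob M \<Longrightarrow>
      (snd (R F' d') N \<bullet> u = ihom_map C M H (Ide M N) (t N) \<bullet> snd (R F d) N)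
      \<longleftrightarrow> cnt F' d' N \<cdot> (u \<rhd>\<^sub>a Ide M N) = t N \<cdot> cnt F d N"
    using ex by (simp_all cong: conj_cong)
  note u = theI'[OF this(1), folded rhobar_map_def]
  show "rhobar_map C M H R F d F' d' t \<in> Hom C ?A ?A'" using u by blast
  show "N \<in> Ob M \<Longrightarrow> cnt F' d' N \<cdot> (rhobar_map C M H R F d F' d' t \<rhd>\<^sub>a Ide M N) = t N \<cdot> cnt F d N"
    using u iff by blast
qed

text \<open>The composite is the adjoint transpose of z, so it inherits the defining equation from
  the universal property. Both \<open>l_inv\<close> and \<open>r_inv\<close> are of this
  form.\<close>

lemma rhobar_map_unit:
  assumes F: "mend F d" and [simp]: "Z \<in> Ob C" and z: "mtrans F d Z z"
  shows "rhobar_map C M H R (rho C M Z) (sw Z) F d z \<bullet> unit G C M H R Z \<in> Hom C Z (fst (R F d))"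
    and "N \<in> Ob M \<Longrightarrow>
      cnt F d N \<cdot> ((rhobar_map C M H R (rho C M Z) (sw Z) F d z \<bullet> unit G C M H R Z) \<rhd>\<^sub>a Ide M N) = z N"
proof -
  note rho = rho_module_endofunctor[of Z, simplified]
  define u where "u = rhobar_map C M H R (rho C M Z) (sw Z) F d z"
  define h where "h = unit G C M H R Z"
  have u: "u \<in> Hom C (fst (R (rho C M Z) (sw Z))) (fst (R F d))"
    "N \<in> Ob M \<Longrightarrow> cnt F d N \<cdot> (u \<rhd>\<^sub>a Ide M N) = z N \<cdot> cnt (rho C M Z) (sw Z) N" for N
    unfolding u_def by (rule rhobar_map[OF rho F]; use z in \<open>simp add: module_trans_def rho_def\<close>)+
  have h: "h \<in> Hom C Z (fst (R (rho C M Z) (sw Z)))"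
    "N \<in> Ob M \<Longrightarrow> cnt (rho C M Z) (sw Z) N \<cdot> (h \<rhd>\<^sub>a Ide M N) = Ide M (Z \<rhd>\<^sub>o N)" for N
    unfolding h_def using unit[of Z] by simp_all
  show "u \<bullet> h \<in> Hom C Z (fst (R F d))" using C.comp_hom[OF h(1) u(1)] .
  assume N [simp]: "N \<in> Ob M"
  note [simp] = module_trans_simps[OF counit_module_trans[OF F]] module_trans_simps[OF counit_module_trans[OF rho]]
    module_trans_simps[OF z] C.hom_arr[OF u(1)] C.hom_dom[OF u(1)] C.hom_cod[OF u(1)]
    C.hom_arr[OF h(1)] C.hom_dom[OF h(1)] C.hom_cod[OF h(1)]
  have "cnt F d N \<cdot> ((u \<bullet> h) \<rhd>\<^sub>a Ide M N) = cnt F d N \<cdot> (u \<rhd>\<^sub>a Ide M N) \<cdot> (h \<rhd>\<^sub>a Ide M N)"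
    by (simp add: act_comp_ide)
  also have "\<dots> = z N \<cdot> cnt (rho C M Z) (sw Z) N \<cdot> (h \<rhd>\<^sub>a Ide M N)"
    using comp_tail[OF u(2)[OF N], of "h \<rhd>\<^sub>a Ide M N"] by simp
  also have "\<dots> = z N" using h(2)[OF N] by simp
  finally show "cnt F d N \<cdot> ((u \<bullet> h) \<rhd>\<^sub>a Ide M N) = z N" .
qed

abbreviation "E \<equiv> trans_cat C M"
abbreviation "J \<equiv> act_arr C M"
text \<open>The half-braidings of the objects G W, acting on M.\<close>

definition S :: "('o \<times> ('o \<Rightarrow> 'o \<times> ('mo \<Rightarrow> 'ma) \<times> 'o)) set" where
  "S = (\<lambda>W. (B W, \<lambda>X. J (hb W X))) ` Ob V"
definition E' :: "('k, 'o, 'o \<times> ('mo \<Rightarrow> 'ma) \<times> 'o) moncat" where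
  "E' = wide_subcat E (central_arr E S)"

text \<open>The central arrows form a monoidal category because the half-braidings are
  multiplicative, and J takes values in it because they are natural in C.\<close>

lemma strict_extension_central: "strict_extension C E' J"
proof -
  interpret X: strict_extension C E J by (rule strict_extension_trans_cat)
  have "strict_monoidal E'"
    unfolding E'_def
  proof (rule X.E.strict_monoidal_central)
    fix b s X assume "(b, s) \<in> S" "X \<in> Ob E"
    then show "b \<in> Ob E \<and> s X \<in> Hom E (b \<otimes>\<^sub>o\<^bsub>E\<^esub> X) (X \<otimes>\<^sub>o\<^bsub>E\<^esub> b)"
      by (auto simp: S_def intro!: X.J_hom) (auto simp: Hom_def)
  next
    fix b s X Y assume "(b, s) \<in> S" "X \<in> Ob E" "Y \<in> Ob E"
    then show "s (X \<otimes>\<^sub>o\<^bsub>E\<^esub> Y) = (Ide E X \<otimes>\<^sub>a\<^bsub>E\<^esub> s Y) \<cdot>\<^bsub>E\<^esub> (s X \<otimes>\<^sub>a\<^bsub>E\<^esub> Ide E Y)"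
      by (auto simp: S_def hb_tens X.J_ide[symmetric] simp del: X.J_ide trans_cat_sel(4,5,8))
  qed
  then interpret E': strict_monoidal E' .
  have "(J f \<otimes>\<^sub>a\<^bsub>E\<^esub> Ide E (B W)) \<cdot>\<^bsub>E\<^esub> J (hb W (Dom E (J f))) = J (hb W (Cod E (J f))) \<cdot>\<^bsub>E\<^esub> (Ide E (B W) \<otimes>\<^sub>a\<^bsub>E\<^esub> J f)"
    if [simp]: "f \<in> Arr C" "W \<in> Ob V" for f W
    using arg_cong[OF hb_natural[of W f], of J] by (simp del: trans_cat_sel(4,5,8))
  then have "central_arr E S (J f)" if "f \<in> Arr C" for f
    using that unfolding central_arr_def S_def by (auto simp del: trans_cat_sel(4,5,8))
  then show ?thesis
    by unfold_locales
      (auto simp: E'_def wide_subcat_hom X.J_hom C.hom_arr simp del: trans_cat_sel(4,5,8))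
qed


section \<open>Central arrows are module transformations\<close>

lemma restrict_eq_iff: "restrict f X = restrict g X \<longleftrightarrow> (\<forall>x\<in>X. f x = g x)"
  by (auto simp: fun_eq_iff)

lemma swap_inv_assoc:
  assumes [simp]: "X \<in> Ob C" "W \<in> Ob V" "N \<in> Ob M"
  shows "Assoc M X (B W) N \<cdot> (hb W X \<rhd>\<^sub>a Ide M N) = inv_arr M (sw X W N) \<cdot> Assoc M (B W) X N"
proof (rule iso_cancel_left[of "sw X W N"])
  show "sw X W N \<cdot> Assoc M X (B W) N \<cdot> (hb W X \<rhd>\<^sub>a Ide M N) = sw X W N \<cdot> inv_arr M (sw X W N) \<cdot> Assoc M (B W) X N"
    using comp_tail[OF swap_assoc[of X W N], of "hb W X \<rhd>\<^sub>a Ide M N"] by (simp add: act_interchange)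
qed simp_all

text \<open>In components, centrality contains \<open>hb\<close> at the source and at the target of
  z. Conjugated with associativity isomorphisms these are the inverses of \<open>swap\<close>, and
  moving them across gives the module condition.\<close>

lemma central_arr_iff:
  assumes z: "act_trans C M Z X z" and [simp]: "W \<in> Ob V"
  shows "((Z, z, X) \<otimes>\<^sub>a\<^bsub>E\<^esub> Ide E (B W)) \<cdot>\<^bsub>E\<^esub> J (hb W Z) = J (hb W X) \<cdot>\<^bsub>E\<^esub> (Ide E (B W) \<otimes>\<^sub>a\<^bsub>E\<^esub> (Z, z, X))
    \<longleftrightarrow> (\<forall>N\<in>Ob M. sw X W N \<cdot> z (B W \<rhd>\<^sub>o N) = (Ide C (B W) \<rhd>\<^sub>a z N) \<cdot> sw Z W N)" (is "?l \<longleftrightarrow> _")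
proof -
  note [simp] = act_transD(1-6)[OF z]
  have "?l \<longleftrightarrow> (\<forall>N\<in>Ob M. inv_arr M (Assoc M X (B W) N) \<cdot> z (B W \<rhd>\<^sub>o N) \<cdot> Assoc M Z (B W) N \<cdot> (hb W Z \<rhd>\<^sub>a Ide M N)
        = (hb W X \<rhd>\<^sub>a Ide M N) \<cdot> inv_arr M (Assoc M (B W) X N) \<cdot> (Ide C (B W) \<rhd>\<^sub>a z N) \<cdot> Assoc M (B W) Z N)"
    by (simp add: act_arr_def restrict_eq_iff)
  also have "\<dots> \<longleftrightarrow> (\<forall>N\<in>Ob M. sw X W N \<cdot> z (B W \<rhd>\<^sub>o N) = (Ide C (B W) \<rhd>\<^sub>a z N) \<cdot> sw Z W N)"
  proof (rule ball_cong[OF refl])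
    fix N assume [simp]: "N \<in> Ob M"
    let ?aX = "Assoc M X (B W) N" and ?a = "Assoc M (B W) Z N" and ?s = "sw Z W N" and ?t = "sw X W N"
    define y where "y = Ide C (B W) \<rhd>\<^sub>a z N"
    define w where "w = z (B W \<rhd>\<^sub>o N)"
    have [simp]: "y \<in> Arr M" "Dom M y = B W \<rhd>\<^sub>o Z \<rhd>\<^sub>o N" "Cod M y = B W \<rhd>\<^sub>o X \<rhd>\<^sub>o N"
      "w \<in> Arr M" "Dom M w = Z \<rhd>\<^sub>o B W \<rhd>\<^sub>o N" "Cod M w = X \<rhd>\<^sub>o B W \<rhd>\<^sub>o N" by (simp_all add: y_def w_def)
    have l: "inv_arr M ?aX \<cdot> w \<cdot> Assoc M Z (B W) N \<cdot> (hb W Z \<rhd>\<^sub>a Ide M N) = inv_arr M ?aX \<cdot> w \<cdot> inv_arr M ?s \<cdot> ?a"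
      by (simp add: swap_inv_assoc)
    have "?aX \<cdot> (hb W X \<rhd>\<^sub>a Ide M N) \<cdot> inv_arr M (Assoc M (B W) X N) \<cdot> y \<cdot> ?a = inv_arr M ?t \<cdot> y \<cdot> ?a"
      using comp_tail[OF swap_inv_assoc[of X W N], of "inv_arr M (Assoc M (B W) X N) \<cdot> y \<cdot> ?a"] by simp
    from iso_moveL[OF _ this]
    have r: "(hb W X \<rhd>\<^sub>a Ide M N) \<cdot> inv_arr M (Assoc M (B W) X N) \<cdot> y \<cdot> ?a = inv_arr M ?aX \<cdot> inv_arr M ?t \<cdot> y \<cdot> ?a"
      by simp
    have "inv_arr M ?aX \<cdot> w \<cdot> inv_arr M ?s \<cdot> ?a = inv_arr M ?aX \<cdot> inv_arr M ?t \<cdot> y \<cdot> ?a \<longleftrightarrow> ?t \<cdot> w = y \<cdot> ?s"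
    proof
      assume "inv_arr M ?aX \<cdot> w \<cdot> inv_arr M ?s \<cdot> ?a = inv_arr M ?aX \<cdot> inv_arr M ?t \<cdot> y \<cdot> ?a"
      from arg_cong[OF this, of "\<lambda>x. (?t \<cdot> ?aX) \<cdot> x \<cdot> (inv_arr M ?a \<cdot> ?s)"]
      show "?t \<cdot> w = y \<cdot> ?s" by simp
    next
      assume "?t \<cdot> w = y \<cdot> ?s"
      from arg_cong[OF this, of "\<lambda>x. inv_arr M ?t \<cdot> x \<cdot> inv_arr M ?s \<cdot> ?a"]
      show "inv_arr M ?aX \<cdot> w \<cdot> inv_arr M ?s \<cdot> ?a = inv_arr M ?aX \<cdot> inv_arr M ?t \<cdot> y \<cdot> ?a" by simp
    qed
    then show "inv_arr M ?aX \<cdot> z (B W \<rhd>\<^sub>o N) \<cdot> Assoc M Z (B W) N \<cdot> (hb W Z \<rhd>\<^sub>a Ide M N)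
        = (hb W X \<rhd>\<^sub>a Ide M N) \<cdot> inv_arr M (Assoc M (B W) X N) \<cdot> (Ide C (B W) \<rhd>\<^sub>a z N) \<cdot> Assoc M (B W) Z N
      \<longleftrightarrow> ?t \<cdot> z (B W \<rhd>\<^sub>o N) = (Ide C (B W) \<rhd>\<^sub>a z N) \<cdot> ?s"
      unfolding y_def[symmetric] w_def[symmetric] l r .
  qed
  finally show ?thesis .
qed

lemma central_module_trans_iff:
  assumes z: "act_trans C M Z X z"
  shows "central_arr E S (Z, z, X) \<longleftrightarrow> mtrans (rho C M X) (sw X) Z z"
proof -
  have "central_arr E S (Z, z, X)
    \<longleftrightarrow> (\<forall>W\<in>Ob V. \<forall>N\<in>Ob M. sw X W N \<cdot> z (B W \<rhd>\<^sub>o N) = (Ide C (B W) \<rhd>\<^sub>a z N) \<cdot> sw Z W N)"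
    unfolding central_arr_def S_def using central_arr_iff[OF z] by (simp del: trans_cat_sel(4,5,8))
  also have "\<dots> \<longleftrightarrow> mtrans (rho C M X) (sw X) Z z"
    using act_transD(4-7)[OF z] by (simp add: module_trans_def Hom_def)
  finally show ?thesis .
qed

lemma central_hom_module_trans:
  assumes "(Z, z, X) \<in> Hom E' Z X"
  shows "mtrans (rho C M X) (sw X) Z z"
  using assms central_module_trans_iff unfolding E'_def wide_subcat_hom by (auto simp: trans_cat_hom)

lemma module_trans_restrict:
  assumes "Z \<in> Ob C"
  shows "mtrans F d Z (\<lambda>N\<in>Ob M. z N) \<longleftrightarrow> mtrans F d Z z"
  using assms unfolding module_trans_def by simp

text \<open>The counterpart for transformations to the identity functor instead of 1 |> -: at the
  unit object the half-braiding is an identity, so \<open>swap\<close> survives only on the side of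
  Z.\<close>

lemma to_unit_central:
  assumes [simp]: "Z \<in> Ob C" and z: "\<And>N. N \<in> Ob M \<Longrightarrow> z N \<in> Hom M (Z \<rhd>\<^sub>o N) N"
  shows "central_arr E S (to_unit C M Z z)
    \<longleftrightarrow> (\<forall>W\<in>Ob V. \<forall>N\<in>Ob M. z (B W \<rhd>\<^sub>o N) = (Ide C (B W) \<rhd>\<^sub>a z N) \<cdot> sw Z W N)"
proof -
  have [simp]: "z N \<in> Arr M" "Dom M (z N) = Z \<rhd>\<^sub>o N" "Cod M (z N) = N" if "N \<in> Ob M" for N
    using z[OF that] by (auto simp: Hom_def)
  have "(to_unit C M Z z \<otimes>\<^sub>a\<^bsub>E\<^esub> Ide E (B W)) \<cdot>\<^bsub>E\<^esub> J (hb W Z)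
      = J (hb W (Unit C)) \<cdot>\<^bsub>E\<^esub> (Ide E (B W) \<otimes>\<^sub>a\<^bsub>E\<^esub> to_unit C M Z z)
    \<longleftrightarrow> (\<forall>N\<in>Ob M. z (B W \<rhd>\<^sub>o N) = (Ide C (B W) \<rhd>\<^sub>a z N) \<cdot> sw Z W N)" (is "?l \<longleftrightarrow> _")
    if [simp]: "W \<in> Ob V" for W
  proof -
    have t: "to_unit C M Z z \<otimes>\<^sub>a\<^bsub>E\<^esub> Ide E (B W) = (Z \<otimes>\<^sub>C B W, \<lambda>N\<in>Ob M. z (B W \<rhd>\<^sub>o N) \<cdot> Assoc M Z (B W) N, B W)"
      "Ide E (B W) \<otimes>\<^sub>a\<^bsub>E\<^esub> to_unit C M Z z = (B W \<otimes>\<^sub>C Z, \<lambda>N\<in>Ob M. (Ide C (B W) \<rhd>\<^sub>a z N) \<cdot> Assoc M (B W) Z N, B W)"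
      by (rule to_unit_tens tens_to_unit; simp add: z)+
    have "?l \<longleftrightarrow> (\<forall>N\<in>Ob M. z (B W \<rhd>\<^sub>o N) \<cdot> Assoc M Z (B W) N \<cdot> (hb W Z \<rhd>\<^sub>a Ide M N)
        = (Ide C (B W) \<rhd>\<^sub>a z N) \<cdot> Assoc M (B W) Z N)"
      unfolding t by (simp add: act_arr_def restrict_eq_iff hb_unit)
    also have "\<dots> \<longleftrightarrow> (\<forall>N\<in>Ob M. z (B W \<rhd>\<^sub>o N) = (Ide C (B W) \<rhd>\<^sub>a z N) \<cdot> sw Z W N)"
    proof (rule ball_cong[OF refl])
      fix N assume [simp]: "N \<in> Ob M"
      let ?y = "Ide C (B W) \<rhd>\<^sub>a z N" and ?s = "sw Z W N" and ?a = "Assoc M (B W) Z N"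
      have "z (B W \<rhd>\<^sub>o N) \<cdot> Assoc M Z (B W) N \<cdot> (hb W Z \<rhd>\<^sub>a Ide M N) = ?y \<cdot> ?a
        \<longleftrightarrow> (z (B W \<rhd>\<^sub>o N) \<cdot> inv_arr M ?s) \<cdot> ?a = ?y \<cdot> ?a"
        by (simp add: swap_inv_assoc)
      also have "\<dots> \<longleftrightarrow> z (B W \<rhd>\<^sub>o N) \<cdot> inv_arr M ?s = ?y"
        using iso_cancel_right[of ?a "z (B W \<rhd>\<^sub>o N) \<cdot> inv_arr M ?s" ?y] by (auto simp del: comp_assoc_arr)
      also have "\<dots> \<longleftrightarrow> z (B W \<rhd>\<^sub>o N) = ?y \<cdot> ?s"
      proof
        assume "z (B W \<rhd>\<^sub>o N) \<cdot> inv_arr M ?s = ?y"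
        from arg_cong[OF this, of "\<lambda>x. x \<cdot> ?s"] show "z (B W \<rhd>\<^sub>o N) = ?y \<cdot> ?s" by simp
      qed simp
      finally show "z (B W \<rhd>\<^sub>o N) \<cdot> Assoc M Z (B W) N \<cdot> (hb W Z \<rhd>\<^sub>a Ide M N) = ?y \<cdot> ?a
        \<longleftrightarrow> z (B W \<rhd>\<^sub>o N) = ?y \<cdot> ?s" .
    qed
    finally show ?thesis .
  qed
  moreover have "Dom E (to_unit C M Z z) = Z" "Cod E (to_unit C M Z z) = Unit C" by (simp_all add: to_unit_def)
  ultimately show ?thesis unfolding central_arr_def S_def by (simp del: trans_cat_sel(4,5,8))
qed

lemma id_module_trans_iff:
  "mtrans id_func (id_str RM) Z z \<longleftrightarrow>
     (\<forall>N\<in>Ob M. z N \<in> Hom M (Z \<rhd>\<^sub>o N) N) \<and>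
     (\<forall>f\<in>Arr M. z (Cod M f) \<cdot> (Ide C Z \<rhd>\<^sub>a f) = f \<cdot> z (Dom M f)) \<and>
     (\<forall>W\<in>Ob V. \<forall>N\<in>Ob M. z (B W \<rhd>\<^sub>o N) = (Ide C (B W) \<rhd>\<^sub>a z N) \<cdot> sw Z W N)"
proof -
  have "id_str RM W N \<cdot> z (B W \<rhd>\<^sub>o N) = z (B W \<rhd>\<^sub>o N)"
    if "\<And>N. N \<in> Ob M \<Longrightarrow> z N \<in> Hom M (Z \<rhd>\<^sub>o N) N" "W \<in> Ob V" "N \<in> Ob M" for W N
    using that(1)[of "B W \<rhd>\<^sub>o N"] that(2,3) by (simp add: id_str_def Hom_def)
  then show ?thesis unfolding module_trans_def by (auto simp: id_func_def)
qed

lemma to_unit_hom_central: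
  assumes "Z \<in> Ob C" "mtrans id_func (id_str RM) Z z"
  shows "to_unit C M Z z \<in> Hom E' Z (Unit C)"
  using assms to_unit_hom to_unit_central unfolding E'_def wide_subcat_hom id_module_trans_iff by simp


abbreviation A :: 'o where "A \<equiv> fst (R id_func (id_str RM))"
abbreviation e :: "'mo \<Rightarrow> 'ma" where "e \<equiv> cnt id_func (id_str RM)"
abbreviation ep :: "'o \<times> ('mo \<Rightarrow> 'ma) \<times> 'o" where "ep \<equiv> to_unit C M A e"

section \<open>The end of the identity functor\<close>

lemma A_ob [simp]: "A \<in> Ob C"
  by (rule R_ob[OF id_module_endofunctor])

lemma e_trans: "mtrans id_func (id_str RM) A e"
  by (rule counit_module_trans[OF id_module_endofunctor])

lemma e_hom: "N \<in> Ob M \<Longrightarrow> e N \<in> Hom M (A \<rhd>\<^sub>o N) N"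
  using e_trans unfolding id_module_trans_iff by blast

lemma e_simps [simp]:
  "N \<in> Ob M \<Longrightarrow> e N \<in> Arr M" "N \<in> Ob M \<Longrightarrow> Dom M (e N) = A \<rhd>\<^sub>o N" "N \<in> Ob M \<Longrightarrow> Cod M (e N) = N"
  using e_hom by (auto simp: Hom_def)

lemma e_comp_hom:
  assumes "f \<in> Hom C Z A" "N \<in> Ob M"
  shows "e N \<cdot> (f \<rhd>\<^sub>a Ide M N) \<in> Hom M (Z \<rhd>\<^sub>o N) N"
  using assms by (auto simp: Hom_def)

lemma E'_sel [simp]:
  "Comp E' = Comp E" "Ide E' = Ide E" "TensA E' = TensA E" "TensO E' = TensO C" "Ob E' = Ob C"
  by (simp_all add: E'_def)

lemma ep_comp_iff:
  assumes f: "f \<in> Hom C Z A" and z: "\<And>N. N \<in> Ob M \<Longrightarrow> z N \<in> Hom M (Z \<rhd>\<^sub>o N) N"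
  shows "ep \<cdot>\<^bsub>E\<^esub> J f = to_unit C M Z z \<longleftrightarrow> (\<forall>N\<in>Ob M. e N \<cdot> (f \<rhd>\<^sub>a Ide M N) = z N)"
proof -
  have "ep \<cdot>\<^bsub>E\<^esub> J f = to_unit C M (Dom C f) (\<lambda>N. e N \<cdot> (f \<rhd>\<^sub>a Ide M N))"
    by (rule to_unit_comp) (use e_hom f in \<open>auto simp: C.hom_arr C.hom_cod\<close>)
  then show ?thesis using to_unit_eq_iff[OF e_comp_hom[OF f] z] C.hom_dom[OF f] by simp
qed

text \<open>Arrows Z -> 1 of E' are the module transformations from Z |> - to the identity, and e is
  universal among these by \<open>R_universal\<close>.\<close>

lemma corepresented_A: "corepresented C E' J A ep"
proof -
  interpret strict_extension C E' J by (rule strict_extension_central)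
  show ?thesis
  proof
    fix Z z assume Z: "Z \<in> Ob C" and z: "z \<in> Hom E' Z (Unit C)"
    from z have zE: "z \<in> Hom E Z (Unit C)" and zc: "central_arr E S z" by (auto simp: E'_def wide_subcat_hom)
    obtain w where w: "z = to_unit C M Z w" "\<And>N. N \<in> Ob M \<Longrightarrow> w N \<in> Hom M (Z \<rhd>\<^sub>o N) N"
      "\<And>f. f \<in> Arr M \<Longrightarrow> w (Cod M f) \<cdot> (Ide C Z \<rhd>\<^sub>a f) = f \<cdot> w (Dom M f)"
      using to_unit_surj[OF zE] by blast
    have "mtrans id_func (id_str RM) Z w"
      unfolding id_module_trans_iff using w zc to_unit_central[OF Z w(2)] by blast
    from R_universal[OF id_module_endofunctor Z this]
    have ex: "\<exists>!f. f \<in> Hom C Z A \<and> (\<forall>N\<in>Ob M. e N \<cdot> (f \<rhd>\<^sub>a Ide M N) = w N)" .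
    have "f \<in> Hom C Z A \<and> ep \<cdot>\<^bsub>E'\<^esub> J f = z \<longleftrightarrow> f \<in> Hom C Z A \<and> (\<forall>N\<in>Ob M. e N \<cdot> (f \<rhd>\<^sub>a Ide M N) = w N)" for f
      using ep_comp_iff[OF _ w(2), of f] w(1) by auto
    then show "\<exists>!f. f \<in> Hom C Z A \<and> ep \<cdot>\<^bsub>E'\<^esub> J f = z" using ex by simp
  qed (use C.left_duals C.right_duals to_unit_hom_central[OF A_ob e_trans] in auto)
qed

sublocale U: corepresented C E' J A ep
  by (rule corepresented_A)

abbreviation zr :: "'o \<Rightarrow> 'mo \<Rightarrow> 'ma" where "zr X N \<equiv> e (X \<rhd>\<^sub>o N) \<cdot> Assoc M A X N"
abbreviation zl :: "'o \<Rightarrow> 'mo \<Rightarrow> 'ma" where "zl X N \<equiv> (Ide C X \<rhd>\<^sub>a e N) \<cdot> Assoc M X A N"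

lemma ep_tens:
  assumes "X \<in> Ob C"
  shows "ep \<otimes>\<^sub>a\<^bsub>E\<^esub> Ide E X = (A \<otimes>\<^sub>C X, \<lambda>N\<in>Ob M. zr X N, X)"
    and "Ide E X \<otimes>\<^sub>a\<^bsub>E\<^esub> ep = (X \<otimes>\<^sub>C A, \<lambda>N\<in>Ob M. zl X N, X)"
  by (rule to_unit_tens tens_to_unit; simp add: assms e_hom)+

text \<open>Direct verification of the module condition is avoided: the tensor product of
  \<open>ep\<close> with an identity stays in the monoidal category E', and its arrows satisfy that
  condition. The same holds for \<open>zl_trans\<close>.\<close>

lemma zr_trans:
  assumes [simp]: "X \<in> Ob C"
  shows "mtrans (rho C M X) (sw X) (A \<otimes>\<^sub>C X) (zr X)"
proof -
  have "ep \<otimes>\<^sub>a\<^bsub>E'\<^esub> Ide E' X \<in> Hom E' (A \<otimes>\<^sub>C X) X"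
    using U.E.tensA_hom[of ep A "Unit C" "Ide E' X" X X] U.ep_hom U.E.ide_hom[of X] by simp
  then show ?thesis
    using central_hom_module_trans[of "A \<otimes>\<^sub>C X" "\<lambda>N\<in>Ob M. zr X N" X]
    by (simp add: ep_tens module_trans_restrict del: trans_cat_sel(5,8))
qed

lemma zl_trans:
  assumes [simp]: "X \<in> Ob C"
  shows "mtrans (rho C M X) (sw X) (X \<otimes>\<^sub>C A) (zl X)"
proof -
  have "Ide E' X \<otimes>\<^sub>a\<^bsub>E'\<^esub> ep \<in> Hom E' (X \<otimes>\<^sub>C A) X"
    using U.E.tensA_hom[of "Ide E' X" X X ep A "Unit C"] U.ep_hom U.E.ide_hom[of X] by simp
  then show ?thesis
    using central_hom_module_trans[of "X \<otimes>\<^sub>C A" "\<lambda>N\<in>Ob M. zl X N" X]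
    by (simp add: ep_tens module_trans_restrict del: trans_cat_sel(5,8))
qed

lemma zl_comp:
  assumes "X \<in> Ob C" "f \<in> Hom C Z (X \<otimes>\<^sub>C A)"
  shows "(Ide E X \<otimes>\<^sub>a\<^bsub>E\<^esub> ep) \<cdot>\<^bsub>E\<^esub> J f = (Z, \<lambda>N\<in>Ob M. zl X N \<cdot> (f \<rhd>\<^sub>a Ide M N), X)"
  unfolding ep_tens(2)[OF assms(1)] using C.hom_dom[OF assms(2)] by (simp add: act_arr_def restrict_eq_iff)

text \<open>With uniqueness from \<open>zl_cancel\<close>, this gives X tensor A the universal
  property of the end of X |> -. It is the reason why \<open>l_inv\<close> is invertible.\<close>

lemma zl_universal:
  assumes [simp]: "X \<in> Ob C" "Z \<in> Ob C" and z: "mtrans (rho C M X) (sw X) Z z"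
  shows "\<exists>f. f \<in> Hom C Z (X \<otimes>\<^sub>C A) \<and> (\<forall>N\<in>Ob M. zl X N \<cdot> (f \<rhd>\<^sub>a Ide M N) = z N)"
proof -
  have at: "act_trans C M Z X (\<lambda>N\<in>Ob M. z N)"
    using z unfolding module_trans_def act_trans_def by simp
  then have "(Z, \<lambda>N\<in>Ob M. z N, X) \<in> Hom E' Z X"
    using central_module_trans_iff[OF at] z unfolding E'_def wide_subcat_hom trans_cat_hom
    by (simp add: module_trans_restrict)
  from U.universal_tens[OF assms(1,2) this] obtain f where
    "f \<in> Hom C Z (X \<otimes>\<^sub>C A)" "(Ide E X \<otimes>\<^sub>a\<^bsub>E\<^esub> ep) \<cdot>\<^bsub>E\<^esub> J f = (Z, \<lambda>N\<in>Ob M. z N, X)"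
    unfolding E'_sel by blast
  then show ?thesis using zl_comp[of X f Z] by (auto simp: restrict_eq_iff)
qed

lemma zl_cancel:
  assumes "X \<in> Ob C" "f \<in> Hom C Z (X \<otimes>\<^sub>C A)" "g \<in> Hom C Z (X \<otimes>\<^sub>C A)"
    and "\<And>N. N \<in> Ob M \<Longrightarrow> zl X N \<cdot> (f \<rhd>\<^sub>a Ide M N) = zl X N \<cdot> (g \<rhd>\<^sub>a Ide M N)"
  shows "f = g"
proof (rule U.universal_eqI[of f g X])
  show "(Ide E' X \<otimes>\<^sub>a\<^bsub>E'\<^esub> ep) \<cdot>\<^bsub>E'\<^esub> J f = (Ide E' X \<otimes>\<^sub>a\<^bsub>E'\<^esub> ep) \<cdot>\<^bsub>E'\<^esub> J g"
    unfolding E'_sel zl_comp[OF assms(1,2)] zl_comp[OF assms(1,3)] using assms(4) by (simp add: restrict_eq_iff)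
qed (use assms(1-3) in \<open>auto simp: Hom_def\<close>)

abbreviation s :: "'o \<Rightarrow> 'a" where "s \<equiv> snd (adj_alg G C M H R)"

section \<open>The half-braiding of the adjoint algebra\<close>

lemma adj_alg_eq: "adj_alg G C M H R = (A, s)"
  by (simp add: adj_alg_def center_rhobar_def)

lemma s_extensional: "s \<in> extensional (Ob C)"
  by (simp add: adj_alg_def center_rhobar_def)

text \<open>Each factor of s corresponds to an equation between universal transformations:
  \<open>r\<close> takes \<open>cr\<close> to \<open>zr\<close>, \<open>m\<close> takes
  \<open>cl\<close> to \<open>cr\<close>, and the inverse of \<open>l\<close> takes
  \<open>zl\<close> to \<open>cl\<close>. Chaining them leaves \<open>zl\<close> on one side and
  \<open>zr\<close> on the other.\<close>

lemma s_transpose: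
  assumes X [simp]: "X \<in> Ob C"
  shows "s X \<in> Hom C (A \<otimes>\<^sub>C X) (X \<otimes>\<^sub>C A)"
    and "N \<in> Ob M \<Longrightarrow> zl X N \<cdot> (s X \<rhd>\<^sub>a Ide M N) = zr X N"
proof -
  let ?dl = "lact_str G C M X id_func (id_str RM)" and ?dr = "ract_str G C M id_func (id_str RM) X"
  let ?F = "rho C M X"
  have Fl: "mend ?F ?dl" and Fr: "mend ?F ?dr"
    by (rule module_endofunctor_cong[OF rho_module_endofunctor[OF X]]; simp)+
  \<comment> \<open>Module transformations see the structures only at objects, so
    \<open>zl_trans\<close> and \<open>zr_trans\<close> apply although L and Q may be different
    ends.\<close>
  have cong: "mtrans ?F ?dl Z z \<longleftrightarrow> mtrans ?F (sw X) Z z" "mtrans ?F ?dr Z z \<longleftrightarrow> mtrans ?F (sw X) Z z" for Z z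
    by (rule module_trans_cong; simp)+
  define l where "l = l_inv G C M H R X id_func (id_str RM)"
  define r where "r = r_inv G C M H R id_func (id_str RM) X"
  define m where "m = rhobar_map C M H R ?F ?dr ?F ?dl (id_str M X)"
  define L where "L = fst (R ?F ?dl)"
  define Q where "Q = fst (R ?F ?dr)"
  define cl where "cl = cnt ?F ?dl"
  define cr where "cr = cnt ?F ?dr"
  have ob [simp]: "L \<in> Ob C" "Q \<in> Ob C" unfolding L_def Q_def by (rule R_ob[OF Fl] R_ob[OF Fr])+
  have cl: "mtrans ?F ?dl L cl" and cr: "mtrans ?F ?dr Q cr"
    unfolding L_def cl_def Q_def cr_def by (rule counit_module_trans[OF Fl] counit_module_trans[OF Fr])+
  note [simp] = module_trans_simps[OF cl, simplified] module_trans_simps[OF cr, simplified]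
  have AX: "X \<otimes>\<^sub>C A \<in> Ob C" "A \<otimes>\<^sub>C X \<in> Ob C" by simp_all
  have l: "l \<in> Hom C (X \<otimes>\<^sub>C A) L" "N \<in> Ob M \<Longrightarrow> cl N \<cdot> (l \<rhd>\<^sub>a Ide M N) = zl X N" for N
    using rhobar_map_unit[OF Fl AX(1), of "zl X"] zl_trans[OF X]
    unfolding cong l_def l_inv_def L_def cl_def Let_def lact_id by simp_all
  have r: "r \<in> Hom C (A \<otimes>\<^sub>C X) Q" "N \<in> Ob M \<Longrightarrow> cr N \<cdot> (r \<rhd>\<^sub>a Ide M N) = zr X N" for N
    using rhobar_map_unit[OF Fr AX(2), of "zr X"] zr_trans[OF X]
    unfolding cong r_def r_inv_def Q_def cr_def Let_def ract_id by simp_all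
  have m: "m \<in> Hom C Q L" "N \<in> Ob M \<Longrightarrow> cl N \<cdot> (m \<rhd>\<^sub>a Ide M N) = cr N" for N
  proof -
    note m = rhobar_map[OF Fr Fl, of "id_str M X", folded m_def cl_def cr_def L_def Q_def]
    show "m \<in> Hom C Q L" by (rule m(1)) (auto simp: id_str_def Hom_def)
    assume N: "N \<in> Ob M"
    have "cl N \<cdot> (m \<rhd>\<^sub>a Ide M N) = id_str M X N \<cdot> cr N"
      by (rule m(2)) (use N in \<open>auto simp: id_str_def Hom_def\<close>)
    then show "cl N \<cdot> (m \<rhd>\<^sub>a Ide M N) = cr N" using N by (simp add: id_str_def)
  qed
  \<comment> \<open>The candidate for the inverse of \<open>l\<close>, which is
    \<open>l_inv\<close>: factor \<open>cl\<close> through X tensor A.\<close>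
  obtain g where g: "g \<in> Hom C L (X \<otimes>\<^sub>C A)" "\<And>N. N \<in> Ob M \<Longrightarrow> zl X N \<cdot> (g \<rhd>\<^sub>a Ide M N) = cl N"
    using zl_universal[OF X ob(1), of cl] cl unfolding cong by blast
  note [simp] = C.hom_arr[OF l(1)] C.hom_dom[OF l(1)] C.hom_cod[OF l(1)] C.hom_arr[OF r(1)] C.hom_dom[OF r(1)] C.hom_cod[OF r(1)]
    C.hom_arr[OF m(1)] C.hom_dom[OF m(1)] C.hom_cod[OF m(1)] C.hom_arr[OF g(1)] C.hom_dom[OF g(1)] C.hom_cod[OF g(1)]
  \<comment> \<open>An opaque name for \<open>zl\<close>, itself a composite, prevents the
    simplifier from reassociating it before \<open>comp_tail\<close> is applied.\<close>
  define w where "w N = zl X N" for N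
  have w [simp]: "w N \<in> Arr M" "Dom M (w N) = (X \<otimes>\<^sub>C A) \<rhd>\<^sub>o N" if "N \<in> Ob M" for N
    using that by (simp_all add: w_def)
  \<comment> \<open>Both arrows factor \<open>cl\<close> through itself, so they agree by the
    universal property of L; the other composite is treated by \<open>zl_cancel\<close>.\<close>
  have lg: "l \<bullet> g = Ide C L"
  proof -
    have ex: "\<exists>!f. f \<in> Hom C L L \<and> (\<forall>N\<in>Ob M. cl N \<cdot> (f \<rhd>\<^sub>a Ide M N) = cl N)"
      unfolding L_def cl_def by (rule R_universal[OF Fl]) (use cl ob in \<open>simp_all add: L_def cl_def\<close>)
    have "cl N \<cdot> ((l \<bullet> g) \<rhd>\<^sub>a Ide M N) = cl N" if N [simp]: "N \<in> Ob M" for N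
      using comp_tail[OF l(2)[OF N], of "g \<rhd>\<^sub>a Ide M N"] g(2)[OF N] by (simp add: act_comp_ide w_def[symmetric])
    moreover have "l \<bullet> g \<in> Hom C L L" "Ide C L \<in> Hom C L L" by (auto simp: Hom_def)
    moreover have "cl N \<cdot> (Ide C L \<rhd>\<^sub>a Ide M N) = cl N" if "N \<in> Ob M" for N using that by simp
    ultimately show ?thesis using ex by blast
  qed
  have gl: "g \<bullet> l = Ide C (X \<otimes>\<^sub>C A)"
  proof (rule zl_cancel[OF X])
    fix N assume N [simp]: "N \<in> Ob M"
    have "w N \<cdot> ((g \<bullet> l) \<rhd>\<^sub>a Ide M N) = w N"
      using comp_tail[OF g(2)[OF N, folded w_def], of "l \<rhd>\<^sub>a Ide M N"] l(2)[OF N, folded w_def] by (simp add: act_comp_ide)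
    then show "zl X N \<cdot> ((g \<bullet> l) \<rhd>\<^sub>a Ide M N) = zl X N \<cdot> (Ide C (X \<otimes>\<^sub>C A) \<rhd>\<^sub>a Ide M N)"
      unfolding w_def[symmetric] by simp
  qed (auto simp: Hom_def)
  have "inv_arr C l = g" by (rule C.inv_arr_eqI) (use l(1) g(1) lg gl in \<open>auto simp: is_inverse_def Hom_def\<close>)
  then have s: "s X = g \<bullet> m \<bullet> r"
    unfolding adj_alg_def center_rhobar_def l_def r_def m_def by simp
  show "s X \<in> Hom C (A \<otimes>\<^sub>C X) (X \<otimes>\<^sub>C A)" unfolding s by (simp add: Hom_def)
  assume N [simp]: "N \<in> Ob M"
  have "w N \<cdot> (s X \<rhd>\<^sub>a Ide M N) = w N \<cdot> (g \<rhd>\<^sub>a Ide M N) \<cdot> (m \<rhd>\<^sub>a Ide M N) \<cdot> (r \<rhd>\<^sub>a Ide M N)"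
    unfolding s by (simp add: act_comp_ide)
  also have "\<dots> = cl N \<cdot> (m \<rhd>\<^sub>a Ide M N) \<cdot> (r \<rhd>\<^sub>a Ide M N)"
    using comp_tail[OF g(2)[OF N, folded w_def], of "(m \<rhd>\<^sub>a Ide M N) \<cdot> (r \<rhd>\<^sub>a Ide M N)"] by simp
  also have "\<dots> = zr X N" using comp_tail[OF m(2)[OF N], of "r \<rhd>\<^sub>a Ide M N"] r(2)[OF N] by simp
  finally show "zl X N \<cdot> (s X \<rhd>\<^sub>a Ide M N) = zr X N" unfolding w_def .
qed

lemma s_ep: "X \<in> Ob C \<Longrightarrow> (Ide E' X \<otimes>\<^sub>a\<^bsub>E'\<^esub> ep) \<cdot>\<^bsub>E'\<^esub> J (s X) = ep \<otimes>\<^sub>a\<^bsub>E'\<^esub> Ide E' X"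
  unfolding E'_sel using zl_comp[OF _ s_transpose(1)] s_transpose(2) ep_tens(1) by (simp add: restrict_eq_iff del: trans_cat_sel(5,8))

lemma half_braiding_adj_alg: "half_braiding C A s"
  by (rule U.half_braiding_s[OF s_transpose(1) s_ep s_extensional])

lemma half_braidingD:
  assumes "half_braiding C Z t"
  shows "Z \<in> Ob C" "X \<in> Ob C \<Longrightarrow> t X \<in> Hom C (Z \<otimes>\<^sub>C X) (X \<otimes>\<^sub>C Z)" "X \<in> Ob C \<Longrightarrow> is_iso C (t X)"
  using assms unfolding half_braiding_def by blast+

lemma in_relative_center_iff:
  "(Z, t) \<in> Ob (relative_center V C G)
    \<longleftrightarrow> half_braiding C Z t \<and> (\<forall>W\<in>Ob V. hb W Z \<bullet> t (B W) = Ide C (Z \<otimes>\<^sub>C B W))"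
  unfolding relative_center_def full_subcat_def by (simp add: center_def)

text \<open>As an arrow of E' the counit commutes with the half-braiding of each G W. By
  \<open>s_inverse\<close> that half-braiding at A is then a right inverse of s, and since s is
  invertible it is also a left inverse.\<close>

lemma adj_alg_relative_center: "(A, s) \<in> Ob (relative_center V C G)"
  unfolding in_relative_center_iff
proof (intro conjI ballI half_braiding_adj_alg)
  fix W assume [simp]: "W \<in> Ob V"
  note iso = half_braidingD(2,3)[OF half_braiding_adj_alg B_ob[OF \<open>W \<in> Ob V\<close>]]
  note [simp] = iso(2) C.hom_arr[OF iso(1)] C.hom_dom[OF iso(1)] C.hom_cod[OF iso(1)]
  have "central_arr E S ep" using to_unit_hom_central[OF A_ob e_trans] by (simp add: E'_def wide_subcat_hom)
  then have "(ep \<otimes>\<^sub>a\<^bsub>E\<^esub> Ide E (B W)) \<cdot>\<^bsub>E\<^esub> J (hb W (Dom E ep)) = J (hb W (Cod E ep)) \<cdot>\<^bsub>E\<^esub> (Ide E (B W) \<otimes>\<^sub>a\<^bsub>E\<^esub> ep)"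
    unfolding central_arr_def S_def by (auto simp del: trans_cat_sel(4,5,8))
  then have "(ep \<otimes>\<^sub>a\<^bsub>E\<^esub> Ide E (B W)) \<cdot>\<^bsub>E\<^esub> J (hb W A) = J (Ide C (B W)) \<cdot>\<^bsub>E\<^esub> (Ide E (B W) \<otimes>\<^sub>a\<^bsub>E\<^esub> ep)"
    \<comment> \<open>At the target 1 of \<open>ep\<close> the half-braiding of G W is an
      identity.\<close>
    by (simp add: to_unit_def hb_unit del: trans_cat_sel(4,5,8))
  also have "\<dots> = Ide E (B W) \<otimes>\<^sub>a\<^bsub>E\<^esub> ep"
    unfolding ep_tens(2)[OF B_ob[OF \<open>W \<in> Ob V\<close>]] by (simp add: act_arr_def restrict_eq_iff)
  finally have eq: "(ep \<otimes>\<^sub>a\<^bsub>E'\<^esub> Ide E' (B W)) \<cdot>\<^bsub>E'\<^esub> J (hb W A) = Ide E' (B W) \<otimes>\<^sub>a\<^bsub>E'\<^esub> ep"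
    unfolding E'_sel .
  have "hb W A \<in> Hom C (B W \<otimes>\<^sub>C A) (A \<otimes>\<^sub>C B W)" by (simp add: Hom_def)
  from U.s_inverse[OF s_transpose(1) s_ep B_ob[OF \<open>W \<in> Ob V\<close>] this eq]
  have "s (B W) \<bullet> hb W A = Ide C (B W \<otimes>\<^sub>C A)" .
  then have "hb W A = inv_arr C (s (B W))" using C.iso_moveL[of "s (B W)" "hb W A"] by simp
  then show "hb W A \<bullet> s (B W) = Ide C (A \<otimes>\<^sub>C B W)" by simp
qed

section \<open>Terminality\<close>

lemma pair_objectD:
  assumes "pair_object V C M G ((Z, t), z)"
  shows "(Z, t) \<in> Ob (relative_center V C G)"
    and "N \<in> Ob M \<Longrightarrow> z N \<in> Hom M (Z \<rhd>\<^sub>o N) N"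
    and "f \<in> Hom M N N' \<Longrightarrow> z N' \<cdot> (Ide C Z \<rhd>\<^sub>a f) = f \<cdot> z N"
    and "X \<in> Ob C \<Longrightarrow> N \<in> Ob M \<Longrightarrow>
      z (X \<rhd>\<^sub>o N) \<cdot> Assoc M Z X N = (Ide C X \<rhd>\<^sub>a z N) \<cdot> Assoc M X Z N \<cdot> (t X \<rhd>\<^sub>a Ide M N)"
  using assms unfolding pair_object_def prod.case by blast+

text \<open>For Z in the relative center, its half-braiding at G W is inverse to that of G W at Z.
  The condition on pairs at X = G W is therefore exactly the module condition, and the universal
  property of A becomes applicable.\<close>

lemma pair_object_module_trans:
  assumes "pair_object V C M G ((Z, t), z)"
  shows "mtrans id_func (id_str RM) Z z"
proof -
  note rc = pair_objectD(1)[OF assms] and z = pair_objectD(2)[OF assms]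
    and nat = pair_objectD(3)[OF assms] and eq = pair_objectD(4)[OF assms]
  have hbt: "half_braiding C Z t" using rc by (simp add: in_relative_center_iff)
  note [simp] = half_braidingD(1)[OF hbt]
  have [simp]: "t X \<in> Arr C" "Cod C (t X) = X \<otimes>\<^sub>C Z" if "X \<in> Ob C" for X
    by (rule C.hom_arr[OF half_braidingD(2)[OF hbt that]] C.hom_cod[OF half_braidingD(2)[OF hbt that]])+
  have [simp]: "z N \<in> Arr M" "Dom M (z N) = Z \<rhd>\<^sub>o N" "Cod M (z N) = N" if "N \<in> Ob M" for N
    using z[OF that] by (auto simp: Hom_def)
  have "z (B W \<rhd>\<^sub>o N) = (Ide C (B W) \<rhd>\<^sub>a z N) \<cdot> sw Z W N" if [simp]: "W \<in> Ob V" "N \<in> Ob M" for W N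
  proof (rule iso_cancel_right[of "Assoc M Z (B W) N"])
    have "hb W Z \<bullet> t (B W) = Ide C (Z \<otimes>\<^sub>C B W)" using rc by (simp add: in_relative_center_iff)
    then have "t (B W) = tau W Z" using C.iso_moveL[of "hb W Z" "t (B W)"] by simp
    then show "z (B W \<rhd>\<^sub>o N) \<cdot> Assoc M Z (B W) N = ((Ide C (B W) \<rhd>\<^sub>a z N) \<cdot> sw Z W N) \<cdot> Assoc M Z (B W) N"
      using eq[of "B W" N] by (simp add: swap_assoc)
  qed simp_all
  then show ?thesis
    unfolding id_module_trans_iff using z nat[OF in_hom[OF _ refl refl]] by (intro conjI ballI)
qed

text \<open>The underlying arrow of the unique morphism comes from the universal property of e. It
  respects half-braidings automatically, and because the relative center is full it needs to satisfy
  nothing more.\<close>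

lemma terminal_adj_alg: "terminal (pair_category V C M G) ((A, s), \<lambda>N\<in>Ob M. e N)"
proof -
  let ?P = "pair_category V C M G" and ?T = "((A, s), \<lambda>N\<in>Ob M. e N)"
  have e_nat: "e (Cod M f) \<cdot> (Ide C A \<rhd>\<^sub>a f) = f \<cdot> e (Dom M f)" if "f \<in> Arr M" for f
    using e_trans that unfolding id_module_trans_iff by blast
  have s_act: "zr X N = (Ide C X \<rhd>\<^sub>a e N) \<cdot> Assoc M X A N \<cdot> (s X \<rhd>\<^sub>a Ide M N)"
    if [simp]: "X \<in> Ob C" "N \<in> Ob M" for X N
    using s_transpose[of X] by (simp add: Hom_def)
  have T: "pair_object V C M G ?T"
    unfolding pair_object_def using adj_alg_relative_center s_act e_nat
    by (auto simp: Hom_def)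
  have "\<exists>!f. f \<in> Hom ?P P ?T" if "P \<in> Ob ?P" for P
  proof -
    obtain Z t z where P: "P = ((Z, t), z)" by (metis surj_pair)
    have po: "pair_object V C M G ((Z, t), z)" using that by (simp add: pair_category_def P)
    have rc: "(Z, t) \<in> Ob (relative_center V C G)" by (rule pair_objectD(1)[OF po])
    have hbt: "half_braiding C Z t" using rc by (simp add: in_relative_center_iff)
    note Z [simp] = half_braidingD(1)[OF hbt]
    have mz: "mtrans id_func (id_str RM) Z z" by (rule pair_object_module_trans[OF po])
    have zh: "\<And>N. N \<in> Ob M \<Longrightarrow> z N \<in> Hom M (Z \<rhd>\<^sub>o N) N" using mz unfolding id_module_trans_iff by blast
    have ex: "\<exists>!f. f \<in> Hom C Z A \<and> (\<forall>N\<in>Ob M. e N \<cdot> (f \<rhd>\<^sub>a Ide M N) = z N)"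
      by (rule R_universal[OF id_module_endofunctor Z mz])
    \<comment> \<open>The condition on pairs for z is read as an equation in E', which is what
      \<open>universal_half_braiding\<close> requires.\<close>
    have center: "(Ide C X \<otimes>\<^sub>a\<^bsub>C\<^esub> f) \<bullet> t X = s X \<bullet> (f \<otimes>\<^sub>a\<^bsub>C\<^esub> Ide C X)"
      if f: "f \<in> Hom C Z A" "\<forall>N\<in>Ob M. e N \<cdot> (f \<rhd>\<^sub>a Ide M N) = z N" and X: "X \<in> Ob C" for f X
    proof (rule U.universal_half_braiding[OF s_transpose(1) s_ep X Z f(1)])
      show tX: "t X \<in> Hom C (Z \<otimes>\<^sub>C X) (X \<otimes>\<^sub>C Z)" by (rule half_braidingD(2)[OF hbt X])
      have ef: "ep \<cdot>\<^bsub>E'\<^esub> J f = to_unit C M Z z" unfolding E'_sel using ep_comp_iff[OF f(1) zh] f(2) by blast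
      have tens: "to_unit C M Z z \<otimes>\<^sub>a\<^bsub>E\<^esub> Ide E X = (Z \<otimes>\<^sub>C X, \<lambda>N\<in>Ob M. z (X \<rhd>\<^sub>o N) \<cdot> Assoc M Z X N, X)"
        "Ide E X \<otimes>\<^sub>a\<^bsub>E\<^esub> to_unit C M Z z = (X \<otimes>\<^sub>C Z, \<lambda>N\<in>Ob M. (Ide C X \<rhd>\<^sub>a z N) \<cdot> Assoc M X Z N, X)"
        by (rule to_unit_tens tens_to_unit; simp add: X zh)+
      have "z (X \<rhd>\<^sub>o N) \<cdot> Assoc M Z X N = (Ide C X \<rhd>\<^sub>a z N) \<cdot> Assoc M X Z N \<cdot> (t X \<rhd>\<^sub>a Ide M N)" if "N \<in> Ob M" for N
        by (rule pair_objectD(4)[OF po X that])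
      then have "((Ide C X \<rhd>\<^sub>a z N) \<cdot> Assoc M X Z N) \<cdot> (t X \<rhd>\<^sub>a Ide M N) = z (X \<rhd>\<^sub>o N) \<cdot> Assoc M Z X N" if "N \<in> Ob M" for N
        using that X zh[OF that] tX by (simp add: Hom_def)
      then show "(Ide E' X \<otimes>\<^sub>a\<^bsub>E'\<^esub> (ep \<cdot>\<^bsub>E'\<^esub> J f)) \<cdot>\<^bsub>E'\<^esub> J (t X) = (ep \<cdot>\<^bsub>E'\<^esub> J f) \<otimes>\<^sub>a\<^bsub>E'\<^esub> Ide E' X"
        unfolding ef unfolding E'_sel tens using C.hom_dom[OF tX]
        by (simp add: act_arr_def restrict_eq_iff)
    qed
    \<comment> \<open>Arrows carry their source and target; after these are stripped off, uniqueness
      is a statement about f alone.\<close>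
    have hom: "x \<in> Hom ?P P ?T \<longleftrightarrow> (\<exists>f. x = (P, ((Z, t), f, (A, s)), ?T) \<and>
        f \<in> Hom C Z A \<and> (\<forall>N\<in>Ob M. e N \<cdot> (f \<rhd>\<^sub>a Ide M N) = z N))" for x
    proof -
      have "x \<in> Hom ?P P ?T \<longleftrightarrow> (\<exists>y. x = (P, y, ?T) \<and> y \<in> Hom (relative_center V C G) (Z, t) (A, s) \<and>
        (\<forall>N\<in>Ob M. e N \<cdot> (center_arr y \<rhd>\<^sub>a Ide M N) = z N))"
        unfolding Hom_def[of ?P] using po T by (auto simp: pair_category_def P)
      also have "\<dots> \<longleftrightarrow> (\<exists>f. x = (P, ((Z, t), f, (A, s)), ?T) \<and>
        f \<in> Hom C Z A \<and> (\<forall>N\<in>Ob M. e N \<cdot> (f \<rhd>\<^sub>a Ide M N) = z N))"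
        using rc adj_alg_relative_center center hbt half_braiding_adj_alg
        unfolding relative_center_def full_subcat_Hom
        by (auto simp: C.in_center_hom center_arr_def full_subcat_def)
      finally show ?thesis .
    qed
    show ?thesis unfolding hom using ex by blast
  qed
  moreover have "?T \<in> Ob ?P" using T by (simp add: pair_category_def)
  ultimately show ?thesis unfolding terminal_def by blast
qed

end

theorem proposition4p16:
  fixes K :: "('k, 'r) ring_scheme"
    and V :: "('k, 'v, 'w) brcat"
    and D :: "('v, 'w) duality"
    and C :: "('k, 'o, 'a) moncat"
    and G :: "('v, 'w, ('o, 'a) cob, ('o, 'a) carr) monfunc"
    and M :: "('k, 'o, 'a, 'mo, 'ma) modcat"
    and H :: "('o, 'a, 'mo, 'ma) ihom"
    and R :: "('v, 'o, 'a, 'mo, 'ma) ends"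
  assumes "algebraically_closed K"
    and "braided_tensor_category K V"
    and "left_duality V D"
    and "tensor_category K C"
    and "braided_monoidal_functor V (center C) G"
    and "faithful V G"
    and "right_exact K V (center C) G"
    and "module_category K C M"
    and "internal_homs C M H"
    and "rhobar_ends K V D G C M H R"
  shows "terminal (pair_category V C M G)
    (adj_alg G C M H R,
     \<lambda>N\<in>Ob M. Phi H (IHom H N N) N N (Ide C (IHom H N N))
       \<cdot>\<^bsub>M\<^esub> (adj_alg_proj G C M R N \<rhd>\<^sub>a\<^bsub>M\<^esub> Ide M N))"
proof -
  interpret V: braided_tensor_category K V by fact
  interpret module_category K C M by fact
  interpret relative_ends K V C M G D H R
    by unfold_locales (use assms in \<open>simp_all add: braided_monoidal_functor_def\<close>)
  \<comment> \<open>The transformation in the theorem is the counit of the adjunction at the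
    identity functor.\<close>
  have "counit C M H R id_func (id_str (restrict_module G C M)) N
      = Phi H (IHom H N N) N N (Ide C (IHom H N N)) \<cdot>\<^bsub>M\<^esub> (adj_alg_proj G C M R N \<rhd>\<^sub>a\<^bsub>M\<^esub> Ide M N)" for N
    by (simp add: counit_def ihom_ev_def adj_alg_proj_def id_func_def)
  then show ?thesis using terminal_adj_alg by (simp add: adj_alg_eq[symmetric])
qed

end
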